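(* Let $l\in\mathbb N-\frac12$, $\tilde{\mathfrak g}=\tilde{\mathfrak g}^{(l)}$, and let $V$ be a simple weight $\tilde{\mathfrak g}$-module having at least one nonzero finite dimensional weight space. (i) If $z$ acts on $V$ as $0$, then $V\cong N^{\tilde{\mathfrak g}}$ for some simple weight $\mathfrak{sl}_2$-module $N$. (ii) If $z$ acts on $V$ as a nonzero scalar $\dot z$, then either (a) $V$ is a simple highest weight module or a simple lowest weight module, or (b) $l=\frac12$ and $V\cong D(a,\dot z)^{\tilde{\mathfrak g}^{(1/2)}}\otimes N^{\tilde{\mathfrak g}^{(1/2)}}$ for some $a\in\mathbb C\setminus\mathbb Z$ and some finite dimensional simple $\mathfrak{sl}_2$-module $N$.
   Context: For $l\in\mathbb N-\frac12$, $\tilde{\mathfrak g}^{(l)}$ is the complex Lie algebra with basis $e,h,f,p_0,\dots,p_{2l},z$ and brackets $[h,e]=2e$, $[h,f]=-2f$, $[e,f]=h$, $[h,p_k]=2(l-k)p_k$, $[e,p_k]=kp_{k-1}$, $[f,p_k]=(2l-k)p_{k+1}$ ($p_{-1}=p_{2l+1}=0$), $z$ central, $[p_k,p_{k'}]=\delta_{k+k',2l}(-1)^{k+l+\frac12}k!(2l-k)!\,z$. $\tilde{\mathcal H}^{(l)}=\mathrm{span}\{p_0,\dots,p_{2l},z\}$, $\mathfrak{sl}_2=\mathrm{span}\{e,h,f\}$. A weight module is one on which $h$ acts diagonalizably. With $\tilde{\mathfrak g}_0=\mathbb Ch+\mathbb Cz$, $\tilde{\mathfrak g}_+=\mathrm{span}\{e,p_k:k<l\}$,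 $\tilde{\mathfrak g}_-=\mathrm{span}\{f,p_k:k>l\}$, a highest (resp. lowest) weight module is one generated by a common eigenvector of $\tilde{\mathfrak g}_0$ annihilated by $\tilde{\mathfrak g}_+$ (resp. $\tilde{\mathfrak g}_-$). For an $\tilde{\mathcal H}^{(l)}$-module $M$ on which $z$ acts as a nonzero scalar, $M^{\tilde{\mathfrak g}}$ is $M$ with $\tilde{\mathfrak g}$-action pulled back along the algebra homomorphism $\Phi_l:U(\tilde{\mathfrak g})\to U(\tilde{\mathcal H}^{(l)})_{(z)}$ (localization at powers of $z$) that is the identity on $\tilde{\mathcal H}^{(l)}$ and sends $e\mapsto \frac{1}{z}\sum_{k=1}^{2l}(-1)^{k+l+\frac12}\frac{l-k}{(k-1)!(2l-k)!}p_{k-1}p_{2l-k}$, $f\mapsto \frac{1}{z}\sum_{k=1}^{2l}(-1)^{k+l-\frac12}\frac{l-k}{(k-1)!(2l-k)!}p_{k}p_{2l-k+1}$, $h\mapsto \frac{2}{z}\sum_{k=0}^{l-\frac12}(-1)^{k+l-\frac12}\frac{l-k}{k!(2l-k)!}p_{2l-k}p_k-\frac{(l+\frac12)^2}{2}$. For an $\mathfrak{sl}_2$-module $N$, $N^{\tilde{\mathfrak g}}$ is $N$ with $\tilde{\mathcal H}^{(l)}$ acting by $0$. For $\dot z\ne0$ and $a\in\mathbb C\setminus\mathbb Z$, $D(a,\dot z)$ is the $\tilde{\mathcal H}^{(1/2)}$-module $\mathbb C[x,x^{-1}]$ with $p_1x^i=x^{i+1}$, $p_0x^i=-\dot z(a+i)x^{i-1}$,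 $zx^i=\dot zx^i$ ($i\in\mathbb Z$). Tensor products carry the diagonal action. *)

theory Defs
  imports Complex_Main "HOL-Library.Function_Algebras"
begin

text \<open>The Lie algebra g~(l), l = m + 1/2 (m a natural number, so 2l = 2m+1).
  Basis: E, H, F, P 0, ..., P (2m+1), Z.\<close>

datatype gbasis = E | H | F | P nat | Z

definition gb :: "nat \<Rightarrow> gbasis set" where
  "gb m = {E, H, F, Z} \<union> P ` {..2*m+1}"

definition sl2b :: "gbasis set" where
  "sl2b = {E, H, F}"

text \<open>Structure constants: br m b b' lists (c, g) such that [b, b'] = sum of c * g.\<close>
fun br :: "nat \<Rightarrow> gbasis \<Rightarrow> gbasis \<Rightarrow> (complex \<times> gbasis) list" where
  "br m H E = [(2, E)]"
| "br m E H = [(-2, E)]"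
| "br m H F = [(-2, F)]"
| "br m F H = [(2, F)]"
| "br m E F = [(1, H)]"
| "br m F E = [(-1, H)]"
| "br m H (P k) = [(2 * (of_nat m + 1/2 - of_nat k), P k)]"
| "br m (P k) H = [(-2 * (of_nat m + 1/2 - of_nat k), P k)]"
| "br m E (P k) = (if k = 0 then [] else [(of_nat k, P (k - 1))])"
| "br m (P k) E = (if k = 0 then [] else [(- of_nat k, P (k - 1))])"
| "br m F (P k) = (if 2*m+1 \<le> k then [] else [(of_nat (2*m+1-k), P (k + 1))])"
| "br m (P k) F = (if 2*m+1 \<le> k then [] else [(- of_nat (2*m+1-k), P (k + 1))])"
| "br m (P k) (P k') = (if k + k' = 2*m+1
      then [((-1)^(k+m+1) * fact k * fact (2*m+1-k), Z)] else [])"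
| "br m _ _ = []"

definition rep_on :: "nat \<Rightarrow> gbasis set \<Rightarrow> (complex \<Rightarrow> 'v::ab_group_add \<Rightarrow> 'v) \<Rightarrow> 'v set
    \<Rightarrow> (gbasis \<Rightarrow> 'v \<Rightarrow> 'v) \<Rightarrow> bool" where
  "rep_on m B s C act \<longleftrightarrow> vector_space s \<and> module.subspace s C \<and>
     (\<forall>b\<in>B. \<forall>v\<in>C. act b v \<in> C) \<and>
     (\<forall>b\<in>B. \<forall>u\<in>C. \<forall>v\<in>C. act b (u + v) = act b u + act b v) \<and>
     (\<forall>b\<in>B. \<forall>c. \<forall>v\<in>C. act b (s c v) = s c (act b v)) \<and>
     (\<forall>b\<in>B. \<forall>b'\<in>B. \<forall>v\<in>C.
        act b (act b' v) - act b' (act b v) = sum_list (map (\<lambda>(c, g). s c (act g v)) (br m b b')))"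

definition invariant_subspace :: "gbasis set \<Rightarrow> (complex \<Rightarrow> 'v::ab_group_add \<Rightarrow> 'v) \<Rightarrow> 'v set
    \<Rightarrow> (gbasis \<Rightarrow> 'v \<Rightarrow> 'v) \<Rightarrow> 'v set \<Rightarrow> bool" where
  "invariant_subspace B s C act U \<longleftrightarrow> module.subspace s U \<and> U \<subseteq> C \<and> (\<forall>b\<in>B. \<forall>u\<in>U. act b u \<in> U)"

definition simple_rep :: "nat \<Rightarrow> gbasis set \<Rightarrow> (complex \<Rightarrow> 'v::ab_group_add \<Rightarrow> 'v) \<Rightarrow> 'v set
    \<Rightarrow> (gbasis \<Rightarrow> 'v \<Rightarrow> 'v) \<Rightarrow> bool" where
  "simple_rep m B s C act \<longleftrightarrow> rep_on m B s C act \<and> C \<noteq> {0} \<and>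
     (\<forall>U. invariant_subspace B s C act U \<longrightarrow> U = {0} \<or> U = C)"

abbreviation gmod :: "nat \<Rightarrow> (complex \<Rightarrow> 'v::ab_group_add \<Rightarrow> 'v) \<Rightarrow> 'v set \<Rightarrow> (gbasis \<Rightarrow> 'v \<Rightarrow> 'v) \<Rightarrow> bool" where
  "gmod m \<equiv> rep_on m (gb m)"

definition submodule_generated :: "gbasis set \<Rightarrow> (complex \<Rightarrow> 'v::ab_group_add \<Rightarrow> 'v) \<Rightarrow> 'v set
    \<Rightarrow> (gbasis \<Rightarrow> 'v \<Rightarrow> 'v) \<Rightarrow> 'v \<Rightarrow> 'v set" where
  "submodule_generated B s C act v = \<Inter>{U. invariant_subspace B s C act U \<and> v \<in> U}"

definition weight_space :: "(complex \<Rightarrow> 'v \<Rightarrow> 'v) \<Rightarrow> 'v set \<Rightarrow> (gbasis \<Rightarrow> 'v \<Rightarrow> 'v) \<Rightarrow> complex \<Rightarrow> 'v set" where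
  "weight_space s C act mu = {v\<in>C. act H v = s mu v}"

definition weight_module :: "(complex \<Rightarrow> 'v::ab_group_add \<Rightarrow> 'v) \<Rightarrow> 'v set \<Rightarrow> (gbasis \<Rightarrow> 'v \<Rightarrow> 'v) \<Rightarrow> bool" where
  "weight_module s C act \<longleftrightarrow> C \<subseteq> module.span s (\<Union>mu. weight_space s C act mu)"

definition fin_dim :: "(complex \<Rightarrow> 'v::ab_group_add \<Rightarrow> 'v) \<Rightarrow> 'v set \<Rightarrow> bool" where
  "fin_dim s W \<longleftrightarrow> (\<exists>B. finite B \<and> W \<subseteq> module.span s B)"

text \<open>Highest / lowest weight modules (g+ = span{e, p_k : k < l}, i.e. k \<le> m;
  g- = span{f, p_k : k > l}, i.e. m+1 \<le> k \<le> 2m+1; g0 = span{h, z}).\<close>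
definition hw_module :: "nat \<Rightarrow> (complex \<Rightarrow> 'v::ab_group_add \<Rightarrow> 'v) \<Rightarrow> 'v set \<Rightarrow> (gbasis \<Rightarrow> 'v \<Rightarrow> 'v) \<Rightarrow> bool" where
  "hw_module m s C act \<longleftrightarrow> gmod m s C act \<and> (\<exists>v\<in>C.
     (\<exists>\<mu>. act H v = s \<mu> v) \<and> (\<exists>\<zeta>. act Z v = s \<zeta> v) \<and>
     act E v = 0 \<and> (\<forall>k\<le>m. act (P k) v = 0) \<and>
     submodule_generated (gb m) s C act v = C)"

definition lw_module :: "nat \<Rightarrow> (complex \<Rightarrow> 'v::ab_group_add \<Rightarrow> 'v) \<Rightarrow> 'v set \<Rightarrow> (gbasis \<Rightarrow> 'v \<Rightarrow> 'v) \<Rightarrow> bool" where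
  "lw_module m s C act \<longleftrightarrow> gmod m s C act \<and> (\<exists>v\<in>C.
     (\<exists>\<mu>. act H v = s \<mu> v) \<and> (\<exists>\<zeta>. act Z v = s \<zeta> v) \<and>
     act F v = 0 \<and> (\<forall>k. m + 1 \<le> k \<and> k \<le> 2*m+1 \<longrightarrow> act (P k) v = 0) \<and>
     submodule_generated (gb m) s C act v = C)"

definition rep_iso :: "gbasis set \<Rightarrow> (complex \<Rightarrow> 'v::ab_group_add \<Rightarrow> 'v) \<Rightarrow> 'v set \<Rightarrow> (gbasis \<Rightarrow> 'v \<Rightarrow> 'v)
    \<Rightarrow> (complex \<Rightarrow> 'w::ab_group_add \<Rightarrow> 'w) \<Rightarrow> 'w set \<Rightarrow> (gbasis \<Rightarrow> 'w \<Rightarrow> 'w) \<Rightarrow> bool" where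
  "rep_iso B s1 C1 act1 s2 C2 act2 \<longleftrightarrow> (\<exists>\<phi>. bij_betw \<phi> C1 C2 \<and>
     (\<forall>u\<in>C1. \<forall>v\<in>C1. \<phi> (u + v) = \<phi> u + \<phi> v) \<and>
     (\<forall>c. \<forall>v\<in>C1. \<phi> (s1 c v) = s2 c (\<phi> v)) \<and>
     (\<forall>b\<in>B. \<forall>v\<in>C1. \<phi> (act1 b v) = act2 b (\<phi> v)))"

definition sl2_ext :: "(gbasis \<Rightarrow> 'v \<Rightarrow> 'v) \<Rightarrow> gbasis \<Rightarrow> 'v \<Rightarrow> 'v::zero" where
  "sl2_ext act b = (if b \<in> sl2b then act b else (\<lambda>_. 0))"

text \<open>M^g for an H~(l)-module M (action of p_k given by pk, z acting by zd \<noteq> 0),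
  pulled back along Phi_l.\<close>
definition ce :: "nat \<Rightarrow> nat \<Rightarrow> complex" where
  "ce m k = (-1)^(k+m+1) * (of_nat m + 1/2 - of_nat k) / (fact (k-1) * fact (2*m+1-k))"
definition cf :: "nat \<Rightarrow> nat \<Rightarrow> complex" where
  "cf m k = (-1)^(k+m) * (of_nat m + 1/2 - of_nat k) / (fact (k-1) * fact (2*m+1-k))"
definition ch :: "nat \<Rightarrow> nat \<Rightarrow> complex" where
  "ch m k = (-1)^(k+m) * (of_nat m + 1/2 - of_nat k) / (fact k * fact (2*m+1-k))"

definition pullback :: "nat \<Rightarrow> (complex \<Rightarrow> 'v::ab_group_add \<Rightarrow> 'v) \<Rightarrow> (nat \<Rightarrow> 'v \<Rightarrow> 'v) \<Rightarrow> complex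
    \<Rightarrow> gbasis \<Rightarrow> 'v \<Rightarrow> 'v" where
  "pullback m s pk zd b v = (case b of
      E \<Rightarrow> s (1/zd) (\<Sum>k\<in>{1..2*m+1}. s (ce m k) (pk (k-1) (pk (2*m+1-k) v)))
    | F \<Rightarrow> s (1/zd) (\<Sum>k\<in>{1..2*m+1}. s (cf m k) (pk k (pk (2*m+2-k) v)))
    | H \<Rightarrow> s (2/zd) (\<Sum>k\<in>{0..m}. s (ch m k) (pk (2*m+1-k) (pk k v)))
            + s (- (of_nat (m+1) * of_nat (m+1)) / 2) v
    | P k \<Rightarrow> pk k v
    | Z \<Rightarrow> s zd v)"

text \<open>The H~(1/2)-module D(a, zd) = C[x, x^-1], elements represented by their
  (finitely supported) coefficient functions int \<Rightarrow> complex; x^i is delta i.\<close>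
definition delta :: "int \<Rightarrow> int \<Rightarrow> complex" where
  "delta i = (\<lambda>j. if j = i then 1 else 0)"

definition D_scale :: "complex \<Rightarrow> (int \<Rightarrow> complex) \<Rightarrow> (int \<Rightarrow> complex)" where
  "D_scale c G = (\<lambda>j. c * G j)"

definition D_p :: "complex \<Rightarrow> complex \<Rightarrow> nat \<Rightarrow> (int \<Rightarrow> complex) \<Rightarrow> (int \<Rightarrow> complex)" where
  "D_p a zd k G = (if k = 1 then (\<lambda>j. G (j - 1))
     else if k = 0 then (\<lambda>j. - zd * (a + of_int (j + 1)) * G (j + 1))
     else (\<lambda>j. 0))"

definition Dg :: "complex \<Rightarrow> complex \<Rightarrow> gbasis \<Rightarrow> (int \<Rightarrow> complex) \<Rightarrow> (int \<Rightarrow> complex)" where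
  "Dg a zd = pullback 0 D_scale (D_p a zd) zd"

text \<open>Tensor product M \<otimes> N of a module M on C[x, x^-1] (coefficient functions, basis x^i)
  with a module N (carrier CN in 'v), realized as finitely supported functions
  int \<Rightarrow> CN (F corresponds to sum_i x^i \<otimes> F i), with diagonal action.\<close>
definition tens_carrier :: "'v::zero set \<Rightarrow> (int \<Rightarrow> 'v) set" where
  "tens_carrier CN = {G. finite {j. G j \<noteq> 0} \<and> (\<forall>j. G j \<in> CN)}"

definition tens_scale :: "(complex \<Rightarrow> 'v \<Rightarrow> 'v) \<Rightarrow> complex \<Rightarrow> (int \<Rightarrow> 'v) \<Rightarrow> (int \<Rightarrow> 'v)" where
  "tens_scale s c G = (\<lambda>j. s c (G j))"

definition tens_act :: "(complex \<Rightarrow> 'v::ab_group_add \<Rightarrow> 'v) \<Rightarrow> (gbasis \<Rightarrow> (int \<Rightarrow> complex) \<Rightarrow> (int \<Rightarrow> complex))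
    \<Rightarrow> (gbasis \<Rightarrow> 'v \<Rightarrow> 'v) \<Rightarrow> gbasis \<Rightarrow> (int \<Rightarrow> 'v) \<Rightarrow> (int \<Rightarrow> 'v)" where
  "tens_act s actM actN b G = (\<lambda>j. (\<Sum>i\<in>{i. G i \<noteq> 0}. s (actM b (delta i) j) (G i)) + actN b (G j))"

end

(*
  Each of e, f, p_k is ad-nilpotent, so on a simple module it is injective or locally nilpotent.
  If xE = Ex + cy with y commuting with x and xv = 0, then x^n E^n v = c^n n! y^n v while higher
  powers of x kill E^n v; such ladders produce infinitely many independent vectors in one weight
  space as soon as injective operators of opposite weights coexist in a forbidden pattern.

  For z = 0 the p_k commute, and these patterns leave only the case of a common kernel of all p_k,
  possibly reached through a highest or lowest weight vector; simplicity makes every p_k zero.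

  For z nonzero they force all p_k and e (k < l), or all p_k and f (k > l), to be locally
  nilpotent, whence a highest or lowest weight vector, unless l = 1/2 and both p_0 and p_1 are
  injective. Then -p_1 p_0 / z has an eigenvalue a on the finite-dimensional weight space, a is
  not an integer, the operators e - Phi(e), f - Phi(f), h - Phi(h) form a copy of sl_2 commuting
  with the Heisenberg part, and N is the a-eigenspace of -p_1 p_0 / z, translated by powers of p_1.
*)
theory Submission
  imports Defs "HOL-Computational_Algebra.Fundamental_Theorem_Algebra"
begin

text \<open>Only one weight space is known to be finite-dimensional, so the independence arguments
  must be carried into it, and only injective operators do that without loss. The weights in play
  differ by integers: \<open>e\<close> and \<open>f\<close> shift by 2, each \<open>p k\<close> by
  the odd number \<open>L - 2 * k\<close>. This parity gap is why exponents are chosen with such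
  care: an odd shift is repeated until the parity is right, and \<open>f\<close> then balances the
  remainder. For z = 0 the delicate point is that a lowest weight vector \<open>v\<close> is not
  visibly killed by the \<open>p k\<close> with \<open>k \<le> m\<close>. The last nonzero
  \<open>p j v\<close> would again be a lowest weight vector, of larger weight, and could never
  generate \<open>v\<close>. For z nonzero, non-integrality of \<open>a\<close> is what makes
  \<open>p1\<close> invertible, so that \<open>p1\<close> can play the role of multiplication by x.
  The eigenspace that becomes the sl2-module is spread over many weights; finite dimension comes
  from translating each of its weight components by its own number of steps into the one good weight
  space.\<close>

section \<open>Parity of weights and the matrix coefficients of D(a, zd)\<close>

text \<open>Used to reach weight 0 from weight \<open>n0\<close>: \<open>a j\<close> applications of
  an operator of odd weight \<open>\<alpha>\<close> and \<open>n j\<close> applications of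
  \<open>f\<close>. Strict growth gives infinitely many different routes.\<close>

lemma parity_solutions:
  fixes \<alpha> n0 :: int
  assumes "odd \<alpha>" "\<alpha> > 0"
  obtains a n :: "nat \<Rightarrow> nat" where "strict_mono a" "strict_mono n"
    "\<forall>j. n0 + int (a j) * \<alpha> = int (n j) * 2"
proof -
  define r :: nat where "r = (if odd n0 then 1 else 0)"
  \<comment> \<open>\<open>r\<close> copies the parity of \<open>n0\<close>, as
    \<open>\<alpha>\<close> is odd; the offset by the absolute value of \<open>n0\<close> keeps the
    total nonnegative, so \<open>nat\<close> below loses nothing.\<close>
  define a where "a j = 2 * (j + nat \<bar>n0\<bar>) + r" for j
  define n where "n j = nat ((n0 + int (a j) * \<alpha>) div 2)" for j
  have eq: "n0 + int (a j) * \<alpha> = int (n j) * 2" for j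
  proof -
    have ev: "even (n0 + int (a j) * \<alpha>)" using assms by (auto simp: a_def r_def)
    have "int (a j) \<ge> \<bar>n0\<bar>" by (simp add: a_def)
    moreover have "int (a j) * 1 \<le> int (a j) * \<alpha>" using assms(2) by (intro mult_left_mono) auto
    ultimately have "n0 + int (a j) * \<alpha> \<ge> 0" by linarith
    then show ?thesis using ev by (simp add: n_def)
  qed
  have "n j < n (Suc j)" for j
  proof -
    have "int (a (Suc j)) * \<alpha> = int (a j) * \<alpha> + 2 * \<alpha>" by (simp add: a_def algebra_simps)
    then show ?thesis using eq[of j] eq[of "Suc j"] assms(2) by linarith
  qed
  moreover have "strict_mono a" by (auto simp: strict_mono_Suc_iff a_def)
  ultimately show ?thesis using that[of a n] eq by (simp add: strict_mono_Suc_iff)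
qed

lemma delta_sum:
  fixes s :: "complex \<Rightarrow> 'v::ab_group_add \<Rightarrow> 'v" and G :: "int \<Rightarrow> 'v"
  assumes "vector_space s" "finite {i. G i \<noteq> 0}"
  shows "(\<Sum>i\<in>{i. G i \<noteq> 0}. s (c * delta i k) (G i)) = s c (G k)"
proof -
  interpret vs: vector_space s by fact
  have "(\<Sum>i\<in>{i. G i \<noteq> 0}. s (c * delta i k) (G i)) = (\<Sum>i\<in>{i. G i \<noteq> 0}. if i = k then s c (G i) else 0)"
    by (rule sum.cong) (auto simp: delta_def)
  also have "\<dots> = s c (G k)" using assms(2) by simp
  finally show ?thesis .
qed

text \<open>For l = 1/2 the map \<Phi> sends e to -p0^2/(2z), f to p1^2/(2z) and h to p1 p0/z - 1/2.
  Every coefficient is written as a factor in \<open>j\<close> times one shifted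
  \<open>delta\<close>, trivial factors and shifts included, because \<open>tens_act_formula\<close>
  matches this shape.\<close>

lemma Dg_delta:
  assumes "zd \<noteq> 0"
  shows "Dg a zd (P (Suc 0)) (delta i) j = 1 * delta i (j + (- 1))"
    and "Dg a zd (P 0) (delta i) j = - zd * (a + of_int (j + 1)) * delta i (j + 1)"
    and "Dg a zd Z (delta i) j = zd * delta i (j + 0)"
    and "Dg a zd E (delta i) j = - (zd / 2) * (a + of_int (j + 1)) * (a + of_int (j + 2)) * delta i (j + 2)"
    and "Dg a zd F (delta i) j = 1 / (2 * zd) * delta i (j + (- 2))"
    and "Dg a zd H (delta i) j = (- (a + of_int j) - 1 / 2) * delta i (j + 0)"
  using assms
  by (auto simp: Dg_def pullback_def D_p_def D_scale_def ce_def cf_def ch_def plus_fun_def field_simps)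

subsection \<open>Linear operators on a subspace\<close>

text \<open>Operators are total functions on the ambient type, but nothing is known about them off
  \<open>C\<close>; linearity, injectivity and nilpotency are therefore defined relative to
  \<open>C\<close>.\<close>

locale carrier_space = vector_space s
  for s :: "complex \<Rightarrow> 'v::ab_group_add \<Rightarrow> 'v" +
  fixes C :: "'v set"
  assumes subspace_C: "subspace C"
begin

text \<open>Dependence is stated for indexed families, since vectors built later are not known to be
  distinct; a repetition yields the relation with coefficients 1 and -1.\<close>

lemma fin_dim_relation:
  assumes "fin_dim s W"
  obtains d where "\<And>w::nat \<Rightarrow> 'v. (\<And>j. j \<le> d \<Longrightarrow> w j \<in> W) \<Longrightarrow>
    \<exists>c. (\<exists>j\<le>d. c j \<noteq> 0) \<and> (\<Sum>j\<le>d. s (c j) (w j)) = 0"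
proof -
  obtain B where B: "finite B" "W \<subseteq> span B"
    using assms unfolding fin_dim_def by auto
  have "\<exists>c. (\<exists>j\<le>card B. c j \<noteq> 0) \<and> (\<Sum>j\<le>card B. s (c j) (w j)) = 0"
    if w: "\<And>j. j \<le> card B \<Longrightarrow> w j \<in> W" for w :: "nat \<Rightarrow> 'v"
  proof (cases "inj_on w {..card B}")
    case True
    have "card (w ` {..card B}) = Suc (card B)"
      using True by (simp add: card_image)
    moreover have "w ` {..card B} \<subseteq> span B" using w B by auto
    ultimately have "dependent (w ` {..card B})"
      using independent_span_bound[OF B(1), of "w ` {..card B}"] by auto
    then obtain u where u: "\<exists>v\<in>w ` {..card B}. u v \<noteq> 0" "(\<Sum>v\<in>w ` {..card B}. s (u v) v) = 0"
      using dependent_finite[of "w ` {..card B}"] by auto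
    have "(\<Sum>j\<le>card B. s (u (w j)) (w j)) = 0"
      using u(2) by (simp add: sum.reindex[OF True])
    then show ?thesis using u(1) by (intro exI[of _ "\<lambda>j. u (w j)"]) auto
  next
    case False
    then obtain i j where ij: "i \<le> card B" "j \<le> card B" "i \<noteq> j" "w i = w j"
      unfolding inj_on_def by auto
    define c :: "nat \<Rightarrow> complex" where "c k = (if k = i then 1 else if k = j then -1 else 0)" for k
    have "(\<Sum>k\<le>card B. s (c k) (w k)) = (\<Sum>k\<in>{i, j}. s (c k) (w k))"
      by (rule sum.mono_neutral_right) (use ij in \<open>auto simp: c_def\<close>)
    also have "\<dots> = 0" using ij by (simp add: c_def)
    finally show ?thesis using ij by (intro exI[of _ c]) (auto simp: c_def)
  qed
  then show ?thesis using that by blast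
qed

lemma C_closed [simp, intro]:
  "0 \<in> C"
  "\<And>u v. u \<in> C \<Longrightarrow> v \<in> C \<Longrightarrow> u + v \<in> C"
  "\<And>u v. u \<in> C \<Longrightarrow> v \<in> C \<Longrightarrow> u - v \<in> C"
  "\<And>u. u \<in> C \<Longrightarrow> - u \<in> C"
  "\<And>c v. v \<in> C \<Longrightarrow> s c v \<in> C"
  "\<And>A g. (\<And>i. i \<in> A \<Longrightarrow> g i \<in> C) \<Longrightarrow> sum g A \<in> C"
  using subspace_C by (auto intro: subspace_0 subspace_add subspace_diff subspace_neg subspace_scale subspace_sum)

definition lin :: "('v \<Rightarrow> 'v) \<Rightarrow> bool" where
  "lin T \<longleftrightarrow> (\<forall>v\<in>C. T v \<in> C) \<and> (\<forall>u\<in>C. \<forall>v\<in>C. T (u + v) = T u + T v)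
     \<and> (\<forall>c. \<forall>v\<in>C. T (s c v) = s c (T v))"

lemma lin_C: "lin T \<Longrightarrow> v \<in> C \<Longrightarrow> T v \<in> C"
  and lin_add: "lin T \<Longrightarrow> u \<in> C \<Longrightarrow> v \<in> C \<Longrightarrow> T (u + v) = T u + T v"
  and lin_scale: "lin T \<Longrightarrow> v \<in> C \<Longrightarrow> T (s c v) = s c (T v)"
  by (auto simp: lin_def)

lemma lin_0: "lin T \<Longrightarrow> T 0 = 0"
  using lin_scale[of T 0 0] by simp

lemma lin_neg: "lin T \<Longrightarrow> v \<in> C \<Longrightarrow> T (- v) = - T v"
  using lin_scale[of T v "-1"] by simp

lemma lin_diff: "lin T \<Longrightarrow> u \<in> C \<Longrightarrow> v \<in> C \<Longrightarrow> T (u - v) = T u - T v"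
  using lin_add[of T u "- v"] lin_neg[of T v] by simp

lemma lin_sum: "lin T \<Longrightarrow> (\<And>i. i \<in> A \<Longrightarrow> g i \<in> C) \<Longrightarrow> T (sum g A) = (\<Sum>i\<in>A. T (g i))"
  by (induction A rule: infinite_finite_induct) (auto simp: lin_0 lin_add)

lemma lin_comp: "lin T \<Longrightarrow> lin S \<Longrightarrow> lin (\<lambda>v. T (S v))"
  by (auto simp: lin_def)

lemma lin_plus: "lin T \<Longrightarrow> lin S \<Longrightarrow> lin (\<lambda>v. T v + S v)"
  by (auto simp: lin_def scale_right_distrib)

lemma lin_minus: "lin T \<Longrightarrow> lin S \<Longrightarrow> lin (\<lambda>v. T v - S v)"
  by (auto simp: lin_def scale_right_diff_distrib)

lemma lin_smult: "lin T \<Longrightarrow> lin (\<lambda>v. s c (T v))"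
  by (auto simp: lin_def scale_right_distrib mult.commute)

lemma lin_id: "lin (\<lambda>v. v)"
  by (auto simp: lin_def)

lemma lin_pow: "lin T \<Longrightarrow> lin (T ^^ n)"
  by (induction n) (auto simp: lin_def)

lemma pow_commute:
  assumes "lin S" "\<And>u. u \<in> C \<Longrightarrow> T (S u) = S (T u)" "u \<in> C"
  shows "T ((S ^^ n) u) = (S ^^ n) (T u)"
proof (induction n)
  case (Suc n)
  then show ?case using assms lin_C[OF lin_pow[OF assms(1)]] by simp
qed simp

lemma pow_commute2:
  assumes "lin S" "lin T" "\<And>u. u \<in> C \<Longrightarrow> T (S u) = S (T u)" "u \<in> C"
  shows "(T ^^ k) ((S ^^ n) u) = (S ^^ n) ((T ^^ k) u)"
  by (rule pow_commute[OF assms(1) _ assms(4)])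
     (use pow_commute[OF assms(2), of S _ k] assms in auto)

section \<open>Injective and locally nilpotent operators; the ladder\<close>

definition injop :: "('v \<Rightarrow> 'v) \<Rightarrow> bool" where
  "injop T \<longleftrightarrow> (\<forall>v\<in>C. T v = 0 \<longrightarrow> v = 0)"

definition locnil :: "('v \<Rightarrow> 'v) \<Rightarrow> bool" where
  "locnil T \<longleftrightarrow> (\<forall>v\<in>C. \<exists>n. (T ^^ n) v = 0)"

lemma injop_pow:
  assumes "lin T" "injop T" "v \<in> C" "(T ^^ n) v = 0"
  shows "v = 0"
  using assms(4)
proof (induction n)
  case (Suc n)
  then show ?case using assms lin_C[OF lin_pow[OF assms(1), of n] assms(3)] by (auto simp: injop_def)
qed simp

lemma injopD: "injop T \<Longrightarrow> v \<in> C \<Longrightarrow> T v = 0 \<Longrightarrow> v = 0"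
  by (auto simp: injop_def)

text \<open>The last nonzero iterate of \<open>v\<close> is the required vector. \<open>X\<close> is
  any stable set, so common kernels of other operators can be used for it.\<close>

lemma locnil_kernel:
  assumes T: "lin T" "locnil T" and X: "X \<subseteq> C" "\<And>v. v \<in> X \<Longrightarrow> T v \<in> X" and v: "v \<in> X" "v \<noteq> 0"
  obtains u where "u \<in> X" "u \<noteq> 0" "T u = 0"
proof -
  obtain n where n: "(T ^^ n) v = 0" using assms unfolding locnil_def by blast
  define k where "k = (LEAST n. (T ^^ n) v = 0)"
  have k: "(T ^^ k) v = 0" unfolding k_def using n by (rule LeastI)
  have "k \<noteq> 0" using k v by (metis funpow_0)
  then obtain j where j: "k = Suc j" by (cases k) auto
  have nz: "(T ^^ j) v \<noteq> 0"
    using j not_less_Least[of j "\<lambda>n. (T ^^ n) v = 0"] unfolding k_def by auto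
  have "(T ^^ i) v \<in> X" for i by (induction i) (use X v in auto)
  then show ?thesis using that[of "(T ^^ j) v"] nz k j by auto
qed

text \<open>Each of the \<open>Suc n\<close> factors \<open>x\<close> contributes one commutator
  \<open>s c (y _)\<close>; these collect because \<open>y\<close> commutes with
  \<open>x\<close>.\<close>

lemma ladder_step:
  assumes x: "lin x" and y: "lin y" and g: "lin g"
    and xy: "\<And>u. u \<in> C \<Longrightarrow> x (y u) = y (x u)"
    and xg: "\<And>u. u \<in> C \<Longrightarrow> x (g u) = g (x u) + s c (y u)"
    and u: "u \<in> C"
  shows "(x ^^ Suc n) (g u) = g ((x ^^ Suc n) u) + s (of_nat (Suc n) * c) (y ((x ^^ n) u))"
proof (induction n)
  case 0
  then show ?case using xg u by simp
next
  case (Suc n)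
  have C: "(x ^^ k) u \<in> C" for k using u lin_C[OF lin_pow[OF x]] by blast
  have "(x ^^ Suc (Suc n)) (g u) = x (g ((x ^^ Suc n) u)) + x (s (of_nat (Suc n) * c) (y ((x ^^ n) u)))"
    using Suc lin_add[OF x] C[of "Suc n"] C[of n] lin_C[OF g] lin_C[OF y] by simp
  also have "x (g ((x ^^ Suc n) u)) = g ((x ^^ Suc (Suc n)) u) + s c (y ((x ^^ Suc n) u))"
    using xg[OF C[of "Suc n"]] by simp
  also have "x (s (of_nat (Suc n) * c) (y ((x ^^ n) u))) = s (of_nat (Suc n) * c) (y ((x ^^ Suc n) u))"
    using lin_scale[OF x] lin_C[OF y] C[of n] xy[OF C[of n]] by simp
  finally have "(x ^^ Suc (Suc n)) (g u) = g ((x ^^ Suc (Suc n)) u)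
      + s (c + of_nat (Suc n) * c) (y ((x ^^ Suc n) u))"
    by (simp only: add.assoc scale_left_distrib)
  moreover have "c + of_nat (Suc n) * c = of_nat (Suc (Suc n)) * c" by (simp add: algebra_simps)
  ultimately show ?case by simp
qed

text \<open>Induction through \<open>ladder_step\<close> at \<open>(g ^^ n) v\<close>: the term with
  \<open>g\<close> in front vanishes because \<open>x ^^ Suc n\<close> already kills that vector, so
  \<open>g\<close> never has to be moved past \<open>y\<close>.\<close>

lemma ladder:
  assumes x: "lin x" and y: "lin y" and g: "lin g"
    and xy: "\<And>u. u \<in> C \<Longrightarrow> x (y u) = y (x u)"
    and xg: "\<And>u. u \<in> C \<Longrightarrow> x (g u) = g (x u) + s c (y u)"
    and v: "v \<in> C" "x v = 0"
  shows "(x ^^ n) ((g ^^ n) v) = s (c ^ n * fact n) ((y ^^ n) v)"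
    and "k > n \<Longrightarrow> (x ^^ k) ((g ^^ n) v) = 0"
proof -
  have C: "(g ^^ k) v \<in> C" "(y ^^ k) v \<in> C" for k
    using v lin_C[OF lin_pow[OF g]] lin_C[OF lin_pow[OF y]] by blast+
  have "(x ^^ n) ((g ^^ n) v) = s (c ^ n * fact n) ((y ^^ n) v) \<and> (\<forall>k>n. (x ^^ k) ((g ^^ n) v) = 0)"
  proof (induction n)
    case 0
    have "(x ^^ k) v = 0" if "k > 0" for k
    proof -
      have "(x ^^ i) 0 = 0" for i using lin_0[OF lin_pow[OF x]] .
      then show ?thesis using v that by (cases k) (auto simp: funpow_swap1)
    qed
    then show ?case by simp
  next
    case (Suc n)
    have st: "(x ^^ Suc k) ((g ^^ Suc n) v)
        = g ((x ^^ Suc k) ((g ^^ n) v)) + s (of_nat (Suc k) * c) (y ((x ^^ k) ((g ^^ n) v)))" for k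
      using ladder_step[OF x y g xy xg C(1)[of n], of k] by simp
    have "(x ^^ k) ((g ^^ Suc n) v) = 0" if k: "k > Suc n" for k
    proof -
      obtain j where "k = Suc j" "j > n" using k by (cases k) auto
      then show ?thesis using st[of j] Suc lin_0[OF g] lin_0[OF y] by (simp del: funpow.simps)
    qed
    moreover have "(x ^^ Suc n) ((g ^^ Suc n) v) = s (c ^ Suc n * fact (Suc n)) ((y ^^ Suc n) v)"
    proof -
      have "(x ^^ Suc n) ((g ^^ Suc n) v) = s (of_nat (Suc n) * c) (y (s (c ^ n * fact n) ((y ^^ n) v)))"
        using st[of n] Suc lin_0[OF g] by (simp del: funpow.simps)
      also have "\<dots> = s (c ^ Suc n * fact (Suc n)) ((y ^^ Suc n) v)"
        using lin_scale[OF y C(2)[of n]] by (simp add: algebra_simps)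
      finally show ?thesis .
    qed
    ultimately show ?case by blast
  qed
  then show "(x ^^ n) ((g ^^ n) v) = s (c ^ n * fact n) ((y ^^ n) v)"
    and "k > n \<Longrightarrow> (x ^^ k) ((g ^^ n) v) = 0" by auto
qed

section \<open>Eigenvectors, spans and finite dimension\<close>

text \<open>Applying \<open>T - lam a\<close> removes the summand at \<open>a\<close> and rescales
  the others by nonzero factors. Summands may be zero, so the result also serves for expansions into
  eigencomponents.\<close>

lemma eigenvectors_independent:
  assumes T: "lin T" and A: "finite A" "inj_on lam A"
    and v: "\<And>i. i \<in> A \<Longrightarrow> v i \<in> C" "\<And>i. i \<in> A \<Longrightarrow> T (v i) = s (lam i) (v i)"
    and sum0: "(\<Sum>i\<in>A. v i) = 0" and i: "i \<in> A"
  shows "v i = 0"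
  using A v sum0 i
proof (induction A arbitrary: v i rule: finite_induct)
  case (insert a A)
  let ?w = "\<lambda>i. s (lam i - lam a) (v i)"
  have S: "v a + sum v A = 0" using insert by simp
  have "T (v a + sum v A) = s (lam a) (v a) + (\<Sum>i\<in>A. s (lam i) (v i))"
    using insert.prems(2,3) by (subst lin_add[OF T]) (auto simp: lin_sum[OF T])
  moreover have "T (v a + sum v A) = 0" using S lin_0[OF T] by simp
  ultimately have "0 = s (lam a) (v a) + (\<Sum>i\<in>A. s (lam i) (v i)) - s (lam a) (v a + sum v A)"
    unfolding S by (metis diff_self scale_zero_right)
  also have "\<dots> = (\<Sum>i\<in>A. s (lam i) (v i)) - (\<Sum>i\<in>A. s (lam a) (v i))"
    by (simp add: scale_right_distrib scale_sum_right)
  also have "\<dots> = sum ?w A" by (simp add: sum_subtractf[symmetric] scale_left_diff_distrib)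
  finally have "sum ?w A = 0" by simp
  moreover have "inj_on lam A" using insert.prems by auto
  ultimately have "?w j = 0" if "j \<in> A" for j
    using insert.prems that
    by (intro insert.IH[of ?w]) (auto simp: lin_scale[OF T] mult.commute)
  moreover have "lam j \<noteq> lam a" if "j \<in> A" for j
    using insert.prems(1) insert.hyps that by (auto simp: inj_on_def)
  ultimately have A0: "v j = 0" if "j \<in> A" for j using that by fastforce
  then have "v a = 0" using S by simp
  then show ?case using A0 insert.prems by auto
qed simp

definition pol_ap :: "('v \<Rightarrow> 'v) \<Rightarrow> complex poly \<Rightarrow> 'v \<Rightarrow> 'v" where
  "pol_ap T q u = (\<Sum>i\<le>degree q. s (coeff q i) ((T ^^ i) u))"

lemma pol_ap_bound:
  assumes "degree q \<le> n"
  shows "pol_ap T q u = (\<Sum>i\<le>n. s (coeff q i) ((T ^^ i) u))"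
  unfolding pol_ap_def
  by (rule sum.mono_neutral_left) (use assms in \<open>auto simp: coeff_eq_0\<close>)

lemma pol_ap_linear_factor:
  assumes T: "lin T" and u: "u \<in> C"
  shows "pol_ap T ([:- r, 1:] * q) u = T (pol_ap T q u) - s r (pol_ap T q u)"
proof -
  let ?n = "degree q"
  have C: "(T ^^ i) u \<in> C" for i using lin_C[OF lin_pow[OF T] u] .
  have eq: "[:- r, 1:] * q = smult (- r) q + pCons 0 q" by simp
  have "degree ([:- r, 1:] * q) \<le> Suc ?n"
    using degree_mult_le[of "[:- r, 1:]" q] by simp
  then have "pol_ap T ([:- r, 1:] * q) u
      = (\<Sum>i\<le>Suc ?n. s (coeff (smult (- r) q + pCons 0 q) i) ((T ^^ i) u))"
    using pol_ap_bound eq by metis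
  also have "\<dots> = (\<Sum>i\<le>Suc ?n. s (- r * coeff q i) ((T ^^ i) u))
      + (\<Sum>i\<le>Suc ?n. s (coeff (pCons 0 q) i) ((T ^^ i) u))"
    by (simp only: coeff_add coeff_smult scale_left_distrib sum.distrib)
  also have "(\<Sum>i\<le>Suc ?n. s (- r * coeff q i) ((T ^^ i) u)) = - s r (pol_ap T q u)"
    by (subst pol_ap_bound[of q "Suc ?n"]) (simp_all add: scale_sum_right sum_negf coeff_eq_0 scale_right_distrib)
  also have "(\<Sum>i\<le>Suc ?n. s (coeff (pCons 0 q) i) ((T ^^ i) u)) = T (pol_ap T q u)"
    unfolding pol_ap_def
    by (subst sum.atMost_Suc_shift) (use C in \<open>simp add: lin_sum[OF T] lin_scale[OF T]\<close>)
  finally show ?thesis by simp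
qed

text \<open>A relation among the iterates of one vector gives a nonzero polynomial \<open>q\<close>
  with \<open>q(T) u = 0\<close>. After splitting off a root, either the cofactor still kills
  \<open>u\<close> and has smaller degree, or its value at \<open>u\<close> is an
  eigenvector.\<close>

lemma eigenvector_exists:
  assumes T: "lin T" and W: "subspace W" "W \<subseteq> C" "\<And>v. v \<in> W \<Longrightarrow> T v \<in> W"
    and fd: "fin_dim s W" and nz: "W \<noteq> {0}"
  obtains v r where "v \<in> W" "v \<noteq> 0" "T v = s r v"
proof -
  obtain u where u: "u \<in> W" "u \<noteq> 0" using nz W(1) subspace_0 by blast
  obtain d where d: "\<And>w::nat \<Rightarrow> 'v. (\<And>j. j \<le> d \<Longrightarrow> w j \<in> W) \<Longrightarrow>
    \<exists>c. (\<exists>j\<le>d. c j \<noteq> 0) \<and> (\<Sum>j\<le>d. s (c j) (w j)) = 0"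
    using fin_dim_relation[OF fd] by blast
  have TW: "(T ^^ i) u \<in> W" for i by (induction i) (use u W in auto)
  then obtain c where c: "\<exists>j\<le>d. c j \<noteq> 0" "(\<Sum>j\<le>d. s (c j) ((T ^^ j) u)) = 0"
    using d[of "\<lambda>j. (T ^^ j) u"] by blast
  define q where "q = (\<Sum>j\<le>d. monom (c j) j)"
  have coeff: "coeff q i = (if i \<le> d then c i else 0)" for i
    by (auto simp: q_def coeff_sum)
  then have "q \<noteq> 0" using c(1) by (metis coeff_0)
  have "degree q \<le> d" by (rule degree_le) (simp add: coeff)
  then have "pol_ap T q u = 0"
    using c(2) pol_ap_bound[of q d T u] by (simp add: coeff)
  have "\<exists>v r. v \<in> W \<and> v \<noteq> 0 \<and> T v = s r v"
    using \<open>q \<noteq> 0\<close> \<open>pol_ap T q u = 0\<close>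
  proof (induction "degree q" arbitrary: q rule: less_induct)
    case less
    show ?case
    proof (cases "degree q = 0")
      case True
      then obtain a where "q = [:a:]" by (auto elim: degree_eq_zeroE)
      then show ?thesis using less.prems u by (simp add: pol_ap_def)
    next
      case False
      then have "\<not> constant (poly q)" by (simp add: constant_degree)
      then obtain r where "poly q r = 0" using fundamental_theorem_of_algebra by blast
      then obtain q' where q': "q = [:- r, 1:] * q'" unfolding poly_eq_0_iff_dvd by (auto simp: dvd_def)
      have "q' \<noteq> 0" using q' less.prems by auto
      then have deg: "degree q' < degree q" unfolding q' by (subst degree_mult_eq) auto
      have eig: "T (pol_ap T q' u) = s r (pol_ap T q' u)"
        using less.prems pol_ap_linear_factor[OF T, of u r q'] u W q' by auto
      show ?thesis
      proof (cases "pol_ap T q' u = 0")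
        case True
        then show ?thesis using less.hyps[OF deg] \<open>q' \<noteq> 0\<close> by blast
      next
        case False
        moreover have "pol_ap T q' u \<in> W"
          unfolding pol_ap_def using TW W(1) by (intro subspace_sum subspace_scale) auto
        ultimately show ?thesis using eig by blast
      qed
    qed
  qed
  then show ?thesis using that by blast
qed

lemma funpow_ident: "((\<lambda>v. v) ^^ n) v = v"
  by (induction n) auto

lemma injop_comp: "lin S \<Longrightarrow> injop T \<Longrightarrow> injop S \<Longrightarrow> injop (\<lambda>v. T (S v))"
  by (auto simp: injop_def lin_C)

lemma lin_span:
  assumes T: "lin T" and X: "X \<subseteq> C" "\<And>w. w \<in> X \<Longrightarrow> T w \<in> span X" and x: "x \<in> span X"
  shows "T x \<in> span X"
proof -
  have "x \<in> C \<and> T x \<in> span X"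
    using x
  proof (induction rule: span_induct_alt)
    case base
    then show ?case using lin_0[OF T] by (simp add: span_zero)
  next
    case (step c x y)
    then have "T (s c x + y) = s c (T x) + T y"
      using X(1) by (auto simp: lin_add[OF T] lin_scale[OF T])
    then show ?case using step X by (auto intro: span_add span_scale)
  qed
  then show ?thesis ..
qed

text \<open>Normal form with one summand per index and zero outside \<open>A\<close>, so that
  expansions can be compared componentwise.\<close>

lemma span_Union_subspaces:
  fixes S :: "int \<Rightarrow> 'v set"
  assumes S: "\<And>n. subspace (S n)" and x: "x \<in> span (\<Union>n\<in>N. S n)"
  shows "\<exists>A w. finite A \<and> A \<subseteq> N \<and> (\<forall>n. w n \<in> S n) \<and> (\<forall>n. n \<notin> A \<longrightarrow> w n = 0) \<and> x = (\<Sum>n\<in>A. w n)"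
  using x
proof (induction rule: span_induct_alt)
  case base
  show ?case by (intro exI[of _ "{}"] exI[of _ "\<lambda>n. 0"]) (auto intro: subspace_0 S)
next
  case (step c x y)
  then obtain A w n where A: "finite A" "A \<subseteq> N" "\<forall>n. w n \<in> S n" "\<forall>n. n \<notin> A \<longrightarrow> w n = 0" "y = (\<Sum>n\<in>A. w n)"
    and n: "n \<in> N" "x \<in> S n" by auto
  let ?w = "\<lambda>k. w k + (if k = n then s c x else 0)"
  have "(\<Sum>k\<in>insert n A. ?w k) = (\<Sum>k\<in>insert n A. w k) + s c x"
    using A(1) by (simp add: sum.distrib)
  also have "(\<Sum>k\<in>insert n A. w k) = sum w A"
    by (rule sum.mono_neutral_right) (use A in auto)
  finally have "(\<Sum>k\<in>insert n A. ?w k) = s c x + y" using A by simp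
  moreover have "\<forall>k. ?w k \<in> S k"
    using A n by (auto intro: subspace_add[OF S] subspace_scale[OF S])
  ultimately show ?case using A n by (intro exI[of _ "insert n A"] exI[of _ ?w]) auto
qed

lemma lin_image_subspace:
  assumes T: "lin T" and U: "subspace U" "U \<subseteq> C"
  shows "subspace (T ` U)"
proof (rule subspaceI)
  show "0 \<in> T ` U" by (rule image_eqI[of _ _ 0]) (simp_all add: lin_0[OF T] subspace_0[OF U(1)])
next
  fix x y assume "x \<in> T ` U" "y \<in> T ` U"
  then obtain u v where uv: "u \<in> U" "v \<in> U" "x = T u" "y = T v" by blast
  then have "u \<in> C" "v \<in> C" using U(2) by auto
  then have "x + y = T (u + v)" "u + v \<in> U"
    using uv lin_add[OF T, of u v] subspace_add[OF U(1)] by simp_all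
  then show "x + y \<in> T ` U" by blast
next
  fix c x assume "x \<in> T ` U"
  then obtain u where u: "u \<in> U" "x = T u" by blast
  then have "u \<in> C" using U(2) by auto
  then have "s c x = T (s c u)" "s c u \<in> U"
    using u lin_scale[OF T, of u c] subspace_scale[OF U(1)] by simp_all
  then show "s c x \<in> T ` U" by blast
qed

text \<open>Converse of \<open>fin_dim_relation\<close>: an infinite basis would contain
  \<open>Suc d\<close> independent vectors.\<close>

lemma fin_dim_if_relation:
  assumes rel: "\<And>w::nat \<Rightarrow> 'v. (\<And>j. j \<le> d \<Longrightarrow> w j \<in> W) \<Longrightarrow>
    \<exists>c. (\<exists>j\<le>d. c j \<noteq> 0) \<and> (\<Sum>j\<le>d. s (c j) (w j)) = 0"
  shows "fin_dim s W"
proof -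
  obtain B where B: "B \<subseteq> W" "independent B" "W \<subseteq> span B"
    by (rule maximal_independent_subset)
  have "finite B"
  proof (rule ccontr)
    assume "infinite B"
    then obtain T where T: "T \<subseteq> B" "finite T" "card T = Suc d"
      using infinite_arbitrarily_large[OF \<open>infinite B\<close>, of "Suc d"] by auto
    obtain g where g: "bij_betw g {0..<Suc d} T" using ex_bij_betw_nat_finite[OF T(2)] T(3) by auto
    have eq: "{0..<Suc d} = {..d}" by auto
    have g': "bij_betw g {..d} T" using g unfolding eq .
    have "g j \<in> W" if "j \<le> d" for j using bij_betwE[OF g'] that T B by auto
    from rel[of g, OF this] obtain c i where c: "i \<le> d" "c i \<noteq> 0" "(\<Sum>j\<le>d. s (c j) (g j)) = 0" by auto
    let ?u = "\<lambda>v. c (inv_into {..d} g v)"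
    note inj = bij_betw_imp_inj_on[OF g']
    have "(\<Sum>v\<in>T. s (?u v) v) = (\<Sum>j\<le>d. s (?u (g j)) (g j))"
      using sum.reindex_bij_betw[OF g', of "\<lambda>v. s (?u v) v"] by simp
    also have "\<dots> = (\<Sum>j\<le>d. s (c j) (g j))"
      by (rule sum.cong) (simp_all add: inv_into_f_f[OF inj])
    finally have "(\<Sum>v\<in>T. s (?u v) v) = 0" using c by simp
    moreover have "g i \<in> T" using bij_betwE[OF g'] c(1) by simp
    moreover have "?u (g i) \<noteq> 0" using c by (simp add: inv_into_f_f[OF inj])
    ultimately have "\<exists>u. (\<exists>v\<in>T. u v \<noteq> 0) \<and> (\<Sum>v\<in>T. s (u v) v) = 0"
      by (intro exI[of _ ?u] conjI bexI[of _ "g i"])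
    then have "dependent T" unfolding dependent_finite[OF T(2)] .
    then show False using independent_mono[OF B(2) T(1)] by simp
  qed
  then show ?thesis using B unfolding fin_dim_def by blast
qed

end

subsection \<open>Simple modules with a finite-dimensional weight space\<close>

text \<open>The central element is absent: it acts by a scalar, which is absorbed into
  \<open>\<kappa> k\<close>, the value of the commutator of \<open>p k\<close> and
  \<open>p (L - k)\<close>. The two halves of the theorem are the cases \<open>\<kappa> = 0\<close>
  and \<open>\<kappa>\<close> nowhere zero.\<close>

locale galilei_module = carrier_space s C
  for s :: "complex \<Rightarrow> 'v::ab_group_add \<Rightarrow> 'v" and C :: "'v set" +
  fixes m L :: nat and e f h :: "'v \<Rightarrow> 'v" and p :: "nat \<Rightarrow> 'v \<Rightarrow> 'v"
    and \<kappa> :: "nat \<Rightarrow> complex" and \<mu> :: complex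
  assumes L: "L = 2 * m + 1"
    and lin_e: "lin e" and lin_f: "lin f" and lin_h: "lin h"
    and lin_p: "k \<le> L \<Longrightarrow> lin (p k)"
    and he: "v \<in> C \<Longrightarrow> h (e v) = e (h v) + s 2 (e v)"
    and hf: "v \<in> C \<Longrightarrow> h (f v) = f (h v) - s 2 (f v)"
    and ef: "v \<in> C \<Longrightarrow> e (f v) = f (e v) + h v"
    and hp: "k \<le> L \<Longrightarrow> v \<in> C \<Longrightarrow> h (p k v) = p k (h v) + s (of_int (int L - 2 * int k)) (p k v)"
    and ep0: "v \<in> C \<Longrightarrow> e (p 0 v) = p 0 (e v)"
    and ep: "k < L \<Longrightarrow> v \<in> C \<Longrightarrow> e (p (Suc k) v) = p (Suc k) (e v) + s (of_nat (Suc k)) (p k v)"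
    and fpL: "v \<in> C \<Longrightarrow> f (p L v) = p L (f v)"
    and fp: "k < L \<Longrightarrow> v \<in> C \<Longrightarrow> f (p k v) = p k (f v) + s (of_nat (L - k)) (p (Suc k) v)"
    and pp: "k \<le> L \<Longrightarrow> j \<le> L \<Longrightarrow> v \<in> C \<Longrightarrow>
      p k (p j v) = p j (p k v) + (if k + j = L then s (\<kappa> k) v else 0)"
    and simple: "subspace U \<Longrightarrow> U \<subseteq> C \<Longrightarrow> (\<And>v. v \<in> U \<Longrightarrow> e v \<in> U) \<Longrightarrow> (\<And>v. v \<in> U \<Longrightarrow> f v \<in> U) \<Longrightarrow>
      (\<And>v. v \<in> U \<Longrightarrow> h v \<in> U) \<Longrightarrow> (\<And>k v. k \<le> L \<Longrightarrow> v \<in> U \<Longrightarrow> p k v \<in> U) \<Longrightarrow> U = {0} \<or> U = C"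
    and weight_nz: "{v \<in> C. h v = s \<mu> v} \<noteq> {0}"
    and weight_fd: "fin_dim s {v \<in> C. h v = s \<mu> v}"
begin

lemmas e_C [simp, intro] = lin_C[OF lin_e]
  and f_C [simp, intro] = lin_C[OF lin_f]
  and h_C [simp, intro] = lin_C[OF lin_h]
  and p_C [simp, intro] = lin_C[OF lin_p]

lemma pow_C [simp, intro]: "lin T \<Longrightarrow> v \<in> C \<Longrightarrow> (T ^^ n) v \<in> C"
  using lin_C[OF lin_pow] by blast

text \<open>The symmetry exchanging \<open>e\<close> with \<open>f\<close> and \<open>p k\<close> with \<open>p (L - k)\<close>, which turns
  statements about lowest weights into statements about highest weights.\<close>
lemma twist: "galilei_module s C m L f e (\<lambda>v. - h v) (\<lambda>k. p (L - k)) (\<lambda>k. \<kappa> (L - k)) (- \<mu>)"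
proof -
  show ?thesis
  proof (unfold_locales, goal_cases)
    case 4
    show ?case using lin_smult[OF lin_h, of "-1"] by simp
  next
    case (6 v)
    then show ?case by (simp add: hf lin_neg[OF lin_f])
  next
    case (7 v)
    then show ?case by (simp add: he lin_neg[OF lin_e])
  next
    case (8 v)
    then show ?case by (simp add: ef)
  next
    case (9 k v)
    then have "int L - 2 * int (L - k) = - (int L - 2 * int k)" by simp
    then show ?case
      using 9 hp[of "L - k" v] by (simp only: of_int_minus lin_neg[OF lin_p] h_C) (simp flip: scale_minus_left)
  next
    case (11 k v)
    then show ?case using fp[of "L - Suc k" v] by (simp add: Suc_diff_Suc)
  next
    case (13 k v)
    then show ?case using ep[of "L - Suc k" v] by (simp add: Suc_diff_Suc)
  next
    case (14 k j v)
    then have "L - k + (L - j) = L \<longleftrightarrow> k + j = L" by auto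
    then show ?case using 14 pp[of "L - k" "L - j" v] by simp
  next
    case (15 U)
    have "h v \<in> U" if "v \<in> U" for v
      using 15(5)[OF that] subspace_neg[OF 15(1), of "- h v"] by simp
    moreover have "p k v \<in> U" if "k \<le> L" "v \<in> U" for k v using 15(6)[of "L - k" v] that by simp
    ultimately show ?case using 15 simple[of U] by blast
  next
    case 1
    show ?case by (rule L)
  next
    case 16
    show ?case using weight_nz by simp
  next
    case 17
    show ?case using weight_fd by simp
  qed (simp_all add: fpL ep0 lin_e lin_f lin_p)
qed

section \<open>Weight components in the coset \<mu> + Z\<close>

text \<open>Weights are counted relative to \<open>\<mu>\<close>, so that \<open>G 0\<close> is the
  given finite-dimensional weight space.\<close>

definition G :: "int \<Rightarrow> 'v set" where
  "G n = {v \<in> C. h v = s (\<mu> + of_int n) v}"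

lemma G_C: "v \<in> G n \<Longrightarrow> v \<in> C" by (simp add: G_def)

lemma G_subspace: "subspace (G n)"
  by (auto intro!: subspaceI simp: G_def lin_0[OF lin_h] lin_add[OF lin_h] lin_scale[OF lin_h]
      scale_right_distrib mult.commute)

lemma G0: "fin_dim s (G 0)" "G 0 \<noteq> {0}"
  using weight_nz weight_fd by (simp_all add: G_def)

definition homog :: "int \<Rightarrow> ('v \<Rightarrow> 'v) \<Rightarrow> bool" where
  "homog d T \<longleftrightarrow> lin T \<and> (\<forall>v\<in>C. h (T v) = T (h v) + s (of_int d) (T v))"

lemma homog_G: "homog d T \<Longrightarrow> v \<in> G n \<Longrightarrow> T v \<in> G (n + d)"
  by (auto simp: homog_def G_def lin_C lin_scale scale_left_distrib[symmetric] add.assoc)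

lemma homog_G': "homog d T \<Longrightarrow> v \<in> G n \<Longrightarrow> k = n + d \<Longrightarrow> T v \<in> G k"
  using homog_G by blast

lemma homog_pow_G: "homog d T \<Longrightarrow> v \<in> G n \<Longrightarrow> k = n + int j * d \<Longrightarrow> (T ^^ j) v \<in> G k"
proof (induction j arbitrary: k)
  case (Suc j)
  then show ?case using homog_G'[of d T "(T ^^ j) v" "n + int j * d" k] by (auto simp: algebra_simps)
qed simp

lemma homog_e: "homog 2 e" and homog_f: "homog (- 2) f"
  and homog_p: "k \<le> L \<Longrightarrow> homog (int L - 2 * int k) (p k)"
  and homog_h: "homog 0 h"
  using he hf hp lin_e lin_f lin_h lin_p by (auto simp: homog_def)

lemma span_G_C: "span (\<Union>n\<in>N. G n) \<subseteq> C"
  using span_minimal[OF _ subspace_C] G_C by blast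

lemma homog_span_G:
  assumes "homog d T" "v \<in> span (\<Union>n. G n)"
  shows "T v \<in> span (\<Union>n. G n)"
proof -
  from span_Union_subspaces[OF G_subspace assms(2)]
  obtain A w where A: "finite A" "\<forall>n. w n \<in> G n" "v = (\<Sum>n\<in>A. w n)" by blast
  have wG: "w n \<in> G n" for n using A(2) by simp
  have "T v = (\<Sum>n\<in>A. T (w n))" unfolding A(3)
    by (rule lin_sum) (use assms G_C[OF wG] in \<open>auto simp: homog_def\<close>)
  moreover have "T (w n) \<in> span (\<Union>n. G n)" for n
    using homog_G[OF assms(1) wG] by (auto intro: span_base)
  ultimately show ?thesis by (simp add: span_sum)
qed

text \<open>All generators are homogeneous of integer weight, so the sum of the \<open>G n\<close>
  is a submodule; it contains the nonzero \<open>G 0\<close>.\<close>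

lemma C_eq_span_G: "C = span (\<Union>n. G n)"
proof -
  have "span (\<Union>n. G n) = {0} \<or> span (\<Union>n. G n) = C"
    by (rule simple) (use span_G_C[of UNIV] homog_span_G homog_e homog_f homog_h homog_p in \<open>blast intro: subspace_span\<close>)+
  moreover have "G 0 \<subseteq> span (\<Union>n. G n)" by (auto intro: span_base)
  ultimately show ?thesis using G0(2) subspace_0[OF G_subspace, of 0] by auto
qed

text \<open>The shift \<open>d\<close> lets the summands be images of weight components under an
  operator of weight \<open>d\<close>.\<close>

lemma G_sum_zero:
  assumes "finite A" "\<And>n. n \<in> A \<Longrightarrow> w n \<in> G (n + d)" "(\<Sum>n\<in>A. w n) = 0" "n \<in> A"
  shows "w n = 0"
  by (rule eigenvectors_independent[OF lin_h, of A "\<lambda>n. \<mu> + of_int (n + d)" w])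
     (use assms in \<open>auto simp: G_def inj_on_def\<close>)

text \<open>A homogeneous operator sends the weight components of \<open>v\<close> to different
  weights, so killing \<open>v\<close> means killing each component; any nonzero component will
  do.\<close>

lemma kernel_weight_vector:
  assumes T: "\<And>T. T \<in> Ts \<Longrightarrow> \<exists>d. homog d T" and v: "v \<in> C" "v \<noteq> 0" "\<And>T. T \<in> Ts \<Longrightarrow> T v = 0"
  shows "\<exists>n u. u \<in> G n \<and> u \<noteq> 0 \<and> (\<forall>T\<in>Ts. T u = 0)"
proof -
  have "v \<in> span (\<Union>n. G n)" using v C_eq_span_G by simp
  from span_Union_subspaces[OF G_subspace this]
  obtain A w where A: "finite A" "\<forall>n. w n \<in> G n" "v = (\<Sum>n\<in>A. w n)" by blast
  have wG: "w n \<in> G n" for n using A(2) by simp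
  obtain n where n: "n \<in> A" "w n \<noteq> 0" using v(2) A(3) by (metis sum.neutral)
  have "T (w n) = 0" if TTs: "T \<in> Ts" for T
  proof -
    obtain d where d: "homog d T" using T[OF TTs] by blast
    have "(\<Sum>n\<in>A. T (w n)) = T v" unfolding A(3)
      by (rule lin_sum[symmetric]) (use d G_C[OF wG] in \<open>auto simp: homog_def\<close>)
    then have "(\<Sum>n\<in>A. T (w n)) = 0" using v(3)[OF TTs] by simp
    then show ?thesis using G_sum_zero[OF A(1), of "\<lambda>n. T (w n)" d n] homog_G[OF d wG] n by simp
  qed
  then show ?thesis using n wG by blast
qed

text \<open>Triangularity gives independence: in a relation with last index \<open>i\<close>,
  \<open>T i\<close> removes every other term. Infinitely many independent vectors do not fit into
  \<open>G 0\<close>.\<close>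

lemma weight_zero_sequence_contradiction:
  fixes w :: "nat \<Rightarrow> 'v"
  assumes w: "\<And>j. w j \<in> G 0" and T: "\<And>i. lin (T i)"
    and 0: "\<And>i j. j < i \<Longrightarrow> T i (w j) = 0" and nz: "\<And>i. T i (w i) \<noteq> 0"
  shows False
proof -
  obtain d where d: "\<And>w::nat \<Rightarrow> 'v. (\<And>j. j \<le> d \<Longrightarrow> w j \<in> G 0) \<Longrightarrow>
    \<exists>c. (\<exists>j\<le>d. c j \<noteq> 0) \<and> (\<Sum>j\<le>d. s (c j) (w j)) = 0"
    using fin_dim_relation[OF G0(1)] by blast
  then obtain c where c: "\<exists>j\<le>d. c j \<noteq> 0" "(\<Sum>j\<le>d. s (c j) (w j)) = 0" using d[of w] w by blast
  define J where "J = {j. j \<le> d \<and> c j \<noteq> 0}"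
  have "finite J" "J \<noteq> {}" using c by (auto simp: J_def)
  define i where "i = Max J"
  have i: "i \<in> J" using Max_in[OF \<open>finite J\<close> \<open>J \<noteq> {}\<close>] by (simp add: i_def)
  have gt: "c j = 0" if "j \<le> d" "i < j" for j
    using Max_ge[OF \<open>finite J\<close>, of j] that unfolding i_def J_def by fastforce
  have "(\<Sum>j\<le>d. s (c j) (w j)) = (\<Sum>j\<le>i. s (c j) (w j))"
    by (rule sum.mono_neutral_right) (use gt i in \<open>auto simp: J_def\<close>)
  then have "0 = T i (\<Sum>j\<le>i. s (c j) (w j))" using c(2) lin_0[OF T[of i]] by simp
  also have "\<dots> = (\<Sum>j\<le>i. s (c j) (T i (w j)))"
    using G_C[OF w] by (simp add: lin_sum[OF T] lin_scale[OF T])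
  also have "\<dots> = (\<Sum>j\<in>{i}. s (c j) (T i (w j)))"
    by (rule sum.mono_neutral_right) (use 0 in auto)
  finally show False using i nz[of i] by (auto simp: J_def)
qed

subsection \<open>Injectivity or local nilpotency\<close>

definition nilset :: "('v \<Rightarrow> 'v) \<Rightarrow> 'v set" where
  "nilset b = {v \<in> C. \<exists>n. (b ^^ n) v = 0}"

lemma pow_zero_mono:
  assumes "lin b" "(b ^^ n) v = 0" "n \<le> k"
  shows "(b ^^ k) v = 0"
proof -
  have "(b ^^ k) v = (b ^^ (k - n)) ((b ^^ n) v)"
    using assms(3) by (metis comp_apply funpow_add le_add_diff_inverse2)
  then show ?thesis using assms lin_0[OF lin_pow[OF assms(1)]] by simp
qed

lemma nilset_subspace:
  assumes b: "lin b"
  shows "subspace (nilset b)"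
proof (rule subspaceI)
  show "0 \<in> nilset b" by (auto simp: nilset_def intro: exI[of _ 0])
next
  fix x y assume "x \<in> nilset b" "y \<in> nilset b"
  then obtain i j where "x \<in> C" "y \<in> C" "(b ^^ i) x = 0" "(b ^^ j) y = 0" by (auto simp: nilset_def)
  then have "(b ^^ (max i j)) (x + y) = 0"
    using pow_zero_mono[OF b] by (simp add: lin_add[OF lin_pow[OF b]])
  then show "x + y \<in> nilset b" using \<open>x \<in> C\<close> \<open>y \<in> C\<close> by (auto simp: nilset_def)
next
  fix c x assume "x \<in> nilset b"
  then obtain i where "x \<in> C" "(b ^^ i) x = 0" by (auto simp: nilset_def)
  then have "(b ^^ i) (s c x) = 0" by (simp add: lin_scale[OF lin_pow[OF b]])
  then show "s c x \<in> nilset b" using \<open>x \<in> C\<close> by (auto simp: nilset_def)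
qed

lemma nilset_back: "v \<in> C \<Longrightarrow> b v \<in> nilset b \<Longrightarrow> v \<in> nilset b"
  by (auto simp: nilset_def funpow_swap1 intro: exI[of _ "Suc _"])

text \<open>\<open>T'\<close> is the commutator of \<open>b\<close> and \<open>T\<close>. As
  \<open>b v\<close> is killed by one power fewer than \<open>v\<close>, induction covers
  \<open>T (b v)\<close>, hence \<open>b (T v)\<close>, hence \<open>T v\<close>. This is how
  ad-nilpotency is used.\<close>

lemma nilset_stable:
  assumes b: "lin b" and T: "lin T" and bT: "\<And>v. v \<in> C \<Longrightarrow> b (T v) = T (b v) + T' v"
    and T': "\<And>v. v \<in> nilset b \<Longrightarrow> T' v \<in> nilset b" and v: "v \<in> nilset b"
  shows "T v \<in> nilset b"
proof -
  obtain n where "v \<in> C" "(b ^^ n) v = 0" using v by (auto simp: nilset_def)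
  then show ?thesis
  proof (induction n arbitrary: v)
    case 0
    then show ?case using lin_0[OF T] subspace_0[OF nilset_subspace[OF b]] by simp
  next
    case (Suc n)
    have "T (b v) \<in> nilset b" using Suc lin_C[OF b] by (simp add: funpow_swap1)
    moreover have "T' v \<in> nilset b" using T' Suc.prems unfolding nilset_def by blast
    ultimately have "b (T v) \<in> nilset b"
      using bT[OF Suc.prems(1)] subspace_add[OF nilset_subspace[OF b]] by simp
    then show ?case using nilset_back lin_C[OF T] Suc.prems(1) by blast
  qed
qed

lemma injop_or_locnil:
  assumes b: "lin b" and "\<And>v. v \<in> nilset b \<Longrightarrow> e v \<in> nilset b" "\<And>v. v \<in> nilset b \<Longrightarrow> f v \<in> nilset b"
    "\<And>v. v \<in> nilset b \<Longrightarrow> h v \<in> nilset b" "\<And>k v. k \<le> L \<Longrightarrow> v \<in> nilset b \<Longrightarrow> p k v \<in> nilset b"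
  shows "injop b \<or> locnil b"
proof -
  have "nilset b = {0} \<or> nilset b = C"
    by (rule simple[OF nilset_subspace[OF b]]) (use assms in \<open>auto simp: nilset_def\<close>)
  moreover have "injop b" if "nilset b = {0}"
  proof -
    have "v = 0" if v: "v \<in> C" "b v = 0" for v
    proof -
      have "(b ^^ 1) v = 0" using v by simp
      then have "v \<in> nilset b" using v unfolding nilset_def by blast
      then show ?thesis using \<open>nilset b = {0}\<close> by simp
    qed
    then show ?thesis by (auto simp: injop_def)
  qed
  moreover have "locnil b" if "nilset b = C"
    using that by (auto simp: locnil_def nilset_def)
  ultimately show ?thesis by blast
qed

text \<open>The order \<open>e\<close>, \<open>h\<close>, \<open>f\<close>, \<open>p 0\<close>,
  \<open>p 1\<close>, ... is forced: the commutator of \<open>e\<close> with each generator is zero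
  or a multiple of one treated before.\<close>

lemma injop_or_locnil_e: "injop e \<or> locnil e"
proof (rule injop_or_locnil[OF lin_e])
  have sc: "s c v \<in> nilset e" if "v \<in> nilset e" for c v
    using subspace_scale[OF nilset_subspace[OF lin_e]] that by blast
  have ng: "- v \<in> nilset e" if "v \<in> nilset e" for v
    using subspace_neg[OF nilset_subspace[OF lin_e]] that by blast
  have z: "0 \<in> nilset e" using subspace_0[OF nilset_subspace[OF lin_e]] .
  show e: "e v \<in> nilset e" if "v \<in> nilset e" for v
    by (rule nilset_stable[OF lin_e lin_e, where T' = "\<lambda>v. 0"]) (use that z in auto)
  show h: "h v \<in> nilset e" if "v \<in> nilset e" for v
    by (rule nilset_stable[OF lin_e lin_h, where T' = "\<lambda>v. - s 2 (e v)"]) (use that sc ng e he in auto)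
  show "f v \<in> nilset e" if "v \<in> nilset e" for v
    by (rule nilset_stable[OF lin_e lin_f, where T' = h]) (use that h ef in auto)
  show "p k v \<in> nilset e" if "k \<le> L" "v \<in> nilset e" for k v
    using that
  proof (induction k arbitrary: v)
    case 0
    show ?case by (rule nilset_stable[OF lin_e lin_p, where T' = "\<lambda>v. 0"]) (use 0 z ep0 in auto)
  next
    case (Suc k)
    show ?case
      by (rule nilset_stable[OF lin_e lin_p, where T' = "\<lambda>v. s (of_nat (Suc k)) (p k v)"])
         (use Suc sc ep in auto)
  qed
qed

lemma injop_or_locnil_f: "injop f \<or> locnil f"
  using galilei_module.injop_or_locnil_e[OF twist] .

text \<open>The \<open>p k\<close> come first, as they commute with \<open>p j\<close> up to
  scalars; the commutators of \<open>p j\<close> with \<open>h\<close>, \<open>e\<close>,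
  \<open>f\<close> are then multiples of operators already treated.\<close>

lemma injop_or_locnil_p:
  assumes j: "j \<le> L"
  shows "injop (p j) \<or> locnil (p j)"
proof (rule injop_or_locnil[OF lin_p[OF j]])
  have sc: "s c v \<in> nilset (p j)" if "v \<in> nilset (p j)" for c v
    using subspace_scale[OF nilset_subspace[OF lin_p[OF j]]] that by blast
  have ng: "- v \<in> nilset (p j)" if "v \<in> nilset (p j)" for v
    using subspace_neg[OF nilset_subspace[OF lin_p[OF j]]] that by blast
  have z: "0 \<in> nilset (p j)" using subspace_0[OF nilset_subspace[OF lin_p[OF j]]] .
  show p: "p k v \<in> nilset (p j)" if "k \<le> L" "v \<in> nilset (p j)" for k v
    by (rule nilset_stable[OF lin_p[OF j] lin_p[OF that(1)] pp[OF j that(1)] _ that(2)]) (use z sc in auto)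
  show "h v \<in> nilset (p j)" if "v \<in> nilset (p j)" for v
    by (rule nilset_stable[OF lin_p[OF j] lin_h, where T' = "\<lambda>v. - s (of_int (int L - 2 * int j)) (p j v)"])
       (use that z sc ng p hp j in auto)
  show "e v \<in> nilset (p j)" if "v \<in> nilset (p j)" for v
  proof (cases j)
    case 0
    show ?thesis
      by (rule nilset_stable[OF lin_p[OF j] lin_e, where T' = "\<lambda>v. 0"]) (use that z ep0 0 in auto)
  next
    case (Suc i)
    show ?thesis
      by (rule nilset_stable[OF lin_p[OF j] lin_e, where T' = "\<lambda>v. - s (of_nat j) (p i v)"])
         (use that Suc j p sc ng ep in auto)
  qed
  show "f v \<in> nilset (p j)" if "v \<in> nilset (p j)" for v
  proof (cases "j = L")
    case True
    show ?thesis
      by (rule nilset_stable[OF lin_p[OF j] lin_f, where T' = "\<lambda>v. 0"]) (use that z fpL True in auto)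
  next
    case False
    show ?thesis
      by (rule nilset_stable[OF lin_p[OF j] lin_f, where T' = "\<lambda>v. - s (of_nat (L - j)) (p (Suc j) v)"])
         (use that False j p sc ng fp in auto)
  qed
qed

section \<open>Common kernels and lowest weight vectors\<close>

text \<open>The common kernel of the operators handled so far is stable under the next one, which
  commutes with them and is locally nilpotent.\<close>

lemma common_kernel:
  assumes J: "finite J" "J \<subseteq> {..L}" and nil: "\<And>k. k \<in> J \<Longrightarrow> locnil (p k)"
    and com: "\<And>j k v. j \<in> J \<Longrightarrow> k \<in> J \<Longrightarrow> v \<in> C \<Longrightarrow> p j (p k v) = p k (p j v)"
  obtains u where "u \<in> C" "u \<noteq> 0" "\<And>k. k \<in> J \<Longrightarrow> p k u = 0"
proof -
  have "\<exists>u. u \<in> C \<and> u \<noteq> 0 \<and> (\<forall>k\<in>J. p k u = 0)"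
    using assms
  proof (induction J rule: finite_induct)
    case empty
    obtain u where "u \<in> G 0" "u \<noteq> 0" using G0 subspace_0[OF G_subspace, of 0] by blast
    then show ?case using G_C by blast
  next
    case (insert j J)
    then obtain u where u: "u \<in> C" "u \<noteq> 0" "\<forall>k\<in>J. p k u = 0" by auto
    have lj: "lin (p j)" "locnil (p j)" using insert.prems lin_p by auto
    have "p k (p j v) = 0" if "v \<in> C" "\<forall>k\<in>J. p k v = 0" "k \<in> J" for k v
      using insert.prems(3)[of k j v] that lin_0[OF lj(1)] by simp
    then obtain w where "w \<in> {v\<in>C. \<forall>k\<in>J. p k v = 0}" "w \<noteq> 0" "p j w = 0"
      by (rule_tac locnil_kernel[OF lj, of "{v\<in>C. \<forall>k\<in>J. p k v = 0}" u])
         (use u lin_C[OF lj(1)] in auto)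
    then show ?case by auto
  qed
  then show ?thesis using that by blast
qed

lemma p_commute: "j \<le> L \<Longrightarrow> k \<le> L \<Longrightarrow> j + k \<noteq> L \<Longrightarrow> v \<in> C \<Longrightarrow> p j (p k v) = p k (p j v)"
  using pp[of j k v] by simp

lemma pf: "k < L \<Longrightarrow> v \<in> C \<Longrightarrow> p k (f v) = f (p k v) + s (- of_nat (L - k)) (p (Suc k) v)"
  using fp[of k v] by (simp only: scale_minus_left) simp

lemma pe: "k < L \<Longrightarrow> v \<in> C \<Longrightarrow> p (Suc k) (e v) = e (p (Suc k) v) + s (- of_nat (Suc k)) (p k v)"
  using ep[of k v] by (simp only: scale_minus_left) simp

lemma nonzero_C: obtains u where "u \<in> C" "u \<noteq> 0"
  using G0 subspace_0[OF G_subspace, of 0] G_C by blast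

lemma locnil_weight_vector:
  assumes "k \<le> L" "locnil (p k)"
  obtains n v where "v \<in> G n" "v \<noteq> 0" "p k v = 0"
proof -
  obtain u where u: "u \<in> C" "u \<noteq> 0" using nonzero_C .
  obtain v where "v \<in> C" "v \<noteq> 0" "p k v = 0"
    using locnil_kernel[OF lin_p[OF assms(1)] assms(2), of C u] u assms(1) by auto
  then show ?thesis
    using kernel_weight_vector[of "{p k}" v] homog_p[OF assms(1)] that by (metis singletonD singletonI)
qed

lemma negative_kernel:
  assumes nil: "\<And>k. m < k \<Longrightarrow> k \<le> L \<Longrightarrow> locnil (p k)"
  obtains n v where "v \<in> G n" "v \<noteq> 0" "\<And>k. m < k \<Longrightarrow> k \<le> L \<Longrightarrow> p k v = 0"
proof -
  have "\<exists>u. u \<in> C \<and> u \<noteq> 0 \<and> (\<forall>k\<in>{m<..L}. p k u = 0)"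
    \<comment> \<open>Two indices above \<open>m\<close> add up to more than \<open>L\<close>, so
      these operators commute whatever \<open>\<kappa>\<close> is.\<close>
    by (rule common_kernel[of "{m<..L}"]) (use nil L p_commute in auto)
  then obtain u where u: "u \<in> C" "u \<noteq> 0" "\<forall>k\<in>{m<..L}. p k u = 0" by blast
  have hom: "\<exists>d. homog d T" if "T \<in> p ` {m<..L}" for T
  proof -
    have "\<exists>k\<le>L. T = p k" using that by auto
    then show ?thesis using homog_p by blast
  qed
  have Tu: "T u = 0" if "T \<in> p ` {m<..L}" for T using u that by auto
  have "\<exists>n v. v \<in> G n \<and> v \<noteq> 0 \<and> (\<forall>T\<in>p ` {m<..L}. T v = 0)"
    by (rule kernel_weight_vector[OF _ u(1,2)]) (erule hom, erule Tu)
  then obtain n v where "v \<in> G n" "v \<noteq> 0" "\<forall>T\<in>p ` {m<..L}. T v = 0" by blast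
  then show ?thesis using that by auto
qed

lemma negative_kernel_f:
  assumes v: "v \<in> C" and k0: "\<And>k. m < k \<Longrightarrow> k \<le> L \<Longrightarrow> p k v = 0" and k: "m < k" "k \<le> L"
  shows "p k (f v) = 0"
proof (cases "k = L")
  case True
  then show ?thesis using fpL[OF v] k0[of L] k lin_0[OF lin_f] by simp
next
  case False
  then show ?thesis using pf[of k v] v k0[of k] k0[of "Suc k"] k lin_0[OF lin_f] by simp
qed

lemma lowest_vector_exists:
  assumes nil: "\<And>k. m < k \<Longrightarrow> k \<le> L \<Longrightarrow> locnil (p k)" and f: "locnil f"
  obtains n v where "v \<in> G n" "v \<noteq> 0" "f v = 0" "\<And>k. m < k \<Longrightarrow> k \<le> L \<Longrightarrow> p k v = 0"
proof -
  obtain n v where v: "v \<in> G n" "v \<noteq> 0" "\<And>k. m < k \<Longrightarrow> k \<le> L \<Longrightarrow> p k v = 0"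
    using negative_kernel[OF nil] by blast
  define K where "K = {v \<in> C. \<forall>k. m < k \<and> k \<le> L \<longrightarrow> p k v = 0}"
  have "f w \<in> K" if "w \<in> K" for w using that negative_kernel_f[of w] by (simp add: K_def)
  then obtain u where u: "u \<in> K" "u \<noteq> 0" "f u = 0"
    using locnil_kernel[OF lin_f f, of K v] v G_C by (auto simp: K_def)
  have uC: "u \<in> C" using u by (simp add: K_def)
  have hom: "\<exists>d. homog d T" if "T \<in> insert f (p ` {m<..L})" for T
  proof -
    have "T = f \<or> (\<exists>k\<le>L. T = p k)" using that by auto
    then show ?thesis using homog_p homog_f by blast
  qed
  have Tu: "T u = 0" if "T \<in> insert f (p ` {m<..L})" for T using that u by (auto simp: K_def)
  have "\<exists>n w. w \<in> G n \<and> w \<noteq> 0 \<and> (\<forall>T\<in>insert f (p ` {m<..L}). T w = 0)"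
    by (rule kernel_weight_vector[OF _ uC u(2)]) (erule hom, erule Tu)
  then obtain n w where "w \<in> G n" "w \<noteq> 0" "\<forall>T\<in>insert f (p ` {m<..L}). T w = 0" by blast
  then show ?thesis using that by auto
qed

subsection \<open>Nonzero central charge\<close>

text \<open>Heisenberg ladder with \<open>y\<close> the identity: \<open>p k ^^ j\<close> would send
  \<open>(p (L - k) ^^ j) v\<close>, which is zero for a suitable \<open>j\<close>, to a nonzero
  multiple of \<open>v\<close>.\<close>

lemma not_both_locnil:
  assumes k: "k \<le> L" and \<kappa>: "\<kappa> k \<noteq> 0" and nil: "locnil (p k)" "locnil (p (L - k))"
  shows False
proof -
  obtain n v where v: "v \<in> G n" "v \<noteq> 0" "p k v = 0" using locnil_weight_vector[OF k nil(1)] .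
  note vC = G_C[OF v(1)]
  obtain j where j: "(p (L - k) ^^ j) v = 0" using nil(2) vC by (auto simp: locnil_def)
  have "p k (p (L - k) u) = p (L - k) (p k u) + s (\<kappa> k) u" if "u \<in> C" for u
    using pp[of k "L - k" u] k that by simp
  from ladder(1)[OF lin_p[OF k] lin_id lin_p[of "L - k"] _ this vC v(3), of j]
  have "s (\<kappa> k ^ j * fact j) v = 0"
    using j lin_0[OF lin_pow[OF lin_p[OF k]]] by (simp add: funpow_ident)
  then show False using \<kappa> v(2) by simp
qed

text \<open>\<open>N\<close> is the number operator of the pair \<open>p i\<close>,
  \<open>p (L - i)\<close>. Applying \<open>p i\<close> moves its eigenvalue by
  \<open>\<kappa> (L - i)\<close>, while \<open>p j\<close> commutes with it; weight-neutral
  products of powers of both therefore produce infinitely many eigenvalues of \<open>N\<close> on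
  \<open>G 0\<close>.\<close>

lemma opposite_not_both_injective:
  assumes ij: "i \<le> m" "m < j" "j \<le> L" "i + j \<noteq> L" and \<kappa>: "\<kappa> (L - i) \<noteq> 0"
    and inj: "injop (p i)" "injop (p j)"
  shows False
proof -
  have iL: "i \<le> L" "L - i \<le> L" using ij L by auto
  define N where "N = (\<lambda>v. p (L - i) (p i v))"
  have lin_N: "lin N" unfolding N_def by (rule lin_comp[OF lin_p[OF iL(2)] lin_p[OF iL(1)]])
  have N_G: "N v \<in> G 0" if "v \<in> G 0" for v
    unfolding N_def
    using homog_G'[OF homog_p[OF iL(2)] homog_G[OF homog_p[OF iL(1)] that], of 0] iL by simp
  obtain u lam where u: "u \<in> G 0" "u \<noteq> 0" "N u = s lam u"
    using eigenvector_exists[OF lin_N G_subspace _ N_G G0] G_C by blast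
  have Ni: "N (p i v) = p i (N v) + s (\<kappa> (L - i)) (p i v)" if "v \<in> C" for v
    using pp[of "L - i" i "p i v"] iL that by (simp add: N_def)
  have Nj: "N (p j v) = p j (N v)" if "v \<in> C" for v
    using p_commute[of i j v] p_commute[of "L - i" j "p i v"] ij iL that L by (simp add: N_def)
  have Ni_pow: "N ((p i ^^ n) v) = s (lam + of_nat n * \<kappa> (L - i)) ((p i ^^ n) v)"
    if "v \<in> C" "N v = s lam v" for v n
  proof (induction n)
    case (Suc n)
    have "(p i ^^ n) v \<in> C" using that iL lin_p by auto
    then have "N ((p i ^^ Suc n) v) = s (lam + of_nat n * \<kappa> (L - i)) ((p i ^^ Suc n) v)
        + s (\<kappa> (L - i)) ((p i ^^ Suc n) v)"
      using Ni[of "(p i ^^ n) v"] Suc iL by (simp add: lin_scale[OF lin_p])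
    then show ?case by (simp add: scale_left_distrib algebra_simps)
  qed (use that in simp)
  \<comment> \<open>Chosen so that the weights of \<open>p i ^^ (a * n)\<close> and
    \<open>p j ^^ (b * n)\<close> cancel.\<close>
  define a where "a = nat (2 * int j - int L)"
  define b where "b = nat (int L - 2 * int i)"
  have ab: "int a = 2 * int j - int L" "int b = int L - 2 * int i" "a > 0"
    using ij L by (auto simp: a_def b_def)
  define w where "w n = (p i ^^ (a * n)) ((p j ^^ (b * n)) u)" for n
  have pjC: "(p j ^^ n) u \<in> C" for n using u G_C ij lin_p by auto
  have wG: "w n \<in> G 0" for n
    unfolding w_def
    by (rule homog_pow_G[OF homog_p[OF iL(1)] homog_pow_G[OF homog_p[OF ij(3)] u(1) refl]])
       (simp add: ab algebra_simps)
  have wnz: "w n \<noteq> 0" for n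
    using injop_pow[OF lin_p[OF iL(1)] inj(1) pjC] injop_pow[OF lin_p[OF ij(3)] inj(2) G_C[OF u(1)]] u(2)
    unfolding w_def by blast
  have Npj: "N ((p j ^^ n) u) = (p j ^^ n) (N u)" for n
    by (rule pow_commute[OF lin_p[OF ij(3)] _ G_C[OF u(1)]]) (rule Nj)
  have Nw: "N (w n) = s (lam + of_nat (a * n) * \<kappa> (L - i)) (w n)" for n
    unfolding w_def
    by (rule Ni_pow[OF pjC]) (use Npj u G_C ij in \<open>simp add: lin_scale[OF lin_pow[OF lin_p]]\<close>)
  obtain d where d: "\<And>w::nat \<Rightarrow> 'v. (\<And>j. j \<le> d \<Longrightarrow> w j \<in> G 0) \<Longrightarrow>
    \<exists>c. (\<exists>j\<le>d. c j \<noteq> 0) \<and> (\<Sum>j\<le>d. s (c j) (w j)) = 0"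
    using fin_dim_relation[OF G0(1)] by blast
  then obtain c n where c: "n \<le> d" "c n \<noteq> 0" "(\<Sum>j\<le>d. s (c j) (w j)) = 0" using d[of w] wG by blast
  have "s (c n) (w n) = 0"
    by (rule eigenvectors_independent[OF lin_N, of "{..d}" "\<lambda>n. lam + of_nat (a * n) * \<kappa> (L - i)"])
       (use c Nw G_C[OF wG] ab \<kappa> in \<open>auto simp: inj_on_def lin_scale[OF lin_N] mult.commute\<close>)
  then show False using c wnz by simp
qed

text \<open>For injective \<open>f\<close>, the vectors \<open>(f ^^ i) v\<close> are nonzero and
  still killed by every \<open>p k\<close> with \<open>k > m\<close>. Brought to weight 0 by powers
  of \<open>p 0\<close>, they form a triangular sequence for the powers of \<open>p L\<close>, by
  the Heisenberg ladder.\<close>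

lemma locnil_f_if_charged:
  assumes \<kappa>: "\<kappa> L \<noteq> 0" and nil: "\<And>k. m < k \<Longrightarrow> k \<le> L \<Longrightarrow> locnil (p k)"
  shows "locnil f"
proof (rule ccontr)
  assume "\<not> locnil f"
  then have inj: "injop f" using injop_or_locnil_f by blast
  obtain n0 v where v: "v \<in> G n0" "v \<noteq> 0" "\<And>k. m < k \<Longrightarrow> k \<le> L \<Longrightarrow> p k v = 0"
    using negative_kernel[OF nil] by blast
  have oddL: "odd (int L)" "int L > 0" using L by auto
  obtain a n :: "nat \<Rightarrow> nat" where an: "strict_mono a" "strict_mono n" "\<forall>j. n0 + int (a j) * int L = int (n j) * 2"
    using parity_solutions[OF oddL, of n0] .
  have fv: "(f ^^ i) v \<in> C \<and> (\<forall>k. m < k \<and> k \<le> L \<longrightarrow> p k ((f ^^ i) v) = 0)" for i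
    by (induction i) (use v G_C negative_kernel_f in auto)
  have fnz: "(f ^^ i) v \<noteq> 0" for i using injop_pow[OF lin_f inj G_C[OF v(1)]] v(2) by blast
  have com: "p L (p 0 u) = p 0 (p L u) + s (\<kappa> L) u" if "u \<in> C" for u
    using pp[of L 0 u] that by simp
  have pL: "p L ((f ^^ i) v) = 0" for i using fv[of i] L by auto
  have fC: "(f ^^ i) v \<in> C" for i using fv by blast
  note lad = ladder[OF lin_p[of L, OF order.refl] lin_id lin_p[of 0, OF le0] _ com fC pL, simplified funpow_ident]
  define w where "w j = (p 0 ^^ a j) ((f ^^ n j) v)" for j
  show False
  proof (rule weight_zero_sequence_contradiction[of w "\<lambda>j. p L ^^ a j"])
    show "w j \<in> G 0" for j
      unfolding w_def
      by (rule homog_pow_G[OF homog_p homog_pow_G[OF homog_f v(1) refl]])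
         (use spec[OF an(3), of j] in \<open>simp_all add: algebra_simps\<close>)
    show "lin (p L ^^ a i)" for i by (intro lin_pow lin_p) simp
    show "(p L ^^ a i) (w j) = 0" if "j < i" for i j
      using lad(2)[of "a j" "a i" "n j"] that an(1) by (simp add: w_def strict_mono_less)
    show "(p L ^^ a i) (w i) \<noteq> 0" for i
      using lad(1)[of "a i" "n i"] \<kappa> fnz by (simp add: w_def)
  qed
qed

lemma lowest_vector_if_charged:
  assumes \<kappa>: "\<kappa> L \<noteq> 0" and nil: "\<And>k. m < k \<Longrightarrow> k \<le> L \<Longrightarrow> locnil (p k)"
  shows "\<exists>v\<in>C. v \<noteq> 0 \<and> (\<exists>\<nu>. h v = s \<nu> v) \<and> f v = 0 \<and> (\<forall>k. m < k \<and> k \<le> L \<longrightarrow> p k v = 0)"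
proof -
  obtain n v where "v \<in> G n" "v \<noteq> 0" "f v = 0" "\<And>k. m < k \<Longrightarrow> k \<le> L \<Longrightarrow> p k v = 0"
    using lowest_vector_exists[OF nil locnil_f_if_charged[OF \<kappa> nil]] by blast
  then show ?thesis by (auto simp: G_def)
qed

lemma highest_vector_if_charged:
  assumes \<kappa>: "\<kappa> 0 \<noteq> 0" and nil: "\<And>k. k \<le> m \<Longrightarrow> locnil (p k)"
  shows "\<exists>v\<in>C. v \<noteq> 0 \<and> (\<exists>\<nu>. h v = s \<nu> v) \<and> e v = 0 \<and> (\<forall>k\<le>m. p k v = 0)"
proof -
  have "\<exists>v\<in>C. v \<noteq> 0 \<and> (\<exists>\<nu>. - h v = s \<nu> v) \<and> e v = 0 \<and> (\<forall>k. m < k \<and> k \<le> L \<longrightarrow> p (L - k) v = 0)"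
    by (rule galilei_module.lowest_vector_if_charged[OF twist]) (use \<kappa> nil L in auto)
  then obtain v \<nu> where v: "v \<in> C" "v \<noteq> 0" "- h v = s \<nu> v" "e v = 0"
    "\<And>k. m < k \<Longrightarrow> k \<le> L \<Longrightarrow> p (L - k) v = 0" by blast
  have "h v = s (- \<nu>) v" using v(3) by (metis minus_minus scale_minus_left)
  moreover have "p k v = 0" if "k \<le> m" for k using v(5)[of "L - k"] that L by simp
  ultimately show ?thesis using v by blast
qed

text \<open>One of \<open>p k\<close>, \<open>p (L - k)\<close> is always injective
  (\<open>pair\<close>), but \<open>p i\<close> and \<open>p j\<close> on opposite sides of l are
  not both injective unless \<open>i + j = L\<close> (\<open>opp\<close>). Apart from the last
  alternative this leaves one whole side without injective operators.\<close>

theorem charged_trichotomy: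
  assumes \<kappa>: "\<And>k. k \<le> L \<Longrightarrow> \<kappa> k \<noteq> 0"
  shows "(\<exists>v\<in>C. v \<noteq> 0 \<and> (\<exists>\<nu>. h v = s \<nu> v) \<and> e v = 0 \<and> (\<forall>k\<le>m. p k v = 0))
    \<or> (\<exists>v\<in>C. v \<noteq> 0 \<and> (\<exists>\<nu>. h v = s \<nu> v) \<and> f v = 0 \<and> (\<forall>k. m < k \<and> k \<le> L \<longrightarrow> p k v = 0))
    \<or> (m = 0 \<and> injop (p 0) \<and> injop (p 1))"
proof (cases "m = 0 \<and> injop (p 0) \<and> injop (p 1)")
  case False
  have opp: "\<not> injop (p i)" if "injop (p j)" "i \<le> m" "m < j" "j \<le> L" "i + j \<noteq> L" for i j
    using opposite_not_both_injective[of i j] that \<kappa> by auto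
  have pair: "injop (p (L - k))" if "\<not> injop (p k)" "k \<le> L" for k
    using not_both_locnil[OF that(2) \<kappa>[OF that(2)]] injop_or_locnil_p[of k] injop_or_locnil_p[of "L - k"] that
    by auto
  have L1: "L = 1" if "m = 0" using L that by simp
  consider "\<forall>k\<le>m. \<not> injop (p k)" | "\<forall>k. m < k \<and> k \<le> L \<longrightarrow> \<not> injop (p k)"
  proof (cases "injop (p 0)")
    case True
    have "\<not> injop (p k)" if "m < k" "k \<le> L" for k
    proof (cases "k = L")
      case False
      then show ?thesis using opp[of k 0] True that by auto
    next
      case kL: True
      show ?thesis
      proof (cases "m = 0")
        case m: True
        then show ?thesis using False True L1 kL by simp
      next
        case m: False
        \<comment> \<open>The pair 0, \<open>L\<close> escapes \<open>opp\<close>, hence the detour: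
          \<open>p (L - 1)\<close> is not injective, so \<open>p 1\<close> is, and
          \<open>p 1\<close> excludes \<open>p L\<close>.\<close>
        have "\<not> injop (p (L - 1))" using opp[of "L - 1" 0] True m L by auto
        then have "injop (p 1)" using pair[of "L - 1"] L by auto
        then show ?thesis using opp[of L 1] kL m L by auto
      qed
    qed
    then show ?thesis using that by blast
  next
    case F: False
    then have "injop (p L)" using pair[of 0] by simp
    then have "\<not> injop (p k)" if "k \<le> m" for k
      using opp[of L k] F that L by (cases "k = 0") auto
    then show ?thesis using that by blast
  qed
  then show ?thesis
  proof cases
    case 1
    have nil: "locnil (p k)" if "k \<le> m" for k using 1 injop_or_locnil_p[of k] L that by auto
    show ?thesis using highest_vector_if_charged[OF \<kappa>[of 0] nil] by simp
  next
    case 2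
    have nil: "locnil (p k)" if "m < k" "k \<le> L" for k using 2 injop_or_locnil_p[of k] that by auto
    show ?thesis using lowest_vector_if_charged[OF \<kappa>[OF order.refl] nil] by simp
  qed
qed simp

subsection \<open>Vanishing central charge\<close>

context
  assumes uncharged: "\<And>k. k \<le> L \<Longrightarrow> \<kappa> k = 0"
begin

lemma p_com: "j \<le> L \<Longrightarrow> k \<le> L \<Longrightarrow> v \<in> C \<Longrightarrow> p j (p k v) = p k (p j v)"
  using pp[of j k v] uncharged by simp

lemma p_pow_com:
  "j \<le> L \<Longrightarrow> k \<le> L \<Longrightarrow> v \<in> C \<Longrightarrow> (p j ^^ a) ((p k ^^ b) v) = (p k ^^ b) ((p j ^^ a) v)"
  by (rule pow_commute2) (auto simp: lin_p p_com)

text \<open>Otherwise some weight vector \<open>v\<close> has \<open>p k v = 0\<close>, and the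
  ladder along \<open>f\<close> with commutator \<open>p (Suc k)\<close> separates the vectors
  \<open>(f ^^ n j) v\<close>. The injective \<open>p i\<close> supplies the positive weight that
  brings them back to \<open>G 0\<close>.\<close>

lemma injop_down:
  assumes i: "i \<le> m" "injop (p i)" and k: "k < L" "injop (p (Suc k))"
  shows "injop (p k)"
proof (rule ccontr)
  assume "\<not> injop (p k)"
  then have nil: "locnil (p k)" using injop_or_locnil_p[of k] k by auto
  obtain n0 v where v: "v \<in> G n0" "v \<noteq> 0" "p k v = 0"
    using locnil_weight_vector[OF less_imp_le[OF k(1)] nil] .
  note vC = G_C[OF v(1)]
  have kL: "k \<le> L" "Suc k \<le> L" and iL: "i \<le> L" using k i L by auto
  have odd: "odd (int L - 2 * int i)" "int L - 2 * int i > 0" using i L by auto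
  obtain a n :: "nat \<Rightarrow> nat" where an: "strict_mono a" "strict_mono n"
    "\<forall>j. n0 + int (a j) * (int L - 2 * int i) = int (n j) * 2"
    using parity_solutions[OF odd, of n0] .
  note lad = ladder[OF lin_p[OF kL(1)] lin_p[OF kL(2)] lin_f p_com[OF kL] pf[OF k(1)] vC v(3)]
  define w where "w j = (p i ^^ a j) ((f ^^ n j) v)" for j
  have fC: "(f ^^ j) v \<in> C" for j using vC lin_f by blast
  have Tw: "(p k ^^ b) (w j) = (p i ^^ a j) ((p k ^^ b) ((f ^^ n j) v))" for b j
    unfolding w_def by (rule p_pow_com[OF kL(1) iL fC])
  show False
  proof (rule weight_zero_sequence_contradiction[of w "\<lambda>j. p k ^^ n j"])
    show "w j \<in> G 0" for j
      unfolding w_def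
      by (rule homog_pow_G[OF homog_p[OF iL] homog_pow_G[OF homog_f v(1) refl]])
         (use spec[OF an(3), of j] in \<open>simp_all add: algebra_simps\<close>)
    show "lin (p k ^^ n i)" for i by (intro lin_pow lin_p kL)
    show "(p k ^^ n i) (w j) = 0" if "j < i" for i j
      using lad(2)[of "n j" "n i"] that an(2) lin_0[OF lin_pow[OF lin_p[OF iL]]]
      by (simp add: Tw strict_mono_less)
    show "(p k ^^ n j) (w j) \<noteq> 0" for j
    proof -
      have C: "(p (Suc k) ^^ n j) v \<in> C" using vC kL lin_p by blast
      have "(p (Suc k) ^^ n j) v \<noteq> 0" using injop_pow[OF lin_p[OF kL(2)] k(2) vC] v(2) by blast
      then have "(p i ^^ a j) ((p (Suc k) ^^ n j) v) \<noteq> 0" using injop_pow[OF lin_p[OF iL] i(2) C] by blast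
      then show ?thesis using lad(1)[of "n j"] C k
        by (simp add: Tw lin_scale[OF lin_pow[OF lin_p[OF iL]]])
    qed
  qed
qed

text \<open>This ladder stays inside \<open>G 0\<close>: \<open>x\<close> is \<open>p 0 p L\<close>
  minus an eigenvalue, so that it kills an eigenvector, and \<open>A\<close> has weight 0. Since
  \<open>f\<close> commutes with \<open>p L\<close> and its commutator with \<open>p 0\<close> is a
  multiple of \<open>p 1\<close>, the commutator of \<open>x\<close> and \<open>A\<close> is a
  multiple of the injective \<open>y\<close>.\<close>

lemma not_all_injective:
  assumes inj: "\<And>k. k \<le> L \<Longrightarrow> injop (p k)"
  shows False
proof -
  have L1: "1 \<le> L" "L - 1 \<le> L" "0 < L" using L by auto
  note lp = lin_p[of 0, OF le0] lin_p[of L, OF order.refl] lin_p[OF L1(1)] lin_p[OF L1(2)]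
  have BG: "p 0 (p L v) \<in> G 0" if "v \<in> G 0" for v
    using homog_G'[OF homog_p[of 0] homog_G[OF homog_p[of L] that], of 0] by simp
  obtain v lam where v: "v \<in> G 0" "v \<noteq> 0" "p 0 (p L v) = s lam v"
    using eigenvector_exists[OF lin_comp[OF lp(1,2)] G_subspace _ BG G0] G_C by blast
  note vC = G_C[OF v(1)]
  define x where "x = (\<lambda>v. p 0 (p L v) - s lam v)"
  define y where "y = (\<lambda>v. p 1 (p L (p 0 (p (L - 1) v))))"
  \<comment> \<open>The weights add up to -2 + L + (2 - L) = 0.\<close>
  define A where "A = (\<lambda>v. f (p 0 (p (L - 1) v)))"
  have lin: "lin x" "lin y" "lin A"
    unfolding x_def y_def A_def
    using lin_minus[OF lin_comp[OF lp(1,2)] lin_smult[OF lin_id]]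
      lin_comp[OF lp(3) lin_comp[OF lp(2) lin_comp[OF lp(1,4)]]]
      lin_comp[OF lin_f lin_comp[OF lp(1,4)]] by this+
  have xp: "x (p k u) = p k (x u)" if "k \<le> L" "u \<in> C" for k u
    using p_com[of L k u] p_com[of 0 k "p L u"] that
    by (simp add: x_def lin_diff[OF lin_p] lin_scale[OF lin_p])
  have xy: "x (y u) = y (x u)" if "u \<in> C" for u
    using that L1 by (simp add: y_def xp)
  have xA: "x (A u) = A (x u) + s (- of_nat L) (y u)" if "u \<in> C" for u
  proof -
    let ?q = "p 0 (p (L - 1) u)"
    have q: "?q \<in> C" using that by simp
    have "p 0 (p L (f ?q)) = f (p 0 (p L ?q)) + s (- of_nat L) (p 1 (p L ?q))"
      using fpL[OF q, symmetric] pf[OF L1(3), of "p L ?q"] q by simp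
    moreover have "p (L - 1) (p 0 (p L u)) = p L ?q"
      using that p_com[of "L - 1" 0 "p L u"] p_com[of "L - 1" L u] p_com[of L 0 "p (L - 1) u"] by simp
    ultimately show ?thesis
      using that q unfolding x_def y_def A_def
      by (simp add: lin_diff[OF lin_p] lin_scale[OF lin_p] lin_diff[OF lin_f] lin_scale[OF lin_f])
  qed
  have x0: "x v = 0" using v by (simp add: x_def)
  note lad = ladder[OF lin xy xA vC x0]
  have AG: "A u \<in> G 0" if "u \<in> G 0" for u
    unfolding A_def
    by (rule homog_G'[OF homog_f homog_G[OF homog_p homog_G[OF homog_p that]]]) (use L1 in \<open>auto simp: of_nat_diff\<close>)
  have "injop y" unfolding y_def
    by (rule injop_comp[OF lin_comp[OF lp(2) lin_comp[OF lp(1,4)]] inj[OF L1(1)]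
          injop_comp[OF lin_comp[OF lp(1,4)] inj[OF order.refl] injop_comp[OF lp(4) inj[OF le0] inj[OF L1(2)]]]])
  then have ynz: "(y ^^ n) v \<noteq> 0" for n using injop_pow[OF lin(2) _ vC] v(2) by blast
  show False
  proof (rule weight_zero_sequence_contradiction[of "\<lambda>n. (A ^^ n) v" "\<lambda>n. x ^^ n"])
    show "(A ^^ j) v \<in> G 0" for j by (induction j) (use v AG in auto)
    show "lin (x ^^ i)" for i by (intro lin_pow lin)
    show "(x ^^ i) ((A ^^ j) v) = 0" if "j < i" for i j using lad(2)[OF _ _ that] by simp
    show "(x ^^ i) ((A ^^ i) v) \<noteq> 0" for i using lad(1)[of i] ynz L1 by simp
  qed
qed

text \<open>The ladder along \<open>e\<close> gives a vector \<open>u\<close> on which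
  \<open>p (Suc t) ^^ n\<close> is nonzero but all higher powers vanish. Suitable lower powers,
  evened out in weight by \<open>p t\<close>, give independent vectors. One \<open>u\<close>
  provides only finitely many of them, so the bound \<open>d\<close> is fixed beforehand.\<close>

lemma not_injop_f:
  assumes t: "t \<le> m" "injop (p t)" "locnil (p (Suc t))" and f: "injop f"
  shows False
proof -
  have tL: "t \<le> L" "Suc t \<le> L" "t < L" using t L by auto
  obtain n0 v where v: "v \<in> G n0" "v \<noteq> 0" "p (Suc t) v = 0"
    using locnil_weight_vector[OF tL(2) t(3)] .
  note vC = G_C[OF v(1)]
  obtain d where d: "\<And>w::nat \<Rightarrow> 'v. (\<And>j. j \<le> d \<Longrightarrow> w j \<in> G 0) \<Longrightarrow>
    \<exists>c. (\<exists>j\<le>d. c j \<noteq> 0) \<and> (\<Sum>j\<le>d. s (c j) (w j)) = 0"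
    using fin_dim_relation[OF G0(1)] by blast
  define \<alpha> where "\<alpha> = L - 2 * t"
  have \<alpha>: "int \<alpha> = int L - 2 * int t" "\<alpha> > 0" "odd (int \<alpha>)" using t L by (auto simp: \<alpha>_def)
  define \<xi> where "\<xi> = int \<alpha> - 2"
  \<comment> \<open>\<open>\<alpha>\<close> and \<open>\<xi>\<close> are the weights of
    \<open>p t\<close> and \<open>p (Suc t)\<close>. Using \<open>\<alpha> * j\<close> factors
    \<open>p (Suc t)\<close> changes the weight by a multiple of \<open>\<alpha>\<close>, which
    \<open>b j\<close> factors \<open>p t\<close> can even out. As \<open>\<alpha>\<close> is odd
    and positive, \<open>\<xi>\<close> is negative only when it is -1, that is for
    \<open>t = m\<close>.\<close>
  have "\<exists>b K. \<forall>j\<le>d. \<xi> * int j + int (b j) = K"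
  proof (cases "\<xi> \<ge> 0")
    case True
    have "\<xi> * int j + int (nat (\<xi> * int (d - j))) = \<xi> * int d" if "j \<le> d" for j
    proof -
      have "int (nat (\<xi> * int (d - j))) = \<xi> * int (d - j)" using True by simp
      then show ?thesis using that by (simp add: of_nat_diff right_diff_distrib)
    qed
    then show ?thesis by (intro exI[of _ "\<lambda>j. nat (\<xi> * int (d - j))"] exI[of _ "\<xi> * int d"]) blast
  next
    case False
    then have "\<xi> = -1" using \<alpha> by (simp add: \<xi>_def)
    then show ?thesis by (intro exI[of _ "\<lambda>j. j"] exI[of _ 0]) simp
  qed
  then obtain b K where b: "\<And>j. j \<le> d \<Longrightarrow> \<xi> * int j + int (b j) = K" by blast
  \<comment> \<open>Large enough that \<open>\<alpha> * j \<le> n\<close> for every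
    \<open>j \<le> d\<close>.\<close>
  define n where "n = \<alpha> * d"
  define u where "u = (e ^^ n) v"
  define \<nu> where "\<nu> = n0 + int n * 2 + int \<alpha> * K"
  have uC: "u \<in> C" using vC lin_e by (auto simp: u_def)
  have x0: "p t (p (Suc t) w) = p (Suc t) (p t w)" if "w \<in> C" for w using p_com tL that by blast
  note lad = ladder[OF lin_p[OF tL(2)] lin_p[OF tL(1)] lin_e x0[symmetric] pe[OF tL(3)] vC v(3), of n, folded u_def]
  have xn: "(p (Suc t) ^^ n) u \<noteq> 0"
    using lad(1) injop_pow[OF lin_p[OF tL(1)] t(2) vC, of n] v(2) by (auto simp del: of_nat_Suc)
  have xC: "(p (Suc t) ^^ k) u \<in> C" for k using uC lin_p tL by blast
  define z where "z j = (p t ^^ b j) ((p (Suc t) ^^ (\<alpha> * j)) u)" for j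
  have zC: "z j \<in> C" for j unfolding z_def using xC lin_p tL by blast
  have zG: "z j \<in> G \<nu>" if "j \<le> d" for j
  proof -
    have uG: "u \<in> G (n0 + int n * 2)" unfolding u_def by (rule homog_pow_G[OF homog_e v(1) refl])
    have bj: "int (b j) = K - \<xi> * int j" using b[OF that] by simp
    have wts: "int L - 2 * int (Suc t) = \<xi>" "int L - 2 * int t = int \<alpha>"
      by (simp_all add: \<xi>_def \<alpha>(1))
    show ?thesis unfolding z_def
      by (intro homog_pow_G[OF homog_p[OF tL(1)] homog_pow_G[OF homog_p[OF tL(2)] uG refl]])
         (simp only: \<nu>_def wts bj, simp add: algebra_simps)
  qed
  obtain a0 n1 where an: "\<nu> + int a0 * int \<alpha> = int n1 * 2"
    using parity_solutions[OF \<alpha>(3), of \<nu>] \<alpha>(2) by (metis of_nat_0_less_iff)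
  \<comment> \<open>An injective map of weight \<open>- \<nu>\<close>: it only places the vectors in
    \<open>G 0\<close>, where a relation exists, and is then cancelled.\<close>
  define \<Phi> where "\<Phi> = (\<lambda>w. (f ^^ n1) ((p t ^^ a0) w))"
  have \<Phi>: "lin \<Phi>" unfolding \<Phi>_def by (rule lin_comp[OF lin_pow[OF lin_f] lin_pow[OF lin_p[OF tL(1)]]])
  have \<Phi>0: "w = 0" if "w \<in> C" "\<Phi> w = 0" for w
    using injop_pow[OF lin_f f, of "(p t ^^ a0) w" n1] injop_pow[OF lin_p[OF tL(1)] t(2), of w a0]
      pow_C[OF lin_p[OF tL(1)], of w a0] that
    unfolding \<Phi>_def by simp
  have "\<Phi> (z j) \<in> G 0" if "j \<le> d" for j
    unfolding \<Phi>_def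
    by (rule homog_pow_G[OF homog_f homog_pow_G[OF homog_p[OF tL(1)] zG[OF that] refl]])
       (use an \<alpha>(1) in \<open>simp add: algebra_simps\<close>)
  then obtain c where c: "\<exists>j\<le>d. c j \<noteq> 0" "(\<Sum>j\<le>d. s (c j) (\<Phi> (z j))) = 0"
    using d[of "\<lambda>j. \<Phi> (z j)"] by blast
  have "\<Phi> (\<Sum>j\<le>d. s (c j) (z j)) = 0"
    using c(2) zC by (simp add: lin_sum[OF \<Phi>] lin_scale[OF \<Phi>])
  then have S: "(\<Sum>j\<le>d. s (c j) (z j)) = 0" using \<Phi>0 zC by (simp add: C_closed(6))
  \<comment> \<open>The smallest index is the one that survives: after applying \<open>X\<close>,
    larger \<open>j\<close> carry more than \<open>n\<close> factors
    \<open>p (Suc t)\<close>.\<close>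
  define j0 where "j0 = (LEAST j. j \<le> d \<and> c j \<noteq> 0)"
  have j0: "j0 \<le> d" "c j0 \<noteq> 0" using LeastI_ex[OF c(1)] by (auto simp: j0_def)
  have below: "c j = 0" if "j < j0" for j using not_less_Least[of j] that j0 unfolding j0_def by fastforce
  define X where "X = p (Suc t) ^^ (n - \<alpha> * j0)"
  have X: "lin X" unfolding X_def by (intro lin_pow lin_p tL)
  have Xz: "X (z j) = (p t ^^ b j) ((p (Suc t) ^^ (n - \<alpha> * j0 + \<alpha> * j)) u)" for j
    unfolding X_def z_def using p_pow_com[OF tL(2,1) xC] by (simp add: funpow_add)
  have le: "\<alpha> * j0 \<le> n" using j0 by (simp add: n_def)
  have Xz0: "X (z j) = 0" if "j > j0" for j
  proof -
    have "\<alpha> * j0 < \<alpha> * j" using that \<alpha>(2) by simp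
    then have "n - \<alpha> * j0 + \<alpha> * j > n" using le by linarith
    then show ?thesis unfolding Xz using lad(2) lin_0[OF lin_pow[OF lin_p[OF tL(1)]]] by simp
  qed
  have "0 = X (\<Sum>j\<le>d. s (c j) (z j))" using S lin_0[OF X] by simp
  also have "\<dots> = (\<Sum>j\<le>d. s (c j) (X (z j)))" using zC by (simp add: lin_sum[OF X] lin_scale[OF X])
  also have "\<dots> = (\<Sum>j\<in>{j0}. s (c j) (X (z j)))"
  proof (rule sum.mono_neutral_right)
    show "\<forall>j\<in>{..d} - {j0}. s (c j) (X (z j)) = 0"
    proof
      fix j assume "j \<in> {..d} - {j0}"
      then have "j < j0 \<or> j > j0" by auto
      then show "s (c j) (X (z j)) = 0" using below Xz0 by auto
    qed
  qed (use j0 in auto)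
  finally have "X (z j0) = 0" using j0 by simp
  then show False
    using injop_pow[OF lin_p[OF tL(1)] t(2) xC] xn le unfolding Xz by fastforce
qed

end

section \<open>Vanishing of all p_k when z acts by zero\<close>

text \<open>Words in the raising operators only; they stand in for a PBW spanning set of the module
  generated by a lowest weight vector.\<close>

inductive_set words :: "'v \<Rightarrow> 'v set" for u where
  words_base: "u \<in> words u"
| words_e: "w \<in> words u \<Longrightarrow> e w \<in> words u"
| words_p: "w \<in> words u \<Longrightarrow> k \<le> m \<Longrightarrow> p k w \<in> words u"

text \<open>The span of the raising words is a submodule: moving \<open>h\<close>, \<open>f\<close>
  or \<open>p k\<close> past the first letter leaves commutators that are in the span by induction.
  Raising letters have positive weight.\<close>

lemma lowest_vector_generates_above:
  assumes u: "u \<in> G n" "u \<noteq> 0" "f u = 0" "\<And>k. m < k \<Longrightarrow> k \<le> L \<Longrightarrow> p k u = 0"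
  shows "C \<subseteq> span (\<Union>k\<in>{n..}. G k)"
proof -
  let ?S = "span (words u)"
  have wG: "\<exists>k\<ge>n. w \<in> G k" if "w \<in> words u" for w
    using that
  proof induction
    case words_base
    then show ?case using u by blast
  next
    case (words_e w)
    then obtain k where k: "k \<ge> n" "w \<in> G k" by blast
    show ?case using homog_G[OF homog_e k(2)] k(1) by (intro exI[of _ "k + 2"]) auto
  next
    case (words_p w j)
    then obtain k where k: "k \<ge> n" "w \<in> G k" by blast
    have j: "j \<le> L" using words_p L by simp
    show ?case using homog_G[OF homog_p[OF j] k(2)] k(1) words_p L
      by (intro exI[of _ "k + (int L - 2 * int j)"]) auto
  qed
  then have wC: "words u \<subseteq> C" using G_C by blast
  have eS: "e w \<in> ?S" if "w \<in> ?S" for w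
    by (rule lin_span[OF lin_e wC _ that]) (auto intro: span_base words_e)
  have pS: "p k w \<in> ?S" if "w \<in> ?S" "k \<le> m" for w k
    by (rule lin_span[OF lin_p wC _ that(1)]) (use that L in \<open>auto intro: span_base words_p\<close>)
  have rest: "h w \<in> ?S \<and> f w \<in> ?S \<and> (\<forall>k\<le>L. p k w \<in> ?S)" if "w \<in> words u" for w
    using that
  proof induction
    case words_base
    have "h u = s (\<mu> + of_int n) u" using u(1) by (simp add: G_def)
    then have "h u \<in> ?S" by (simp add: span_scale span_base words.words_base)
    moreover have "p k u \<in> ?S" if "k \<le> L" for k
      using pS[OF span_base[OF words.words_base], of k] u(4)[of k] that by (cases "k \<le> m") (auto simp: span_zero)
    ultimately show ?case using u(3) by (simp add: span_zero)
  next
    case (words_e w)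
    then have w: "w \<in> C" using wC by blast
    have "h (e w) \<in> ?S" unfolding he[OF w] using words_e by (intro span_add span_scale eS) (auto intro: span_base)
    moreover have "f (e w) = e (f w) - h w" using ef[OF w] by simp
    then have "f (e w) \<in> ?S" using words_e by (auto intro: span_diff eS)
    moreover have "p k (e w) \<in> ?S" if "k \<le> L" for k
    proof (cases k)
      case 0
      then show ?thesis using ep0[OF w] words_e eS[of "p 0 w"] by simp
    next
      case (Suc i)
      then have i: "i < L" "i \<le> L" "Suc i \<le> L" using that by auto
      show ?thesis unfolding Suc pe[OF i(1) w] using words_e i
        by (intro span_add span_scale eS) auto
    qed
    ultimately show ?case by blast
  next
    case (words_p w j)
    then have w: "w \<in> C" using wC by blast
    have j: "j < L" "j \<le> L" using words_p L by auto
    have wS: "w \<in> ?S" using words_p by (auto intro: span_base)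
    have "h (p j w) \<in> ?S" unfolding hp[OF j(2) w] using words_p wS by (auto intro!: span_add span_scale pS)
    moreover have "f (p j w) \<in> ?S" unfolding fp[OF j(1) w]
      using words_p j by (auto intro!: span_add span_scale intro: pS)
    moreover have "p k (p j w) \<in> ?S" if "k \<le> L" for k
      unfolding pp[OF that j(2) w] using words_p that
      by (auto intro!: span_add span_scale span_zero intro: pS span_base)
    ultimately show ?case by blast
  qed
  have "?S = {0} \<or> ?S = C"
  proof (rule simple)
    show "subspace ?S" by simp
    show "?S \<subseteq> C" by (rule span_minimal[OF wC subspace_C])
    show "e w \<in> ?S" if "w \<in> ?S" for w using eS that .
    show "f w \<in> ?S" if "w \<in> ?S" for w by (rule lin_span[OF lin_f wC _ that]) (use rest in blast)
    show "h w \<in> ?S" if "w \<in> ?S" for w by (rule lin_span[OF lin_h wC _ that]) (use rest in blast)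
    show "p k w \<in> ?S" if "k \<le> L" "w \<in> ?S" for k w
      by (rule lin_span[OF lin_p[OF that(1)] wC _ that(2)]) (use rest that in blast)
  qed
  moreover have "u \<in> ?S" by (intro span_base words_base)
  ultimately have "C = ?S" using u(2) by auto
  also have "\<dots> \<subseteq> span (\<Union>k\<in>{n..}. G k)" by (rule span_mono) (use wG in auto)
  finally show ?thesis .
qed

text \<open>For the largest \<open>j\<close> with \<open>p j v\<close> nonzero, \<open>p j v\<close>
  is again a lowest weight vector, since \<open>f\<close> takes it to a multiple of
  \<open>p (Suc j) v\<close>, which is 0. Its weight exceeds \<open>n\<close>, so the module it
  generates cannot contain \<open>v\<close>.\<close>

lemma uncharged_lowest_vector:
  assumes uncharged: "\<And>k. k \<le> L \<Longrightarrow> \<kappa> k = 0"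
    and v: "v \<in> G n" "v \<noteq> 0" "f v = 0" "\<And>k. m < k \<Longrightarrow> k \<le> L \<Longrightarrow> p k v = 0"
    and k: "k \<le> L"
  shows "p k v = 0"
proof (rule ccontr)
  assume "p k v \<noteq> 0"
  define J where "J = {j. j \<le> L \<and> p j v \<noteq> 0}"
  have J: "finite J" "J \<noteq> {}" using k \<open>p k v \<noteq> 0\<close> by (auto simp: J_def)
  define j where "j = Max J"
  have j: "j \<le> L" "p j v \<noteq> 0" using Max_in[OF J] by (auto simp: j_def J_def)
  have above: "p i v = 0" if "j < i" "i \<le> L" for i
    using Max_ge[OF J(1), of i] that unfolding j_def J_def by fastforce
  have jm: "j \<le> m" using v(4)[of j] j by (meson not_le)
  note vC = G_C[OF v(1)]
  have "C \<subseteq> span (\<Union>k\<in>{n + (int L - 2 * int j)..}. G k)"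
  proof (rule lowest_vector_generates_above)
    show "p j v \<in> G (n + (int L - 2 * int j))" by (rule homog_G[OF homog_p[OF j(1)] v(1)])
    show "f (p j v) = 0" using fp[of j v] above[of "Suc j"] jm L vC v(3) j(1) lin_0[OF lin_p[OF j(1)]] by simp
    show "p i (p j v) = 0" if "m < i" "i \<le> L" for i
      using p_com[OF uncharged, of i j v] that j(1) v(4)[of i] vC lin_0[OF lin_p[OF j(1)]] by simp
  qed (use j in simp)
  then have "v \<in> span (\<Union>k\<in>{n + (int L - 2 * int j)..}. G k)" using vC by blast
  from span_Union_subspaces[OF G_subspace this]
  obtain A w where A: "finite A" "A \<subseteq> {n + (int L - 2 * int j)..}" "\<forall>k. w k \<in> G k" "v = sum w A"
    by blast
  have n: "n \<notin> A" using A(2) jm L by auto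
  let ?w = "\<lambda>k. if k = n then - v else w k"
  have "sum ?w (insert n A) = - v + (\<Sum>k\<in>A. ?w k)" using n A(1) by simp
  also have "(\<Sum>k\<in>A. ?w k) = sum w A" by (rule sum.cong) (use n in auto)
  finally have "sum ?w (insert n A) = 0" using A(4) by simp
  then have "?w n = 0"
    by (intro G_sum_zero[of "insert n A" ?w 0 n])
       (use A v(1) subspace_neg[OF G_subspace] in auto)
  then show False using v(2) by simp
qed

text \<open>At the last index \<open>t\<close> with \<open>p t\<close> injective,
  \<open>p (Suc t)\<close> is locally nilpotent, so \<open>not_injop_f\<close> makes
  \<open>f\<close> locally nilpotent and a lowest weight vector exists.\<close>

lemma uncharged_common_kernel_negative:
  assumes uncharged: "\<And>k. k \<le> L \<Longrightarrow> \<kappa> k = 0"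
    and i: "i \<le> m" "injop (p i)" and neg: "\<And>k. m < k \<Longrightarrow> k \<le> L \<Longrightarrow> locnil (p k)"
    and ninj: "\<And>k. m < k \<Longrightarrow> k \<le> L \<Longrightarrow> \<not> injop (p k)"
  shows "\<exists>v\<in>C. v \<noteq> 0 \<and> (\<forall>k\<le>L. p k v = 0)"
proof -
  define J where "J = {j. j \<le> m \<and> injop (p j)}"
  have J: "finite J" "J \<noteq> {}" using i by (auto simp: J_def)
  define t where "t = Max J"
  have t: "t \<le> m" "injop (p t)" using Max_in[OF J] by (auto simp: t_def J_def)
  have "\<not> injop (p (Suc t))"
  proof (cases "t = m")
    case True
    then show ?thesis using ninj[of "Suc t"] L by simp
  next
    case False
    then show ?thesis using Max_ge[OF J(1), of "Suc t"] t unfolding t_def J_def by fastforce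
  qed
  then have "locnil (p (Suc t))" using injop_or_locnil_p[of "Suc t"] t L by auto
  then have "\<not> injop f" using not_injop_f[OF uncharged t] by blast
  then have f: "locnil f" using injop_or_locnil_f by blast
  obtain n v where v: "v \<in> G n" "v \<noteq> 0" "f v = 0" "\<And>k. m < k \<Longrightarrow> k \<le> L \<Longrightarrow> p k v = 0"
    using lowest_vector_exists[OF neg f] by blast
  then show ?thesis using uncharged_lowest_vector[OF uncharged v] G_C by blast
qed

text \<open>One nonzero vector killed by all \<open>p k\<close> suffices, as their common kernel is
  a submodule. Injective operators on both sides of l are excluded: injectivity would spread to
  every index, downward by \<open>injop_down\<close> and upward by its twist.\<close>

theorem uncharged_trivial:
  assumes uncharged: "\<And>k. k \<le> L \<Longrightarrow> \<kappa> k = 0" and k: "k \<le> L" and v: "v \<in> C"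
  shows "p k v = 0"
proof -
  have "\<exists>v\<in>C. v \<noteq> 0 \<and> (\<forall>k\<le>L. p k v = 0)"
  proof -
    consider (none) "\<forall>k\<le>L. \<not> injop (p k)"
      | (pos) i where "i \<le> m" "injop (p i)" "\<forall>k. m < k \<and> k \<le> L \<longrightarrow> \<not> injop (p k)"
      | (neg) i where "m < i" "i \<le> L" "injop (p i)" "\<forall>k\<le>m. \<not> injop (p k)"
      | (both) i j where "i \<le> m" "injop (p i)" "m < j" "j \<le> L" "injop (p j)"
      by (meson not_le)
    then show ?thesis
    proof cases
      case none
      then have nil: "locnil (p k)" if "k \<in> {..L}" for k using that injop_or_locnil_p by auto
      show ?thesis
        by (rule common_kernel[of "{..L}"]) (use nil p_com[OF uncharged] in auto)
    next
      case (pos i)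
      then show ?thesis
        using uncharged_common_kernel_negative[OF uncharged, of i] injop_or_locnil_p by blast
    next
      case (neg i)
      have nil: "locnil (p k)" if "k \<le> m" for k using neg injop_or_locnil_p[of k] L that by auto
      have "\<exists>v\<in>C. v \<noteq> 0 \<and> (\<forall>k\<le>L. p (L - k) v = 0)"
        by (rule galilei_module.uncharged_common_kernel_negative[OF twist, of "L - i"])
           (use neg uncharged nil L in auto)
      then obtain v where v: "v \<in> C" "v \<noteq> 0" "\<And>k. k \<le> L \<Longrightarrow> p (L - k) v = 0" by blast
      have "p k v = 0" if "k \<le> L" for k using v(3)[of "L - k"] that by simp
      then show ?thesis using v by blast
    next
      case (both i j)
      have down: "injop (p k)" if "k < L" "injop (p (Suc k))" for k
        using injop_down[OF uncharged] both that by blast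
      have up: "injop (p (Suc k))" if "k < L" "injop (p k)" for k
      proof -
        have "injop (p (L - (L - Suc k)))"
          by (rule galilei_module.injop_down[OF twist, of "L - j"])
             (use both that uncharged L in \<open>auto simp: Suc_diff_Suc\<close>)
        then show ?thesis using that by simp
      qed
      have low: "injop (p k)" if "k \<le> j" for k
        using that by (induction rule: inc_induct) (use both down in auto)
      have high: "k \<le> L \<longrightarrow> injop (p k)" if "j \<le> k" for k
        using that by (induction rule: dec_induct) (use both up in auto)
      have "injop (p k)" if "k \<le> L" for k using low[of k] high[of k] that by linarith
      then show ?thesis using not_all_injective[OF uncharged] by blast
    qed
  qed
  then obtain w where w: "w \<in> C" "w \<noteq> 0" "\<And>k. k \<le> L \<Longrightarrow> p k w = 0" by blast
  define U where "U = {v \<in> C. \<forall>k\<le>L. p k v = 0}"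
  have "U = {0} \<or> U = C"
  proof (rule simple)
    show "subspace U"
      by (rule subspaceI) (auto simp: U_def lin_0[OF lin_p] lin_add[OF lin_p] lin_scale[OF lin_p])
    show "U \<subseteq> C" by (auto simp: U_def)
    show "f v \<in> U" if "v \<in> U" for v
    proof -
      have "p k (f v) = 0" if "k \<le> L" for k
        using that \<open>v \<in> U\<close> pf[of k v] fpL[of v] lin_0[OF lin_f] by (cases "k = L") (auto simp: U_def)
      then show ?thesis using that by (simp add: U_def)
    qed
    show "e v \<in> U" if "v \<in> U" for v
    proof -
      have "p k (e v) = 0" if "k \<le> L" for k
        using that \<open>v \<in> U\<close> pe[of "k - 1" v] ep0[of v] lin_0[OF lin_e] by (cases k) (auto simp: U_def)
      then show ?thesis using that by (simp add: U_def)
    qed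
    show "h v \<in> U" if "v \<in> U" for v
    proof -
      have "p k (h v) = 0" if "k \<le> L" for k
        using that \<open>v \<in> U\<close> hp[of k v] lin_0[OF lin_h] by (auto simp: U_def)
      then show ?thesis using that by (simp add: U_def)
    qed
    show "p k v \<in> U" if "k \<le> L" "v \<in> U" for k v
      using that lin_0[OF lin_p] by (auto simp: U_def)
  qed
  moreover have "w \<in> U" using w by (simp add: U_def)
  ultimately have "U = C" using w by auto
  then show ?thesis using v k by (auto simp: U_def)
qed

end

subsection \<open>The dense case\<close>

locale dense_module = galilei_module s C m L e f h p \<kappa> \<mu>
  for s :: "complex \<Rightarrow> 'v::ab_group_add \<Rightarrow> 'v" and C m L e f h p \<kappa> \<mu> +
  fixes zd :: complex
  assumes m0: "m = 0" and zd: "zd \<noteq> 0" and \<kappa>0: "\<kappa> 0 = - zd" and \<kappa>1: "\<kappa> 1 = zd"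
    and inj0: "injop (p 0)" and inj1: "injop (p 1)"
begin

lemma L1: "L = 1" using L m0 by simp

definition "p0 = p 0"
definition "p1 = p 1"

lemma lin_p0: "lin p0" and lin_p1: "lin p1"
  unfolding p0_def p1_def using lin_p[of 0] lin_p[of 1] L1 by auto

lemma inj_p0: "injop p0" and inj_p1: "injop p1"
  unfolding p0_def p1_def by (rule inj0 inj1)+

lemma p01_C [simp]: "v \<in> C \<Longrightarrow> p0 v \<in> C" "v \<in> C \<Longrightarrow> p1 v \<in> C"
  using lin_C lin_p0 lin_p1 by auto

lemma p01: "v \<in> C \<Longrightarrow> p0 (p1 v) = p1 (p0 v) - s zd v"
  using pp[of 0 1 v] \<kappa>0 L1 by (simp add: p0_def p1_def)

lemma e_p0: "v \<in> C \<Longrightarrow> e (p0 v) = p0 (e v)" and e_p1: "v \<in> C \<Longrightarrow> e (p1 v) = p1 (e v) + p0 v"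
  and f_p0: "v \<in> C \<Longrightarrow> f (p0 v) = p0 (f v) + p1 v" and f_p1: "v \<in> C \<Longrightarrow> f (p1 v) = p1 (f v)"
  and h_p0: "v \<in> C \<Longrightarrow> h (p0 v) = p0 (h v) + p0 v" and h_p1: "v \<in> C \<Longrightarrow> h (p1 v) = p1 (h v) - p1 v"
  using ep0[of v] ep[of 0 v] fp[of 0 v] fpL[of v] hp[of 0 v] hp[of 1 v] L1
  by (simp_all add: p0_def p1_def)

lemmas lins = lin_add[OF lin_e] lin_add[OF lin_f] lin_add[OF lin_h] lin_add[OF lin_p0] lin_add[OF lin_p1]
  lin_diff[OF lin_e] lin_diff[OF lin_f] lin_diff[OF lin_h] lin_diff[OF lin_p0] lin_diff[OF lin_p1]
  lin_scale[OF lin_e] lin_scale[OF lin_f] lin_scale[OF lin_h] lin_scale[OF lin_p0] lin_scale[OF lin_p1]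
  lin_neg[OF lin_e] lin_neg[OF lin_f] lin_neg[OF lin_h] lin_neg[OF lin_p0] lin_neg[OF lin_p1]
  scale_right_distrib scale_right_diff_distrib

lemma s2: "s (2 * c) v = s c v + s c v" "s (c * 2) v = s c v + s c v"
  by (simp_all only: mult_2 mult_2_right scale_left_distrib)

lemma p0_p0_p1: "v \<in> C \<Longrightarrow> p0 (p0 (p1 v)) = p1 (p0 (p0 v)) - s (2 * zd) (p0 v)"
  and p0_p1_p1: "v \<in> C \<Longrightarrow> p0 (p1 (p1 v)) = p1 (p1 (p0 v)) - s (2 * zd) (p1 v)"
  and e_p1_p1: "v \<in> C \<Longrightarrow> e (p1 (p1 v)) = p1 (p1 (e v)) + s 2 (p1 (p0 v)) - s zd v"
  using s2(1)[of 1 "p1 (p0 v)"] by (simp_all add: p01 e_p1 lins s2 algebra_simps)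

text \<open>\<open>e'\<close>, \<open>f'\<close>, \<open>h'\<close> are \<open>e\<close>, \<open>f\<close>, \<open>h\<close> minus their images under the map
  \<open>\<Phi>\<close> for \<open>l = 1/2\<close>; they commute with \<open>p0\<close> and \<open>p1\<close>.\<close>
definition "N v = s (- 1 / zd) (p1 (p0 v))"
definition "e' v = e v + s (1 / (2 * zd)) (p0 (p0 v))"
definition "f' v = f v - s (1 / (2 * zd)) (p1 (p1 v))"
definition "h' v = h v + N v + s (1 / 2) v"

lemma lin_N: "lin N" and lin_e': "lin e'" and lin_f': "lin f'" and lin_h': "lin h'"
proof -
  show N: "lin N" unfolding N_def[abs_def] by (rule lin_smult[OF lin_comp[OF lin_p1 lin_p0]])
  show "lin e'" unfolding e'_def[abs_def] by (rule lin_plus[OF lin_e lin_smult[OF lin_comp[OF lin_p0 lin_p0]]])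
  show "lin f'" unfolding f'_def[abs_def] by (rule lin_minus[OF lin_f lin_smult[OF lin_comp[OF lin_p1 lin_p1]]])
  show "lin h'" unfolding h'_def[abs_def] by (rule lin_plus[OF lin_plus[OF lin_h N] lin_smult[OF lin_id]])
qed

lemma N_C [simp]: "v \<in> C \<Longrightarrow> N v \<in> C" "v \<in> C \<Longrightarrow> e' v \<in> C" "v \<in> C \<Longrightarrow> f' v \<in> C" "v \<in> C \<Longrightarrow> h' v \<in> C"
  using lin_C lin_N lin_e' lin_f' lin_h' by auto

lemma N_p0: "v \<in> C \<Longrightarrow> N (p0 v) = p0 (N v) - p0 v"
  and N_p1: "v \<in> C \<Longrightarrow> N (p1 v) = p1 (N v) + p1 v"
  and N_e: "v \<in> C \<Longrightarrow> N (e v) = e (N v) + s (1 / zd) (p0 (p0 v))"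
  and N_f: "v \<in> C \<Longrightarrow> N (f v) = f (N v) + s (1 / zd) (p1 (p1 v))"
  using zd by (simp_all add: N_def p01 e_p0 e_p1 f_p0 f_p1 lins)

lemma e'_p0: "v \<in> C \<Longrightarrow> e' (p0 v) = p0 (e' v)" and e'_p1: "v \<in> C \<Longrightarrow> e' (p1 v) = p1 (e' v)"
  and f'_p0: "v \<in> C \<Longrightarrow> f' (p0 v) = p0 (f' v)" and f'_p1: "v \<in> C \<Longrightarrow> f' (p1 v) = p1 (f' v)"
  and h'_p0: "v \<in> C \<Longrightarrow> h' (p0 v) = p0 (h' v)" and h'_p1: "v \<in> C \<Longrightarrow> h' (p1 v) = p1 (h' v)"
  using zd by (simp_all add: e'_def f'_def h'_def p0_p0_p1 p0_p1_p1 e_p0 e_p1 f_p0 f_p1 h_p0 h_p1 N_p0 N_p1 lins)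

lemma h'_e':
  assumes v: "v \<in> C" shows "h' (e' v) = e' (h' v) + s 2 (e' v)"
proof -
  \<comment> \<open>\<open>h'\<close> commutes with \<open>p0\<close>, so the quadratic correction
    passes through and only the commutator with \<open>e\<close> is left.\<close>
  have "h' (e' v) = h' (e v) + s (1 / (2 * zd)) (p0 (p0 (h' v)))"
    unfolding e'_def using v by (simp add: lin_add[OF lin_h'] lin_scale[OF lin_h'] h'_p0)
  also have "h' (e v) = e (h' v) + s 2 (e v) + s (1 / zd) (p0 (p0 v))"
    unfolding h'_def using v by (simp add: he N_e lins)
  finally show ?thesis unfolding e'_def using zd by (simp add: scale_right_distrib)
qed

lemma h'_f':
  assumes v: "v \<in> C" shows "h' (f' v) = f' (h' v) - s 2 (f' v)"
proof -
  have "h' (f' v) = h' (f v) - s (1 / (2 * zd)) (p1 (p1 (h' v)))"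
    unfolding f'_def using v by (simp add: lin_diff[OF lin_h'] lin_scale[OF lin_h'] h'_p1)
  also have "h' (f v) = f (h' v) - s 2 (f v) + s (1 / zd) (p1 (p1 v))"
    unfolding h'_def using v by (simp add: hf N_f lins)
  finally show ?thesis unfolding f'_def using zd by (simp add: scale_right_diff_distrib)
qed

lemma e'_f':
  assumes v: "v \<in> C" shows "e' (f' v) = f' (e' v) + h' v"
proof -
  have "f' (e' v) = f' (e v) + s (1 / (2 * zd)) (p0 (p0 (f' v)))"
    unfolding e'_def using v by (simp add: lin_add[OF lin_f'] lin_scale[OF lin_f'] f'_p0)
  moreover have "e' (f' v) = e (f' v) + s (1 / (2 * zd)) (p0 (p0 (f' v)))"
    unfolding e'_def ..
  moreover have "e (f' v) = f' (e v) + h' v"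
    unfolding f'_def h'_def N_def using v zd by (simp add: ef e_p1_p1 lins)
  ultimately show ?thesis by simp
qed

text \<open>The inverse of \<open>p1\<close> on \<open>C\<close>, meaningful once \<open>p1\<close>
  is known to be surjective there.\<close>

definition q :: "'v \<Rightarrow> 'v" where "q = inv_into C p1"

text \<open>On D(a, zd) the operator \<open>N\<close> multiplies x^i by a + i, so
  \<open>eigsp a k\<close> corresponds to x^k tensored with the sl2-module.\<close>

definition eigsp :: "complex \<Rightarrow> int \<Rightarrow> 'v set" where
  "eigsp a k = {v \<in> C. N v = s (a + of_int k) v}"

lemma eigsp_C: "v \<in> eigsp a k \<Longrightarrow> v \<in> C" by (simp add: eigsp_def)

lemma eigsp_subspace: "subspace (eigsp a k)"
  by (rule subspaceI)
     (auto simp: eigsp_def lin_0[OF lin_N] lin_add[OF lin_N] lin_scale[OF lin_N] scale_right_distrib mult.commute)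

lemma eigsp_p1: "v \<in> eigsp a k \<Longrightarrow> p1 v \<in> eigsp a (k + 1)"
  and eigsp_p0: "v \<in> eigsp a k \<Longrightarrow> p0 v \<in> eigsp a (k - 1)"
  by (auto simp: eigsp_def N_p0 N_p1 lins scale_left_distrib scale_left_diff_distrib)

lemma p1_p0: "v \<in> eigsp a k \<Longrightarrow> p1 (p0 v) = s (- zd * (a + of_int k)) v"
proof -
  assume "v \<in> eigsp a k"
  then have "s (- 1 / zd) (p1 (p0 v)) = s (a + of_int k) v" by (simp add: eigsp_def N_def)
  then have "s (- zd) (s (- 1 / zd) (p1 (p0 v))) = s (- zd) (s (a + of_int k) v)" by simp
  then show ?thesis using zd by simp
qed

lemma N_e'_commute: "v \<in> C \<Longrightarrow> N (e' v) = e' (N v)" "v \<in> C \<Longrightarrow> N (f' v) = f' (N v)"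
  "v \<in> C \<Longrightarrow> N (h' v) = h' (N v)"
  unfolding N_def
  by (simp_all add: lin_scale[OF lin_e'] lin_scale[OF lin_f'] lin_scale[OF lin_h'] e'_p0 e'_p1 f'_p0 f'_p1 h'_p0 h'_p1
      lin_neg[OF lin_e'] lin_neg[OF lin_f'] lin_neg[OF lin_h'])

lemma eigsp_e': "v \<in> eigsp a k \<Longrightarrow> e' v \<in> eigsp a k" "v \<in> eigsp a k \<Longrightarrow> f' v \<in> eigsp a k"
  "v \<in> eigsp a k \<Longrightarrow> h' v \<in> eigsp a k"
  by (simp_all add: eigsp_def N_e'_commute lin_scale[OF lin_e'] lin_scale[OF lin_f'] lin_scale[OF lin_h'])

lemma efh_eq: "e v = e' v - s (1 / (2 * zd)) (p0 (p0 v))" "f v = f' v + s (1 / (2 * zd)) (p1 (p1 v))"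
  "h v = h' v - N v - s (1 / 2) v"
  by (simp_all add: e'_def f'_def h'_def)

text \<open>\<open>e\<close>, \<open>f\<close>, \<open>h\<close> are combinations of the primed
  operators and products of \<open>p0\<close>, \<open>p1\<close>, so submodules may be tested on the
  latter.\<close>

lemma simple':
  assumes U: "subspace U" "U \<subseteq> C"
    and p: "\<And>v. v \<in> U \<Longrightarrow> p0 v \<in> U" "\<And>v. v \<in> U \<Longrightarrow> p1 v \<in> U"
    and efh: "\<And>v. v \<in> U \<Longrightarrow> e' v \<in> U" "\<And>v. v \<in> U \<Longrightarrow> f' v \<in> U" "\<And>v. v \<in> U \<Longrightarrow> h' v \<in> U"
  shows "U = {0} \<or> U = C"
proof (rule simple[OF U])
  fix v assume v: "v \<in> U"
  note sc = subspace_scale[OF U(1)]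
  show "e v \<in> U" unfolding efh_eq(1)[of v]
    by (rule subspace_diff[OF U(1) efh(1)[OF v] sc[OF p(1)[OF p(1)[OF v]]]])
  show "f v \<in> U" unfolding efh_eq(2)[of v]
    by (rule subspace_add[OF U(1) efh(2)[OF v] sc[OF p(2)[OF p(2)[OF v]]]])
  have "N v \<in> U" unfolding N_def by (rule sc[OF p(2)[OF p(1)[OF v]]])
  then show "h v \<in> U" unfolding efh_eq(3)[of v]
    by (rule subspace_diff[OF U(1) subspace_diff[OF U(1) efh(3)[OF v]] sc[OF v]])
  fix k assume "k \<le> L"
  then consider "k = 0" | "k = 1" using L1 by linarith
  then show "p k v \<in> U"
    by cases (use p[OF v] in \<open>simp_all only: p0_def p1_def\<close>)
qed

text \<open>The injective operators \<open>p0\<close> and \<open>p1\<close> move the eigenvalue by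
  -1 and 1. From an integer they reach 0, where \<open>p1 (p0 w) = 0\<close> contradicts
  injectivity.\<close>

lemma N_eigenvalue_not_int:
  assumes u: "u \<in> C" "u \<noteq> 0" "N u = s a u"
  shows "a \<notin> \<int>"
proof
  assume "a \<in> \<int>"
  then obtain k where k: "a = of_int k" by (auto elim: Ints_cases)
  have uE: "u \<in> eigsp a 0" using u by (simp add: eigsp_def)
  have 0: "(p0 ^^ n) u \<in> eigsp a (- int n)" for n
  proof (induction n)
    case (Suc n)
    have eq: "- int n - 1 = - int (Suc n)" by simp
    show ?case using eigsp_p0[OF Suc] unfolding eq by simp
  qed (use uE in simp)
  have 1: "(p1 ^^ n) u \<in> eigsp a (int n)" for n
  proof (induction n)
    case (Suc n)
    then show ?case using eigsp_p1[of "(p1 ^^ n) u" a "int n"] by (simp add: algebra_simps)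
  qed (use uE in simp)
  obtain w where w: "w \<in> eigsp a (- k)" "w \<noteq> 0"
  proof (cases "k \<ge> 0")
    case True
    then show ?thesis using that[of "(p0 ^^ nat k) u"] 0[of "nat k"] injop_pow[OF lin_p0 inj_p0 u(1)] u(2) by auto
  next
    case False
    then show ?thesis using that[of "(p1 ^^ nat (- k)) u"] 1[of "nat (- k)"] injop_pow[OF lin_p1 inj_p1 u(1)] u(2) by auto
  qed
  then have "p1 (p0 w) = 0" using p1_p0[OF w(1)] k by simp
  then have "w = 0" using injopD[OF inj_p1, of "p0 w"] injopD[OF inj_p0, of w] eigsp_C[OF w(1)] by simp
  then show False using w by simp
qed

lemma homog_N: "homog 0 N"
  unfolding homog_def using lin_N by (simp add: N_def h_p0 h_p1 lins)

lemma N_eigenvector: obtains a u where "u \<in> G 0" "u \<noteq> 0" "N u = s a u"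
proof -
  have "N v \<in> G 0" if "v \<in> G 0" for v using homog_G'[OF homog_N that] by simp
  then show ?thesis using eigenvector_exists[OF lin_N G_subspace _ _ G0] G_C that by blast
qed

end

section \<open>Eigenspaces of \<open>N\<close> and translation by powers of
  \<open>p1\<close>\<close>

locale dense_module_eigen = dense_module s C m L e f h p \<kappa> \<mu> zd
  for s :: "complex \<Rightarrow> 'v::ab_group_add \<Rightarrow> 'v" and C m L e f h p \<kappa> \<mu> zd +
  fixes a :: complex and u0 :: 'v
  assumes u0: "u0 \<in> C" "u0 \<noteq> 0" "N u0 = s a u0"
begin

abbreviation "W \<equiv> eigsp a"

lemma a_notin_Ints: "a \<notin> \<int>" using N_eigenvalue_not_int[OF u0] .

lemma a_plus_int: "a + of_int k \<noteq> 0"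
proof
  assume "a + of_int k = 0"
  then have "a = of_int (- k)" by (simp add: eq_neg_iff_add_eq_0)
  then show False using a_notin_Ints by (metis Ints_of_int)
qed

text \<open>\<open>p0\<close> and \<open>p1\<close> shift the eigenspaces and the primed operators
  preserve them, so their sum is a submodule containing \<open>u0\<close>.\<close>

lemma C_eq_span_W: "C = span (\<Union>k. W k)"
proof -
  let ?X = "\<Union>k. W k"
  have X: "?X \<subseteq> C" using eigsp_C by blast
  have "span ?X = {0} \<or> span ?X = C"
  proof (rule simple')
    have XI: "v \<in> W k \<Longrightarrow> v \<in> span ?X" for v k by (auto intro: span_base)
    show "subspace (span ?X)" by simp
    show "span ?X \<subseteq> C" by (rule span_minimal[OF X subspace_C])
    show "p0 v \<in> span ?X" if "v \<in> span ?X" for v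
      by (rule lin_span[OF lin_p0 X _ that]) (erule UN_E, rule XI, erule eigsp_p0)
    show "p1 v \<in> span ?X" if "v \<in> span ?X" for v
      by (rule lin_span[OF lin_p1 X _ that]) (erule UN_E, rule XI, erule eigsp_p1)
    show "e' v \<in> span ?X" if "v \<in> span ?X" for v
      by (rule lin_span[OF lin_e' X _ that]) (erule UN_E, rule XI, erule eigsp_e'(1))
    show "f' v \<in> span ?X" if "v \<in> span ?X" for v
      by (rule lin_span[OF lin_f' X _ that]) (erule UN_E, rule XI, erule eigsp_e'(2))
    show "h' v \<in> span ?X" if "v \<in> span ?X" for v
      by (rule lin_span[OF lin_h' X _ that]) (erule UN_E, rule XI, erule eigsp_e'(3))
  qed
  moreover have "u0 \<in> W 0" using u0 by (simp add: eigsp_def)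
  then have "u0 \<in> span ?X" by (auto intro: span_base)
  ultimately show ?thesis using u0(2) by auto
qed

lemma E_sum_zero:
  assumes "finite A" "\<And>k. k \<in> A \<Longrightarrow> w k \<in> W k" "sum w A = 0" "k \<in> A"
  shows "w k = 0"
  by (rule eigenvectors_independent[OF lin_N, of A "\<lambda>k. a + of_int k" w])
     (use assms in \<open>auto simp: eigsp_def inj_on_def\<close>)

text \<open>On \<open>W k\<close> the product \<open>p1 p0\<close> is the scalar
  \<open>- zd * (a + of_int k)\<close>, nonzero because \<open>a\<close> is not an integer; so each
  \<open>W k\<close> lies in the image.\<close>

lemma p1_surj: assumes "v \<in> C" shows "\<exists>u\<in>C. p1 u = v"
proof -
  let ?U = "p1 ` C"
  have "subspace ?U" by (rule lin_image_subspace[OF lin_p1 subspace_C order.refl])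
  moreover have "(\<Union>k. W k) \<subseteq> ?U"
  proof
    fix v assume "v \<in> (\<Union>k. W k)"
    then obtain k where k: "v \<in> W k" by blast
    define c where "c = - zd * (a + of_int k)"
    have "c \<noteq> 0" using zd a_plus_int by (simp add: c_def)
    then have "p1 (s (1 / c) (p0 v)) = v"
      using p1_p0[OF k, folded c_def] eigsp_C[OF k] by (simp add: lin_scale[OF lin_p1])
    moreover have "s (1 / c) (p0 v) \<in> C" using eigsp_C[OF k] by simp
    ultimately show "v \<in> ?U" by (metis imageI)
  qed
  ultimately have "span (\<Union>k. W k) \<subseteq> ?U" by (simp add: span_minimal)
  then show ?thesis using assms C_eq_span_W by auto
qed

lemma q_C [simp]: "v \<in> C \<Longrightarrow> q v \<in> C" and p1_q: "v \<in> C \<Longrightarrow> p1 (q v) = v"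
  using p1_surj[of v] inv_into_into[of v p1 C] f_inv_into_f[of v p1 C] by (auto simp: q_def)

lemma p1_cancel: "u \<in> C \<Longrightarrow> v \<in> C \<Longrightarrow> p1 u = p1 v \<Longrightarrow> u = v"
  using injopD[OF inj_p1, of "u - v"] by (simp add: lin_diff[OF lin_p1])

lemma lin_q: "lin q"
  unfolding lin_def
proof (intro conjI ballI allI)
  fix u v assume uv: "u \<in> C" "v \<in> C"
  show "q (u + v) = q u + q v" by (rule p1_cancel) (use uv in \<open>simp_all add: p1_q lin_add[OF lin_p1]\<close>)
next
  fix c v assume v: "v \<in> C"
  show "q (s c v) = s c (q v)" by (rule p1_cancel) (use v in \<open>simp_all add: p1_q lin_scale[OF lin_p1]\<close>)
qed simp

text \<open>Integer powers of \<open>p1\<close>; \<open>tr j\<close> plays the role of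
  multiplication by x^j.\<close>

definition tr :: "int \<Rightarrow> 'v \<Rightarrow> 'v" where
  "tr j = (if j \<ge> 0 then p1 ^^ nat j else q ^^ nat (- j))"

lemma lin_tr: "lin (tr j)" by (simp add: tr_def lin_pow lin_p1 lin_q)

lemma tr_C [simp]: "v \<in> C \<Longrightarrow> tr j v \<in> C" using lin_C lin_tr by blast

lemma tr_0 [simp]: "tr 0 v = v" by (simp add: tr_def)

lemma p1_tr: "v \<in> C \<Longrightarrow> p1 (tr j v) = tr (j + 1) v"
proof -
  assume v: "v \<in> C"
  consider "j \<ge> 0" | n where "j = - int (Suc n)"
    by (metis int_cases2 negative_eq_positive of_nat_0_le_iff not0_implies_Suc)
  then show ?thesis
  proof cases
    case 1
    then show ?thesis by (simp add: tr_def nat_add_distrib)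
  next
    case (2 n)
    have "nat (- j) = Suc n" using 2 by simp
    then have "tr j v = q ((q ^^ n) v)" using 2 by (simp add: tr_def)
    moreover have "tr (j + 1) v = (q ^^ n) v"
    proof (cases n)
      case 0
      then show ?thesis using 2 by simp
    next
      case (Suc i)
      then have "\<not> 0 \<le> j + 1" "nat (- (j + 1)) = n" using 2 by auto
      then show ?thesis by (simp only: tr_def if_False)
    qed
    ultimately show ?thesis using v pow_C[OF lin_q] by (simp add: p1_q)
  qed
qed

text \<open>The downward step goes from \<open>j + 1\<close> to \<open>j\<close> because an identity
  at \<open>j\<close> is obtained from the one at \<open>j + 1\<close> by cancelling
  \<open>p1\<close>.\<close>

lemma tr_induct [case_names zero up down]:
  assumes "Q 0" "\<And>j. Q j \<Longrightarrow> Q (j + 1)" "\<And>j. Q (j + 1) \<Longrightarrow> Q j"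
  shows "Q (j::int)"
proof (induction j rule: int_induct[of _ 0])
  case (step2 i)
  then show ?case using assms(3)[of "i - 1"] by simp
qed (use assms in auto)

lemma tr_commute:
  assumes T: "lin T" "\<And>v. v \<in> C \<Longrightarrow> T (p1 v) = p1 (T v)" and v: "v \<in> C"
  shows "T (tr j v) = tr j (T v)"
proof (induction j rule: tr_induct)
  case (up j)
  then show ?case using T(2)[of "tr j v"] p1_tr[of v j] p1_tr[of "T v" j] v lin_C[OF T(1)] by simp
next
  case (down j)
  show ?case
    by (rule p1_cancel) (use down v lin_C[OF T(1)] T(2)[of "tr j v"] in \<open>simp_all add: p1_tr\<close>)
qed simp

lemma tr_E: "v \<in> W k \<Longrightarrow> tr j v \<in> W (k + j)"
proof (induction j rule: tr_induct)
  case (up j)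
  then show ?case using eigsp_p1[of "tr j v" a "k + j"] eigsp_C by (simp add: p1_tr add.assoc)
next
  case (down j)
  then have v: "v \<in> C" using eigsp_C by blast
  have "p1 (tr j v) \<in> W (k + (j + 1))" using down v by (simp add: p1_tr)
  then have "p1 (N (tr j v)) = p1 (s (a + of_int (k + j)) (tr j v))"
    using v by (simp add: eigsp_def N_p1 lins scale_left_distrib)
  then have "N (tr j v) = s (a + of_int (k + j)) (tr j v)" using p1_cancel v by simp
  then show ?case using v by (simp add: eigsp_def)
qed simp

lemma tr_tr: "v \<in> C \<Longrightarrow> tr i (tr j v) = tr (i + j) v"
proof (induction i rule: tr_induct)
  case (up i)
  then show ?case using p1_tr[of "tr j v" i] p1_tr[of v "i + j"] by (simp add: ac_simps)
next
  case (down i)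
  show ?case
    by (rule p1_cancel) (use down p1_tr[of "tr j v" i] p1_tr[of v "i + j"] in \<open>simp_all add: ac_simps\<close>)
qed simp

lemma tr_inj: "v \<in> C \<Longrightarrow> tr j v = 0 \<Longrightarrow> v = 0"
  using tr_tr[of v "- j" j] lin_0[OF lin_tr, of "- j"] by simp

text \<open>The coefficient is that of p_0 on x^j in D(a, zd), which is why the tensor factor is
  this module.\<close>

lemma p0_tr: "v \<in> W 0 \<Longrightarrow> p0 (tr j v) = s (- zd * (a + of_int j)) (tr (j - 1) v)"
proof (rule p1_cancel)
  assume v: "v \<in> W 0"
  show "p0 (tr j v) \<in> C" "s (- zd * (a + of_int j)) (tr (j - 1) v) \<in> C" using eigsp_C[OF v] by auto
  have "tr j v \<in> W j" using tr_E[OF v, of j] by simp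
  then show "p1 (p0 (tr j v)) = p1 (s (- zd * (a + of_int j)) (tr (j - 1) v))"
    using p1_p0[of "tr j v" a j] eigsp_C[OF v] p1_tr[of v "j - 1"] by (simp add: lin_scale[OF lin_p1] lin_neg[OF lin_p1])
qed

section \<open>The simple sl2-module on \<open>W 0\<close>\<close>

definition actN :: "gbasis \<Rightarrow> 'v \<Rightarrow> 'v" where
  "actN b = (case b of E \<Rightarrow> e' | F \<Rightarrow> f' | H \<Rightarrow> h' | _ \<Rightarrow> (\<lambda>_. 0))"

lemma actN_simps: "actN E = e'" "actN F = f'" "actN H = h'"
  by (simp_all add: actN_def)

lemma W_component:
  assumes "u \<in> W k" "finite A" "\<And>n. w n \<in> W n" "\<And>n. n \<notin> A \<Longrightarrow> w n = 0" "u = sum w A"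
  shows "u = w k"
proof -
  let ?w = "\<lambda>n. w n - (if n = k then u else 0)"
  have "sum ?w (insert k A) = sum w (insert k A) - u"
    using assms(2) by (simp add: sum_subtractf)
  also have "sum w (insert k A) = sum w A"
    by (rule sum.mono_neutral_right) (use assms in auto)
  finally have "sum ?w (insert k A) = 0" using assms(5) by simp
  then have "?w k = 0"
    by (intro E_sum_zero[of "insert k A" ?w k])
       (use assms in \<open>auto intro: subspace_diff[OF eigsp_subspace]\<close>)
  then show ?thesis by simp
qed

lemma tr_e': "v \<in> C \<Longrightarrow> e' (tr j v) = tr j (e' v)"
  and tr_f': "v \<in> C \<Longrightarrow> f' (tr j v) = tr j (f' v)"
  and tr_h': "v \<in> C \<Longrightarrow> h' (tr j v) = tr j (h' v)"
  by (rule tr_commute[OF lin_e' e'_p1] tr_commute[OF lin_f' f'_p1] tr_commute[OF lin_h' h'_p1]; assumption)+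

lemma rep_on_W0: "rep_on m sl2b s (W 0) actN"
  unfolding rep_on_def
proof (intro conjI)
  show "\<forall>b\<in>sl2b. \<forall>v\<in>W 0. actN b v \<in> W 0"
    using eigsp_e' by (auto simp: sl2b_def actN_simps)
  show "\<forall>b\<in>sl2b. \<forall>u\<in>W 0. \<forall>v\<in>W 0. actN b (u + v) = actN b u + actN b v"
    using eigsp_C lin_add[OF lin_e'] lin_add[OF lin_f'] lin_add[OF lin_h']
    by (auto simp: sl2b_def actN_simps)
  show "\<forall>b\<in>sl2b. \<forall>c. \<forall>v\<in>W 0. actN b (s c v) = s c (actN b v)"
    using eigsp_C lin_scale[OF lin_e'] lin_scale[OF lin_f'] lin_scale[OF lin_h']
    by (auto simp: sl2b_def actN_simps)
  show "\<forall>b\<in>sl2b. \<forall>b'\<in>sl2b. \<forall>v\<in>W 0. actN b (actN b' v) - actN b' (actN b v)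
      = sum_list (map (\<lambda>(c, g). s c (actN g v)) (br m b b'))"
    using eigsp_C by (auto simp: sl2b_def actN_simps h'_e' h'_f' e'_f')
qed (use vector_space_axioms eigsp_subspace in auto)

text \<open>The translates of an invariant \<open>U\<close> span a submodule of \<open>C\<close>. If
  that is all of \<open>C\<close>, comparing components at the eigenvalue \<open>a\<close> puts
  every element of \<open>W 0\<close> into \<open>U\<close>.\<close>

lemma simple_W0: "simple_rep m sl2b s (W 0) actN"
  unfolding simple_rep_def
proof (intro conjI allI impI)
  show "rep_on m sl2b s (W 0) actN" by (rule rep_on_W0)
  have "u0 \<in> W 0" using u0 by (simp add: eigsp_def)
  then show "W 0 \<noteq> {0}" using u0(2) by blast
  fix U assume "invariant_subspace sl2b s (W 0) actN U"
  then have U: "subspace U" "U \<subseteq> W 0" "\<And>u. u \<in> U \<Longrightarrow> e' u \<in> U" "\<And>u. u \<in> U \<Longrightarrow> f' u \<in> U" "\<And>u. u \<in> U \<Longrightarrow> h' u \<in> U"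
    by (auto simp: invariant_subspace_def sl2b_def actN_simps)
  then have UC: "U \<subseteq> C" using eigsp_C by blast
  let ?X = "\<Union>j. tr j ` U"
  have X: "?X \<subseteq> C" using UC by auto
  have trX: "tr j u \<in> span ?X" if "u \<in> U" for j u using that by (auto intro: span_base)
  have "span ?X = {0} \<or> span ?X = C"
  proof (rule simple')
    show "subspace (span ?X)" by simp
    show "span ?X \<subseteq> C" by (rule span_minimal[OF X subspace_C])
    show "p0 v \<in> span ?X" if "v \<in> span ?X" for v
    proof (rule lin_span[OF lin_p0 X _ that])
      fix w assume "w \<in> ?X"
      then obtain j u where u: "u \<in> U" and w: "w = tr j u" by blast
      have "u \<in> W 0" using U(2) u by blast
      then show "p0 w \<in> span ?X" unfolding w p0_tr[OF \<open>u \<in> W 0\<close>] using trX[OF u] span_scale by blast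
    qed
    show "p1 v \<in> span ?X" if "v \<in> span ?X" for v
      by (rule lin_span[OF lin_p1 X _ that]) (use UC p1_tr trX in auto)
    show "e' v \<in> span ?X" if "v \<in> span ?X" for v
      by (rule lin_span[OF lin_e' X _ that]) (use UC tr_e' U trX in auto)
    show "f' v \<in> span ?X" if "v \<in> span ?X" for v
      by (rule lin_span[OF lin_f' X _ that]) (use UC tr_f' U trX in auto)
    show "h' v \<in> span ?X" if "v \<in> span ?X" for v
      by (rule lin_span[OF lin_h' X _ that]) (use UC tr_h' U trX in auto)
  qed
  then show "U = {0} \<or> U = W 0"
  proof
    assume "span ?X = {0}"
    then have "u = 0" if "u \<in> U" for u using trX[OF that, of 0] by simp
    then show ?thesis using subspace_0[OF U(1)] by blast
  next
    assume sp: "span ?X = C"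
    have "u \<in> U" if u: "u \<in> W 0" for u
    proof -
      have "u \<in> span (\<Union>j\<in>UNIV. tr j ` U)" using sp eigsp_C[OF u] by simp
      from span_Union_subspaces[OF lin_image_subspace[OF lin_tr U(1) UC] this]
      obtain A w where A: "finite A" "\<forall>n. w n \<in> tr n ` U" "\<forall>n. n \<notin> A \<longrightarrow> w n = 0" "u = sum w A"
        by blast
      have "w n \<in> W n" for n
      proof -
        obtain v where "v \<in> U" "w n = tr n v" using A(2) by blast
        then show ?thesis using U(2) tr_E[of v 0 n] by auto
      qed
      then have "u = w 0" using W_component[OF u A(1), of w] A(3,4) by blast
      moreover obtain v where "v \<in> U" "w 0 = tr 0 v" using A(2) by blast
      ultimately show ?thesis by simp
    qed
    then show ?thesis using U(2) by blast
  qed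
qed

section \<open>Finite dimension of \<open>W 0\<close>\<close>

lemma homog_p1: "homog (- 1) p1"
  using homog_p[of 1] L1 by (simp add: p1_def)

lemma tr_G: "v \<in> G n \<Longrightarrow> tr j v \<in> G (n - j)"
proof (induction j rule: tr_induct)
  case (up j)
  then show ?case using homog_G[OF homog_p1, of "tr j v" "n - j"] p1_tr[of v j] G_C by (simp add: algebra_simps)
next
  case (down j)
  then have v: "v \<in> C" using G_C by blast
  let ?x = "tr j v"
  have "p1 ?x \<in> G (n - (j + 1))" using down v by (simp add: p1_tr)
  then have "p1 (h ?x) - p1 ?x = s (\<mu> + of_int (n - (j + 1))) (p1 ?x)"
    using v by (simp add: G_def h_p1)
  then have "p1 (h ?x) = s (\<mu> + of_int (n - (j + 1)) + 1) (p1 ?x)"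
    by (simp only: diff_eq_eq scale_left_distrib scale_one)
  moreover have "\<mu> + of_int (n - (j + 1)) + 1 = \<mu> + of_int (n - j)" by simp
  ultimately have "p1 (h ?x) = p1 (s (\<mu> + of_int (n - j)) ?x)"
    using v by (simp only: lin_scale[OF lin_p1] tr_C)
  then show ?case using p1_cancel[of "h ?x"] v by (simp add: G_def)
qed simp

text \<open>\<open>N\<close> has weight 0, so the equation \<open>N u = s a u\<close> splits into
  the same equation for each weight component.\<close>

lemma W0_decomposition:
  assumes u: "u \<in> W 0"
  shows "\<exists>A w. finite A \<and> (\<forall>n. w n \<in> G n \<and> w n \<in> W 0) \<and> (\<forall>n. n \<notin> A \<longrightarrow> w n = 0) \<and> u = sum w A"
proof -
  have "u \<in> span (\<Union>n\<in>UNIV. G n)" using C_eq_span_G eigsp_C[OF u] by simp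
  from span_Union_subspaces[OF G_subspace this]
  obtain A w where A: "finite A" "\<forall>n. w n \<in> G n" "\<forall>n. n \<notin> A \<longrightarrow> w n = 0" "u = sum w A"
    by blast
  have wG: "w n \<in> G n" for n using A(2) by simp
  note wC = G_C[OF wG]
  let ?r = "\<lambda>n. N (w n) - s a (w n)"
  have "N u = (\<Sum>n\<in>A. N (w n))" unfolding A(4) by (rule lin_sum[OF lin_N wC])
  then have "sum ?r A = N u - s a u"
    by (simp add: sum_subtractf scale_sum_right A(4))
  then have r0: "sum ?r A = 0" using u by (simp add: eigsp_def)
  have rG: "?r n \<in> G (n + 0)" for n
    using homog_G[OF homog_N wG] wG
    by (intro subspace_diff[OF G_subspace] subspace_scale[OF G_subspace]) simp_all
  have "?r n = 0" for n
  proof (cases "n \<in> A")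
    case True
    show ?thesis by (rule G_sum_zero[OF A(1) rG r0 True])
  next
    case False
    then show ?thesis using A(3) lin_0[OF lin_N] by simp
  qed
  then have "w n \<in> W 0" for n using wC by (simp add: eigsp_def)
  then show ?thesis using A wG by blast
qed

text \<open>Shifting the weight-\<open>n\<close> component of \<open>W 0\<close> by \<open>tr n\<close> embeds all of \<open>W 0\<close> into the
  finite-dimensional weight space \<open>G 0\<close>.\<close>
lemma fin_dim_W0: "fin_dim s (W 0)"
proof -
  obtain d where d: "\<And>w::nat \<Rightarrow> 'v. (\<And>j. j \<le> d \<Longrightarrow> w j \<in> G 0) \<Longrightarrow>
    \<exists>c. (\<exists>j\<le>d. c j \<noteq> 0) \<and> (\<Sum>j\<le>d. s (c j) (w j)) = 0"
    using fin_dim_relation[OF G0(1)] by blast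
  show ?thesis
  proof (rule fin_dim_if_relation)
    fix w :: "nat \<Rightarrow> 'v" assume w: "\<And>j. j \<le> d \<Longrightarrow> w j \<in> W 0"
    have "\<forall>j. \<exists>A x. j \<le> d \<longrightarrow> finite A \<and> (\<forall>n. x n \<in> G n \<and> x n \<in> W 0) \<and> (\<forall>n. n \<notin> A \<longrightarrow> x n = 0) \<and> w j = sum x A"
    proof
      fix j
      show "\<exists>A x. j \<le> d \<longrightarrow> finite A \<and> (\<forall>n. x n \<in> G n \<and> x n \<in> W 0) \<and> (\<forall>n. n \<notin> A \<longrightarrow> x n = 0) \<and> w j = sum x A"
      proof (cases "j \<le> d")
        case True
        then show ?thesis using W0_decomposition[OF w[OF True]] by simp
      qed simp
    qed
    then obtain A x where Ax: "\<And>j. j \<le> d \<Longrightarrow> finite (A j) \<and> (\<forall>n. x j n \<in> G n \<and> x j n \<in> W 0)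
        \<and> (\<forall>n. n \<notin> A j \<longrightarrow> x j n = 0) \<and> w j = sum (x j) (A j)"
      by metis
    \<comment> \<open>One index set for all \<open>w j\<close>, so that their weight components can
      be combined.\<close>
    define B where "B = (\<Union>j\<le>d. A j)"
    have B: "finite B" using Ax by (auto simp: B_def)
    have wB: "w j = sum (x j) B" if "j \<le> d" for j
    proof -
      have "sum (x j) B = sum (x j) (A j)"
        by (rule sum.mono_neutral_right) (use Ax[OF that] B that in \<open>auto simp: B_def\<close>)
      then show ?thesis using Ax[OF that] by simp
    qed
    have xC: "x j n \<in> C" if "j \<le> d" for j n using Ax[OF that] eigsp_C by blast
    have "(\<Sum>n\<in>B. tr n (x j n)) \<in> G 0" if "j \<le> d" for j
    proof (intro subspace_sum[OF G_subspace])
      fix n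
      show "tr n (x j n) \<in> G 0" using tr_G[of "x j n" n n] Ax[OF that] by simp
    qed
    then obtain c where c: "\<exists>j\<le>d. c j \<noteq> 0" "(\<Sum>j\<le>d. s (c j) (\<Sum>n\<in>B. tr n (x j n))) = 0"
      using d[of "\<lambda>j. \<Sum>n\<in>B. tr n (x j n)"] by blast
    define y where "y n = (\<Sum>j\<le>d. s (c j) (x j n))" for n
    have yW: "y n \<in> W 0" for n
      unfolding y_def using Ax by (intro subspace_sum[OF eigsp_subspace] subspace_scale[OF eigsp_subspace]) auto
    have "(\<Sum>n\<in>B. tr n (y n)) = (\<Sum>n\<in>B. \<Sum>j\<le>d. s (c j) (tr n (x j n)))"
      unfolding y_def
    proof (intro sum.cong refl)
      fix n
      have "tr n (\<Sum>j\<le>d. s (c j) (x j n)) = (\<Sum>j\<le>d. tr n (s (c j) (x j n)))"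
        by (rule lin_sum[OF lin_tr]) (use xC in simp)
      then show "tr n (\<Sum>j\<le>d. s (c j) (x j n)) = (\<Sum>j\<le>d. s (c j) (tr n (x j n)))"
        using xC by (simp add: lin_scale[OF lin_tr])
    qed
    also have "\<dots> = (\<Sum>j\<le>d. s (c j) (\<Sum>n\<in>B. tr n (x j n)))"
      by (subst sum.swap) (simp add: scale_sum_right)
    finally have "(\<Sum>n\<in>B. tr n (y n)) = 0" using c by simp
    \<comment> \<open>These vectors all have weight 0, but \<open>tr n (y n)\<close> lies in
      \<open>W n\<close>, so the eigenvalues of \<open>N\<close> separate them.\<close>
    then have "tr n (y n) = 0" if "n \<in> B" for n
      using E_sum_zero[OF B, of "\<lambda>n. tr n (y n)" n] tr_E[OF yW] that by simp
    then have y0: "y n = 0" if "n \<in> B" for n using tr_inj eigsp_C[OF yW] that by blast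
    have "(\<Sum>j\<le>d. s (c j) (w j)) = (\<Sum>j\<le>d. \<Sum>n\<in>B. s (c j) (x j n))"
      by (intro sum.cong refl) (simp add: wB scale_sum_right)
    also have "\<dots> = (\<Sum>n\<in>B. y n)" unfolding y_def by (rule sum.swap)
    also have "\<dots> = 0" using y0 by simp
    finally show "\<exists>c. (\<exists>j\<le>d. c j \<noteq> 0) \<and> (\<Sum>j\<le>d. s (c j) (w j)) = 0" using c(1) by blast
  qed
qed

section \<open>The isomorphism with the tensor product\<close>

abbreviation "TC \<equiv> tens_carrier (W 0)"

text \<open>The map taking x^j tensor v to \<open>tr j v\<close>; the isomorphism of the theorem is
  its inverse.\<close>

definition psi :: "(int \<Rightarrow> 'v) \<Rightarrow> 'v" where
  "psi g = (\<Sum>j\<in>{j. g j \<noteq> 0}. tr j (g j))"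

lemma TC_D: "g \<in> TC \<Longrightarrow> finite {j. g j \<noteq> 0}" "g \<in> TC \<Longrightarrow> g j \<in> W 0" "g \<in> TC \<Longrightarrow> g j \<in> C"
  using eigsp_C by (auto simp: tens_carrier_def)

lemma psi_eq: "finite A \<Longrightarrow> (\<And>j. j \<notin> A \<Longrightarrow> g j = 0) \<Longrightarrow> psi g = (\<Sum>j\<in>A. tr j (g j))"
  unfolding psi_def by (rule sum.mono_neutral_left) (auto simp: lin_0[OF lin_tr])

lemma psi_C: "g \<in> TC \<Longrightarrow> psi g \<in> C"
  unfolding psi_def using TC_D by (intro C_closed(6) tr_C) blast

lemma TC_add: "g \<in> TC \<Longrightarrow> g' \<in> TC \<Longrightarrow> g + g' \<in> TC"
proof -
  assume g: "g \<in> TC" "g' \<in> TC"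
  have "finite {j. (g + g') j \<noteq> 0}"
    by (rule finite_subset[of _ "{j. g j \<noteq> 0} \<union> {j. g' j \<noteq> 0}"]) (use g TC_D(1) in auto)
  then show ?thesis using g subspace_add[OF eigsp_subspace] by (auto simp: tens_carrier_def)
qed

lemma psi_add: "g \<in> TC \<Longrightarrow> g' \<in> TC \<Longrightarrow> psi (g + g') = psi g + psi g'"
proof -
  assume g: "g \<in> TC" "g' \<in> TC"
  let ?A = "{j. g j \<noteq> 0} \<union> {j. g' j \<noteq> 0}"
  have A: "finite ?A" using g TC_D(1) by auto
  have "psi (g + g') = (\<Sum>j\<in>?A. tr j (g j + g' j))" by (subst psi_eq[OF A]) auto
  also have "\<dots> = (\<Sum>j\<in>?A. tr j (g j)) + (\<Sum>j\<in>?A. tr j (g' j))"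
    using g TC_D(3) by (simp add: lin_add[OF lin_tr] sum.distrib)
  also have "\<dots> = psi g + psi g'" using psi_eq[OF A, of g] psi_eq[OF A, of g'] by simp
  finally show ?thesis .
qed

lemma TC_shift:
  assumes g: "g \<in> TC"
  shows "(\<lambda>j. s (c j) (g (j + d))) \<in> TC"
proof -
  have "{j. s (c j) (g (j + d)) \<noteq> 0} \<subseteq> (\<lambda>i. i - d) ` {i. g i \<noteq> 0}"
  proof
    fix j assume "j \<in> {j. s (c j) (g (j + d)) \<noteq> 0}"
    then have "g (j + d) \<noteq> 0" by auto
    then show "j \<in> (\<lambda>i. i - d) ` {i. g i \<noteq> 0}" by (intro image_eqI[of _ _ "j + d"]) auto
  qed
  then have "finite {j. s (c j) (g (j + d)) \<noteq> 0}"
    using finite_surj[OF TC_D(1)[OF g]] by blast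
  then show ?thesis using TC_D(2)[OF g] subspace_scale[OF eigsp_subspace] by (auto simp: tens_carrier_def)
qed

lemma psi_shift:
  assumes g: "g \<in> TC"
  shows "psi (\<lambda>j. s (c j) (g (j + d))) = (\<Sum>i\<in>{i. g i \<noteq> 0}. s (c (i - d)) (tr (i - d) (g i)))"
proof -
  let ?A = "(\<lambda>i. i - d) ` {i. g i \<noteq> 0}"
  have out: "s (c j) (g (j + d)) = 0" if "j \<notin> ?A" for j
  proof -
    have "g (j + d) = 0" using that by (force simp: image_iff)
    then show ?thesis by simp
  qed
  have "psi (\<lambda>j. s (c j) (g (j + d))) = (\<Sum>j\<in>?A. tr j (s (c j) (g (j + d))))"
    by (rule psi_eq) (use out TC_D(1)[OF g] in auto)
  also have "\<dots> = (\<Sum>i\<in>{i. g i \<noteq> 0}. tr (i - d) (s (c (i - d)) (g (i - d + d))))"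
    by (subst sum.reindex) (auto simp: inj_on_def)
  also have "\<dots> = (\<Sum>i\<in>{i. g i \<noteq> 0}. s (c (i - d)) (tr (i - d) (g i)))"
    using TC_D(3)[OF g] by (simp add: lin_scale[OF lin_tr])
  finally show ?thesis .
qed

lemma psi_scale: "g \<in> TC \<Longrightarrow> psi (tens_scale s c g) = s c (psi g)"
  using psi_shift[of g "\<lambda>_. c" 0] by (simp add: tens_scale_def psi_def scale_sum_right)

lemma TC_map:
  assumes g: "g \<in> TC" and T: "lin T" "\<And>v. v \<in> W 0 \<Longrightarrow> T v \<in> W 0"
  shows "(\<lambda>j. T (g j)) \<in> TC"
proof -
  have "finite {j. T (g j) \<noteq> 0}"
    by (rule finite_subset[OF _ TC_D(1)[OF g]]) (auto simp: lin_0[OF T(1)])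
  then show ?thesis using TC_D(2)[OF g] T(2) by (auto simp: tens_carrier_def)
qed

lemma psi_map:
  assumes g: "g \<in> TC" and T: "lin T" "\<And>v j. v \<in> C \<Longrightarrow> T (tr j v) = tr j (T v)"
  shows "psi (\<lambda>j. T (g j)) = T (psi g)"
proof -
  have "psi (\<lambda>j. T (g j)) = (\<Sum>j\<in>{j. g j \<noteq> 0}. tr j (T (g j)))"
    by (rule psi_eq) (use TC_D(1)[OF g] lin_0[OF T(1)] in auto)
  then show ?thesis
    using TC_D(3)[OF g] by (simp add: psi_def lin_sum[OF T(1)] T(2))
qed

text \<open>\<open>C\<close> is the direct sum of the \<open>W j\<close>, and \<open>tr j\<close>
  identifies \<open>W 0\<close> with \<open>W j\<close>; the preimage of a component in
  \<open>W n\<close> is found with \<open>tr (- n)\<close>.\<close>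

lemma psi_bij: "bij_betw psi TC C"
  unfolding bij_betw_def
proof
  show "inj_on psi TC"
  proof (rule inj_onI)
    fix g g' assume g: "g \<in> TC" "g' \<in> TC" and eq: "psi g = psi g'"
    let ?A = "{j. g j \<noteq> 0} \<union> {j. g' j \<noteq> 0}"
    have A: "finite ?A" using g TC_D(1) by auto
    have "(\<Sum>j\<in>?A. tr j (g j - g' j)) = (\<Sum>j\<in>?A. tr j (g j)) - (\<Sum>j\<in>?A. tr j (g' j))"
      using g TC_D(3) by (simp add: lin_diff[OF lin_tr] sum_subtractf)
    also have "\<dots> = 0" using psi_eq[OF A, of g] psi_eq[OF A, of g'] eq by simp
    finally have 0: "(\<Sum>j\<in>?A. tr j (g j - g' j)) = 0" .
    have dW: "g j - g' j \<in> W 0" for j using g TC_D(2) by (intro subspace_diff[OF eigsp_subspace]) auto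
    show "g = g'"
    proof
      fix j
      show "g j = g' j"
      proof (cases "j \<in> ?A")
        case True
        have "tr j (g j - g' j) = 0"
          by (rule E_sum_zero[OF A _ 0 True]) (use tr_E[OF dW] in simp)
        then show ?thesis using tr_inj[of "g j - g' j" j] eigsp_C[OF dW] by simp
      qed simp
    qed
  qed
  show "psi ` TC = C"
  proof
    show "psi ` TC \<subseteq> C" using psi_C by blast
    show "C \<subseteq> psi ` TC"
    proof
      fix v assume "v \<in> C"
      then have "v \<in> span (\<Union>k\<in>UNIV. W k)" using C_eq_span_W by simp
      from span_Union_subspaces[OF eigsp_subspace this]
      obtain A w where A: "finite A" "\<forall>n. w n \<in> W n" "\<forall>n. n \<notin> A \<longrightarrow> w n = 0" "v = sum w A"
        by blast
      have wW: "w n \<in> W n" for n using A(2) by simp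
      let ?g = "\<lambda>n. tr (- n) (w n)"
      have supp: "?g n = 0" if "n \<notin> A" for n using A(3) that lin_0[OF lin_tr] by simp
      have "{j. ?g j \<noteq> 0} \<subseteq> A" using supp by blast
      then have "finite {j. ?g j \<noteq> 0}" using A(1) finite_subset by blast
      moreover have "?g n \<in> W 0" for n using tr_E[OF wW, of "- n" n] by simp
      ultimately have "?g \<in> TC" by (simp add: tens_carrier_def)
      moreover have "psi ?g = v"
        using psi_eq[OF A(1), of ?g] supp eigsp_C[OF wW] by (simp add: tr_tr A(4))
      ultimately show "v \<in> psi ` TC" by blast
    qed
  qed
qed

abbreviation "TA \<equiv> tens_act s (Dg a zd) (sl2_ext actN)"

lemma tens_act_formula:
  assumes g: "g \<in> TC" and D: "\<And>i j. Dg a zd b (delta i) j = c j * delta i (j + d)"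
  shows "TA b g = (\<lambda>j. s (c j) (g (j + d))) + (\<lambda>j. sl2_ext actN b (g j))"
  unfolding tens_act_def D using delta_sum[OF vector_space_axioms TC_D(1)[OF g]] by (auto simp: plus_fun_def)

lemma p0_tr2: "v \<in> W 0 \<Longrightarrow> p0 (p0 (tr j v)) = s (zd * zd * (a + of_int j) * (a + of_int (j - 1))) (tr (j - 2) v)"
proof -
  assume v: "v \<in> W 0"
  have j: "j - 1 - 1 = j - 2" by simp
  have c: "- zd * (a + of_int j) * (- zd * (a + of_int (j - 1))) = zd * zd * (a + of_int j) * (a + of_int (j - 1))"
    by simp
  have "p0 (p0 (tr j v)) = s (- zd * (a + of_int j)) (p0 (tr (j - 1) v))"
    unfolding p0_tr[OF v, of j] by (rule lin_scale[OF lin_p0 tr_C[OF eigsp_C[OF v]]])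
  also have "\<dots> = s (zd * zd * (a + of_int j) * (a + of_int (j - 1))) (tr (j - 2) v)"
    unfolding p0_tr[OF v, of "j - 1"] scale_scale c j ..
  finally show ?thesis .
qed

lemma p1_tr2: "v \<in> C \<Longrightarrow> p1 (p1 (tr j v)) = tr (j + 2) v"
  using p1_tr[of v j] p1_tr[of v "j + 1"] by (simp add: add.assoc)

lemma psi_lin: "lin T \<Longrightarrow> g \<in> TC \<Longrightarrow> T (psi g) = (\<Sum>i\<in>{i. g i \<noteq> 0}. T (tr i (g i)))"
  unfolding psi_def using TC_D(3) by (intro lin_sum) auto

lemma psi_intertwines:
  assumes g: "g \<in> TC"
  shows "TA (P 0) g \<in> TC \<and> psi (TA (P 0) g) = p0 (psi g)"
    and "TA (P (Suc 0)) g \<in> TC \<and> psi (TA (P (Suc 0)) g) = p1 (psi g)"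
    and "TA Z g \<in> TC \<and> psi (TA Z g) = s zd (psi g)"
    and "TA E g \<in> TC \<and> psi (TA E g) = e (psi g)"
    and "TA F g \<in> TC \<and> psi (TA F g) = f (psi g)"
    and "TA H g \<in> TC \<and> psi (TA H g) = h (psi g)"
proof -
  note D = Dg_delta[OF zd, of a]
  have ext: "sl2_ext actN (P k) = (\<lambda>_. 0)" "sl2_ext actN Z = (\<lambda>_. 0)"
    "sl2_ext actN E = e'" "sl2_ext actN F = f'" "sl2_ext actN H = h'" for k
    by (auto simp: sl2_ext_def sl2b_def actN_simps)
  have z: "k + (\<lambda>j. 0) = k" for k :: "int \<Rightarrow> 'v" by (auto simp: plus_fun_def)
  have gW: "g i \<in> W 0" and gC: "g i \<in> C" for i using TC_D[OF g] by auto
  note fin = TC_D(1)[OF g]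
  \<comment> \<open>\<open>T\<close> is the part of the generator coming from D, that is its image
    under \<Phi> acting on \<open>C\<close>, and \<open>X\<close> is its sl2 part. Each case reduces
    to the effect of \<open>T\<close> on \<open>tr i (g i)\<close>.\<close>
  have base: "TA b g \<in> TC \<and> psi (TA b g) = T (psi g) + X (psi g)"
    if D: "\<And>i j. Dg a zd b (delta i) j = c j * delta i (j + d)"
      and X: "sl2_ext actN b = X" "lin X" "\<And>v. v \<in> W 0 \<Longrightarrow> X v \<in> W 0" "\<And>v j. v \<in> C \<Longrightarrow> X (tr j v) = tr j (X v)"
      and T: "lin T" "\<And>i. T (tr i (g i)) = s (c (i - d)) (tr (i - d) (g i))" for b c d T X
  proof -
    have eq: "TA b g = (\<lambda>j. s (c j) (g (j + d))) + (\<lambda>j. X (g j))"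
      using tens_act_formula[OF g D] X(1) by simp
    have "psi (\<lambda>j. s (c j) (g (j + d))) = T (psi g)"
      using psi_shift[OF g] psi_lin[OF T(1) g] T(2) by simp
    then show ?thesis
      unfolding eq using TC_add psi_add TC_shift[OF g] TC_map[OF g X(2,3)] psi_map[OF g X(2,4)] by simp
  qed
  have X0: "lin (\<lambda>_. 0)" "0 \<in> W 0" "\<And>j. tr j 0 = 0"
    using lin_0[OF lin_tr] subspace_0[OF eigsp_subspace] by (auto simp: lin_def)
  show "TA (P 0) g \<in> TC \<and> psi (TA (P 0) g) = p0 (psi g)"
    using base[OF D(2) ext(1) X0(1) _ _ lin_p0] X0 p0_tr[OF gW] by simp
  show "TA (P (Suc 0)) g \<in> TC \<and> psi (TA (P (Suc 0)) g) = p1 (psi g)"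
    using base[OF D(1) ext(1) X0(1) _ _ lin_p1] X0 p1_tr[OF gC] by simp
  show "TA Z g \<in> TC \<and> psi (TA Z g) = s zd (psi g)"
    using base[OF D(3) ext(2) X0(1) _ _ lin_smult[OF lin_id, of zd]] X0 by simp
  have "TA E g \<in> TC \<and> psi (TA E g) = s (- (1 / (2 * zd))) (p0 (p0 (psi g))) + e' (psi g)"
  proof (rule base[OF D(4) ext(3) lin_e'])
    show "lin (\<lambda>v. s (- (1 / (2 * zd))) (p0 (p0 v)))" by (rule lin_smult[OF lin_comp[OF lin_p0 lin_p0]])
    fix i
    \<comment> \<open>\<open>Dg_delta\<close> gives the coefficient at the target exponent, here
      \<open>i - 2\<close>; the left side is what two applications of \<open>p0\<close> produce from
      \<open>i\<close>.\<close>
    have "- (1 / (2 * zd)) * (zd * zd * (a + of_int i) * (a + of_int (i - 1)))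
        = - (zd / 2) * (a + of_int (i - 2 + 1)) * (a + of_int (i - 2 + 2))"
      using zd by (simp add: field_simps)
    then show "s (- (1 / (2 * zd))) (p0 (p0 (tr i (g i))))
        = s (- (zd / 2) * (a + of_int (i - 2 + 1)) * (a + of_int (i - 2 + 2))) (tr (i - 2) (g i))"
      unfolding p0_tr2[OF gW] scale_scale by simp
  qed (use eigsp_e' tr_e' in auto)
  then show "TA E g \<in> TC \<and> psi (TA E g) = e (psi g)" by (simp add: efh_eq)
  have "TA F g \<in> TC \<and> psi (TA F g) = s (1 / (2 * zd)) (p1 (p1 (psi g))) + f' (psi g)"
    by (rule base[OF D(5) ext(4) lin_f' _ _ lin_smult[OF lin_comp[OF lin_p1 lin_p1]]])
       (use eigsp_e' tr_f' p1_tr2[OF gC] in auto)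
  then show "TA F g \<in> TC \<and> psi (TA F g) = f (psi g)" by (simp add: efh_eq)
  have "TA H g \<in> TC \<and> psi (TA H g) = (- N (psi g) - s (1 / 2) (psi g)) + h' (psi g)"
  proof (rule base[OF D(6) ext(5) lin_h'])
    show "lin (\<lambda>v. - N v - s (1 / 2) v)"
      using lin_minus[OF lin_smult[OF lin_N, of "-1"] lin_smult[OF lin_id, of "1/2"]] by simp
    fix i
    have "N (tr i (g i)) = s (a + of_int i) (tr i (g i))" using tr_E[OF gW, of i i] by (simp add: eigsp_def)
    then show "- N (tr i (g i)) - s (1 / 2) (tr i (g i)) = s (- (a + of_int (i - 0)) - 1 / 2) (tr (i - 0) (g i))"
      by (simp add: scale_left_diff_distrib scale_left_distrib)
  qed (use eigsp_e' tr_h' in auto)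
  then show "TA H g \<in> TC \<and> psi (TA H g) = h (psi g)" by (simp add: efh_eq)
qed

lemma tensor_iso:
  assumes act: "act E = e" "act F = f" "act H = h" "\<And>k. act (P k) = p k" "\<And>v. v \<in> C \<Longrightarrow> act Z v = s zd v"
  shows "rep_iso (gb 0) s C act (tens_scale s) TC TA"
proof -
  define \<phi> where "\<phi> = inv_into TC psi"
  have \<phi>: "\<phi> v \<in> TC" "psi (\<phi> v) = v" if "v \<in> C" for v
    using psi_bij that by (auto simp: \<phi>_def bij_betw_def inv_into_into f_inv_into_f)
  have \<phi>I: "\<phi> (psi g) = g" if "g \<in> TC" for g
    using psi_bij that by (auto simp: \<phi>_def bij_betw_def inv_into_f_f)
  show ?thesis unfolding rep_iso_def
  proof (intro exI[of _ \<phi>] conjI ballI allI)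
    show "bij_betw \<phi> C TC" unfolding \<phi>_def by (rule bij_betw_inv_into[OF psi_bij])
    show "\<phi> (u + v) = \<phi> u + \<phi> v" if "u \<in> C" "v \<in> C" for u v
      using \<phi>I[of "\<phi> u + \<phi> v"] psi_add[of "\<phi> u" "\<phi> v"] TC_add \<phi> that by simp
    show "\<phi> (s c v) = tens_scale s c (\<phi> v)" if "v \<in> C" for c v
    proof -
      have "tens_scale s c (\<phi> v) \<in> TC"
        using TC_shift[OF \<phi>(1)[OF that], of "\<lambda>_. c" 0] by (simp add: tens_scale_def)
      then show ?thesis using \<phi>I[of "tens_scale s c (\<phi> v)"] psi_scale \<phi> that by simp
    qed
    show "\<phi> (act b v) = TA b (\<phi> v)" if b: "b \<in> gb 0" and v: "v \<in> C" for b v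
    proof -
      have 01: "p0 = p 0" "p1 = p (Suc 0)" by (simp_all add: p0_def p1_def)
      consider "b = E" | "b = F" | "b = H" | "b = Z" | "b = P 0" | "b = P (Suc 0)"
        using b by (auto simp: gb_def le_Suc_eq)
      then have "TA b (\<phi> v) \<in> TC \<and> psi (TA b (\<phi> v)) = act b v"
        by cases (simp_all add: psi_intertwines[OF \<phi>(1)[OF v]] act \<phi>(2)[OF v] v 01)
      then show ?thesis using \<phi>I[of "TA b (\<phi> v)"] by simp
    qed
  qed
qed

end

section \<open>Passage between representations and the locale\<close>

lemma galilei_module_of_simple_rep:
  assumes simple: "simple_rep m (gb m) s C act" and z: "\<And>v. v \<in> C \<Longrightarrow> act Z v = s zd v"
    and wt: "weight_space s C act \<mu> \<noteq> {0}" "fin_dim s (weight_space s C act \<mu>)"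
  shows "galilei_module s C m (2 * m + 1) (act E) (act F) (act H) (\<lambda>k. act (P k))
    (\<lambda>k. zd * ((-1) ^ (k + m + 1) * fact k * fact (2 * m + 1 - k))) \<mu>"
proof -
  have rep: "rep_on m (gb m) s C act" using simple by (simp add: simple_rep_def)
  interpret vector_space s using rep by (simp add: rep_on_def)
  have sub: "subspace C" using rep by (simp add: rep_on_def)
  interpret carrier_space s C by unfold_locales (rule sub)
  have lin: "lin (act b)" if "b \<in> gb m" for b
    using rep that by (auto simp: rep_on_def lin_def)
  have mem: "E \<in> gb m" "F \<in> gb m" "H \<in> gb m" "Z \<in> gb m" "\<And>k. k \<le> 2 * m + 1 \<Longrightarrow> P k \<in> gb m"
    by (auto simp: gb_def)
  have brk: "act b (act b' v) = act b' (act b v) + sum_list (map (\<lambda>(c, g). s c (act g v)) (br m b b'))"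
    if "b \<in> gb m" "b' \<in> gb m" "v \<in> C" for b b' v
  proof -
    have "act b (act b' v) - act b' (act b v) = sum_list (map (\<lambda>(c, g). s c (act g v)) (br m b b'))"
      using rep that by (auto simp: rep_on_def)
    then show ?thesis by (simp add: diff_eq_eq add.commute)
  qed
  show ?thesis
  proof (unfold_locales, goal_cases)
    case (9 k v)
    have "of_int (int (2 * m + 1) - 2 * int k) = 2 * (of_nat m + 1 / 2 - of_nat k :: complex)"
      by (simp add: algebra_simps)
    then show ?case using brk[OF mem(3) mem(5)[OF 9(1)] 9(2)] by simp
  next
    case (14 k j v)
    show ?case using brk[OF mem(5)[OF 14(1)] mem(5)[OF 14(2)] 14(3)] z[OF 14(3)] by (simp add: mult.commute)
  next
    case (15 U)
    have "act b v \<in> U" if bm: "b \<in> gb m" and vU: "v \<in> U" for b v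
    proof -
      consider "b = E" | "b = F" | "b = H" | "b = Z" | k where "k \<le> 2 * m + 1" "b = P k"
        using bm by (auto simp: gb_def)
      then show ?thesis
      proof cases
        case 4
        \<comment> \<open>Invariance under \<open>Z\<close> is automatic for a scalar, which lets
          the locale test submodules without it.\<close>
        have "act Z v = s zd v" using z vU 15(2) by blast
        then show ?thesis using 4 subspace_scale[OF 15(1) vU] by simp
      qed (use vU 15 in auto)
    qed
    then have "invariant_subspace (gb m) s C act U"
      using 15 by (simp add: invariant_subspace_def)
    then show ?case using simple by (simp add: simple_rep_def)
  next
    case 16
    show ?case using wt(1) by (simp add: weight_space_def)
  next
    case 17
    show ?case using wt(2) by (simp add: weight_space_def)
  next
    case (6 v)
    show ?case using brk[OF mem(3) mem(1) 6] by simp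
  next
    case (7 v)
    show ?case using brk[OF mem(3) mem(2) 7] by simp
  next
    case (8 v)
    show ?case using brk[OF mem(1) mem(2) 8] by simp
  next
    case (10 v)
    show ?case using brk[OF mem(1) mem(5)[of 0] 10] by simp
  next
    case (11 k v)
    show ?case using brk[OF mem(1) mem(5)[of "Suc k"] 11(2)] 11(1) by simp
  next
    case (12 v)
    show ?case using brk[OF mem(2) mem(5)[of "2 * m + 1"] 12] by simp
  next
    case (13 k v)
    show ?case using brk[OF mem(2) mem(5)[of k] 13(2)] 13(1) by simp
  qed (use lin mem in simp_all)
qed

lemma submodule_generated_simple:
  assumes simple: "simple_rep m (gb m) s C act" and v: "v \<in> C" "v \<noteq> 0"
  shows "submodule_generated (gb m) s C act v = C"
proof -
  have "invariant_subspace (gb m) s C act C"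
    using simple by (auto simp: simple_rep_def rep_on_def invariant_subspace_def)
  moreover have "U = C" if "invariant_subspace (gb m) s C act U" "v \<in> U" for U
    using simple that v by (auto simp: simple_rep_def)
  ultimately show ?thesis using v(1) unfolding submodule_generated_def by blast
qed

text \<open>When the generators outside sl2 act by zero, both algebras have the same submodules, and
  the identity is the isomorphism.\<close>

lemma uncharged_restricts_to_sl2:
  assumes simple: "simple_rep m (gb m) s C act"
    and zero: "\<And>b v. b \<in> gb m \<Longrightarrow> b \<notin> sl2b \<Longrightarrow> v \<in> C \<Longrightarrow> act b v = 0"
  shows "simple_rep m sl2b s C act" "rep_iso (gb m) s C act s C (sl2_ext act)"
proof -
  have sub: "sl2b \<subseteq> gb m" by (auto simp: sl2b_def gb_def)
  have rep: "rep_on m (gb m) s C act" using simple by (simp add: simple_rep_def)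
  interpret vector_space s using rep by (simp add: rep_on_def)
  have "rep_on m sl2b s C act"
    unfolding rep_on_def
  proof (intro conjI)
    show "\<forall>b\<in>sl2b. \<forall>v\<in>C. act b v \<in> C" "\<forall>b\<in>sl2b. \<forall>u\<in>C. \<forall>v\<in>C. act b (u + v) = act b u + act b v"
      "\<forall>b\<in>sl2b. \<forall>c. \<forall>v\<in>C. act b (s c v) = s c (act b v)"
      "\<forall>b\<in>sl2b. \<forall>b'\<in>sl2b. \<forall>v\<in>C. act b (act b' v) - act b' (act b v)
        = sum_list (map (\<lambda>(c, g). s c (act g v)) (br m b b'))"
      using rep sub unfolding rep_on_def by (meson subsetD)+
  qed (use rep in \<open>simp_all add: rep_on_def\<close>)
  moreover have "U = {0} \<or> U = C" if "invariant_subspace sl2b s C act U" for U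
  proof -
    have "act b v \<in> U" if "b \<in> gb m" "v \<in> U" for b v
      using that \<open>invariant_subspace sl2b s C act U\<close> zero[of b v] subspace_0[of U]
      by (cases "b \<in> sl2b") (auto simp: invariant_subspace_def)
    then have "invariant_subspace (gb m) s C act U"
      using that by (simp add: invariant_subspace_def)
    then show ?thesis using simple by (simp add: simple_rep_def)
  qed
  ultimately show "simple_rep m sl2b s C act" using simple by (simp add: simple_rep_def)
  show "rep_iso (gb m) s C act s C (sl2_ext act)"
    unfolding rep_iso_def
    by (intro exI[of _ "\<lambda>v. v"]) (use zero in \<open>auto simp: bij_betw_def sl2_ext_def\<close>)
qed

theorem theorem6:
  fixes m :: nat
    and s :: "complex \<Rightarrow> 'v::ab_group_add \<Rightarrow> 'v"
    and C :: "'v set"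
    and act :: "gbasis \<Rightarrow> 'v \<Rightarrow> 'v"
  assumes simple: "simple_rep m (gb m) s C act"
    and weight: "weight_module s C act"
    and fdws: "\<exists>mu. weight_space s C act mu \<noteq> {0} \<and> fin_dim s (weight_space s C act mu)"
  shows "((\<forall>v\<in>C. act Z v = 0) \<longrightarrow>
           (\<exists>CN actN. simple_rep m sl2b s CN actN \<and> weight_module s CN actN \<and>
              rep_iso (gb m) s C act s CN (sl2_ext actN)))
       \<and> (\<forall>zd. zd \<noteq> 0 \<and> (\<forall>v\<in>C. act Z v = s zd v) \<longrightarrow>
           (hw_module m s C act \<or> lw_module m s C act) \<or>
           (m = 0 \<and> (\<exists>a. a \<notin> \<int> \<and> (\<exists>CN actN. simple_rep m sl2b s CN actN \<and> fin_dim s CN \<and>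
              rep_iso (gb m) s C act (tens_scale s) (tens_carrier CN)
                 (tens_act s (Dg a zd) (sl2_ext actN))))))"
proof (intro conjI impI allI)
  note rep = simple
  obtain mu where mu: "weight_space s C act mu \<noteq> {0}" "fin_dim s (weight_space s C act mu)"
    using fdws by blast
  have gmod: "gmod m s C act" using rep by (simp add: simple_rep_def)
  interpret vector_space s using gmod by (simp add: rep_on_def)
  {
    assume z: "\<forall>v\<in>C. act Z v = 0"
    \<comment> \<open>The factor \<open>0 *\<close> is the instance \<open>zd = 0\<close> of the
      general form of \<open>\<kappa>\<close>.\<close>
    interpret galilei_module s C m "2 * m + 1" "act E" "act F" "act H" "\<lambda>k. act (P k)"
      "\<lambda>k. 0 * ((-1) ^ (k + m + 1) * fact k * fact (2 * m + 1 - k))" mu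
      by (rule galilei_module_of_simple_rep[OF rep _ mu]) (use z in simp)
    have "act b v = 0" if "b \<in> gb m" "b \<notin> sl2b" "v \<in> C" for b v
      using that uncharged_trivial z by (auto simp: gb_def sl2b_def)
    from uncharged_restricts_to_sl2[OF rep this] weight
    show "\<exists>CN actN. simple_rep m sl2b s CN actN \<and> weight_module s CN actN \<and>
              rep_iso (gb m) s C act s CN (sl2_ext actN)" by blast
  }
  fix zd assume charge: "zd \<noteq> 0 \<and> (\<forall>v\<in>C. act Z v = s zd v)"
  define \<kappa> where "\<kappa> = (\<lambda>k. zd * ((-1) ^ (k + m + 1) * fact k * fact (2 * m + 1 - k)))"
  interpret galilei_module s C m "2 * m + 1" "act E" "act F" "act H" "\<lambda>k. act (P k)" \<kappa> mu
    unfolding \<kappa>_def by (rule galilei_module_of_simple_rep[OF rep _ mu]) (use charge in simp)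
  have hw: "hw_module m s C act"
    if "v \<in> C" "v \<noteq> 0" "act H v = s \<nu> v" "act E v = 0" "\<forall>k\<le>m. act (P k) v = 0" for v \<nu>
    unfolding hw_module_def using that gmod charge submodule_generated_simple[OF rep that(1,2)] by blast
  have lw: "lw_module m s C act"
    if "v \<in> C" "v \<noteq> 0" "act H v = s \<nu> v" "act F v = 0" "\<forall>k. m < k \<and> k \<le> 2 * m + 1 \<longrightarrow> act (P k) v = 0" for v \<nu>
    unfolding lw_module_def
    using that gmod charge submodule_generated_simple[OF rep that(1,2)] by (auto simp: Suc_le_eq)
  have "\<kappa> k \<noteq> 0" for k using charge by (simp add: \<kappa>_def)
  from charged_trichotomy[OF this]
  show "(hw_module m s C act \<or> lw_module m s C act) \<or>
           (m = 0 \<and> (\<exists>a. a \<notin> \<int> \<and> (\<exists>CN actN. simple_rep m sl2b s CN actN \<and> fin_dim s CN \<and>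
              rep_iso (gb m) s C act (tens_scale s) (tens_carrier CN)
                 (tens_act s (Dg a zd) (sl2_ext actN)))))"
  proof (elim disjE)
    assume dense: "m = 0 \<and> injop (act (P 0)) \<and> injop (act (P 1))"
    interpret dense_module s C m "2 * m + 1" "act E" "act F" "act H" "\<lambda>k. act (P k)" \<kappa> mu zd
      by unfold_locales (use dense charge in \<open>simp_all add: \<kappa>_def\<close>)
    obtain a u where au: "u \<in> G 0" "u \<noteq> 0" "N u = s a u" using N_eigenvector .
    interpret dense_module_eigen s C m "2 * m + 1" "act E" "act F" "act H" "\<lambda>k. act (P k)" \<kappa> mu zd a u
      by unfold_locales (use au G_C in auto)
    have zC: "act Z v = s zd v" if "v \<in> C" for v using charge that by simp
    have "rep_iso (gb m) s C act (tens_scale s) TC TA"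
      using tensor_iso[OF refl refl refl refl zC] dense by simp
    then show ?thesis using dense a_notin_Ints simple_W0 fin_dim_W0 by blast
  qed (use hw lw in blast)+
qed

end
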